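(* Let $\mathscr{H}=\ell\boxtimes\mathcal{H}$ be a homogeneous pre-foliation of type $(1,d)$ on $\mathbb{P}^2_{\mathbb{C}}$ with $d\geq3$. (1) If the line $\ell$ is invariant by $\mathcal{H}$, then the $d$-web $\mathrm{Leg}\,\mathscr{H}$ is flat if and only if its curvature $K(\mathrm{Leg}\,\mathscr{H})$ is holomorphic on $\mathcal{G}_{\mathcal{H}}(\mathrm{I}_{\mathcal{H}}^{\mathrm{tr}})$. (2) If the line $\ell$ is not invariant by $\mathcal{H}$, then the $d$-web $\mathrm{Leg}\,\mathscr{H}$ is flat if and only if its curvature $K(\mathrm{Leg}\,\mathscr{H})$ is holomorphic on $\mathcal{G}_{\mathcal{H}}(\mathrm{I}_{\mathcal{H}}^{\mathrm{tr}})\cup D_\ell=\mathcal{G}_{\mathcal{H}}(\mathrm{I}_{\mathcal{H}}^{\mathrm{tr}}\cup\ell)$, where $D_\ell=\mathcal{G}_{\mathcal{H}}(\ell)$.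
   Context: Homogeneous pre-foliations. A pre-foliation of type $(1,d)$ (co-degree $1$, degree $d$) on $\mathbb{P}^2_{\mathbb{C}}$ is a pair, written $\ell\boxtimes\mathcal H$, of a line $\ell$ and a holomorphic foliation $\mathcal H$ of degree $d-1$. It is homogeneous if in some affine chart $(x,y)$ it is invariant under all homotheties $(x,y)\mapsto\lambda(x,y)$; then $\ell$ passes through the origin $O$ or is the line at infinity $L_\infty$ (which is $\mathcal H$-invariant), and $\mathcal H$ is defined by $A\,dx+B\,dy$ with $A,B\in\mathbb{C}[x,y]_{d-1}$, $\gcd(A,B)=1$. Gauss maps and inflection. $\mathcal G_{\mathcal H}:\mathbb{P}^2_{\mathbb{C}}\dashrightarrow\check{\mathbb{P}}^2_{\mathbb{C}}$ sends a regular point $m$ to the tangent line at $m$ of the leaf through $m$; for a curve $C$, $\mathcal G_{\mathcal H}(C)$ is the closure of $\mathcal G_{\mathcal H}(C\setminus\mathrm{Sing}\,\mathcal H)$. Let $\underline{\mathcal G}_{\mathcal H}:\mathbb{P}^1_{\mathbb{C}}\to\mathbb{P}^1_{\mathbb{C}}$, $[y:x]\mapsto[-A(x,y):B(x,y)]$. The transverse inflection divisor is $\mathrm I_{\mathcal H}^{\mathrm{tr}}=\prod_iT_i^{n_i}$, where $T_i=(b_iy-a_ix=0)$ and $[a_i:b_i]$ runs over the non-fixed critical points of $\underline{\mathcal G}_{\mathcal H}$, of multiplicity $n_i$. For a line $T=(by-ax=0)$, not invariant by $\mathcal H$, $\mathcal G_{\mathcal H}(T)$ is the line of $\check{\mathbb{P}}^2_{\mathbb{C}}$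 given by $[p:1]=\underline{\mathcal G}_{\mathcal H}([a:b])$ in the chart $(p,q)$ below. Legendre transform. In the affine chart $(p,q)$ of $\check{\mathbb{P}}^2_{\mathbb{C}}$ associated to the line $\{y=px-q\}$, $\mathrm{Leg}\,\mathcal H$ is the $(d-1)$-web $A(x,px-q)+pB(x,px-q)=0$ with $x=dq/dp$; $\mathrm{Leg}\,\ell$ is the foliation by lines through the point dual to $\ell$ (given by $f(x,px-q)=0$, $x=dq/dp$, if $\ell=(f(x,y)=0)$; by $dp=0$ if $\ell=L_\infty$); $\mathrm{Leg}(\ell\boxtimes\mathcal H)=\mathrm{Leg}\,\ell\boxtimes\mathrm{Leg}\,\mathcal H$ is their superposition. Curvature. At a generic point a $d$-web $\mathcal W$ is a superposition $\mathcal F_1\boxtimes\cdots\boxtimes\mathcal F_d$ of pairwise transverse foliations, $\mathcal F_i:\omega_i=0$. Put $\omega_i\wedge\omega_j=\delta_{ij}\,dx\wedge dy$. For $r<s<t$ let $\eta_{rst}$ be the unique meromorphic 1-form with $d(\delta_{st}\omega_r)=\eta_{rst}\wedge\delta_{st}\omega_r$, $d(\delta_{tr}\omega_s)=\eta_{rst}\wedge\delta_{tr}\omega_s$, $d(\delta_{rs}\omega_t)=\eta_{rst}\wedge\delta_{rs}\omega_t$. The curvature $K(\mathcal W)=d\big(\sum_{r<s<t}\eta_{rst}\big)$ is a well-defined global meromorphic 2-form; $\mathcal W$ is flat if $K(\mathcal W)\equiv0$. "Holomorphic on (along) a curve" means holomorphic at the generic points of each irreducible component of the curve. *)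

theory Defs
  imports "HOL-Analysis.Analysis" "HOL-Computational_Algebra.Polynomial"
begin

section \<open>Pre-foliations on the projective plane\<close>

text \<open>
  Points \<open>[x:y:z]\<close> of the projective plane and points \<open>[u:v:w]\<close> of the dual plane (standing for
  the line \<open>u x + v y + w z = 0\<close>) are given by homogeneous coordinates; subsets of the two planes
  are given by the cones of all homogeneous coordinates of their points, without the zero vector.
  The affine chart \<open>(x,y)\<close> is \<open>z = 1\<close>, and the line at infinity is \<open>z = 0\<close>.

  An element of \<open>poly2\<close> is a polynomial in \<open>x,y\<close>, and one of \<open>poly3\<close> is a polynomial in
  \<open>x,y,z\<close>: the innermost variable is \<open>x\<close> and the outermost one is \<open>y\<close>, resp. \<open>z\<close>.
\<close>

type_synonym poly2 = "complex poly poly"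
type_synonym poly3 = "complex poly poly poly"
type_synonym vec3 = "complex \<times> complex \<times> complex"
type_synonym form3 = "poly3 \<times> poly3 \<times> poly3"

definition eval2 :: "poly2 \<Rightarrow> complex \<Rightarrow> complex \<Rightarrow> complex" where
  "eval2 P x y = poly (poly P [:y:]) x"

fun eval3 :: "poly3 \<Rightarrow> vec3 \<Rightarrow> complex" where
  "eval3 P (x, y, z) = eval2 (poly P [:[:z:]:]) x y"

definition homogeneous3 :: "nat \<Rightarrow> poly3 \<Rightarrow> bool" where
  "homogeneous3 m P \<longleftrightarrow>
     (\<forall>i j k. coeff (coeff (coeff P k) j) i \<noteq> 0 \<longrightarrow> i + j + k = m)"

text \<open>The pairing of a covector with a vector, also the value at \<open>(x,y,z)\<close> of a linear form.\<close>

fun pair3 :: "vec3 \<Rightarrow> vec3 \<Rightarrow> complex" where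
  "pair3 (u, v, w) (x, y, z) = u * x + v * y + w * z"

text \<open>The triple \<open>(a,b,c)\<close> stands for the 1-form \<open>a dx + b dy + c dz\<close>.\<close>

fun covector :: "form3 \<Rightarrow> vec3 \<Rightarrow> vec3" where
  "covector (a, b, c) m = (eval3 a m, eval3 b m, eval3 c m)"

text \<open>
  A foliation of degree \<open>n\<close>: a 1-form with homogeneous coefficients of degree \<open>n + 1\<close> without
  common factor (isolated singularities), annihilated by the radial vector field.
\<close>

fun foliation :: "nat \<Rightarrow> form3 \<Rightarrow> bool" where
  "foliation n (a, b, c) \<longleftrightarrow>
     homogeneous3 (n + 1) a \<and> homogeneous3 (n + 1) b \<and> homogeneous3 (n + 1) c \<and>
     (\<forall>m. pair3 (covector (a, b, c) m) m = 0) \<and>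
     (\<forall>g. g dvd a \<and> g dvd b \<and> g dvd c \<longrightarrow> g dvd 1)"

text \<open>The line \<open>\<ell>\<close> is given by its equation \<open>\<alpha> x + \<beta> y + \<gamma> z = 0\<close>.\<close>

definition prefoliation :: "nat \<Rightarrow> vec3 \<Rightarrow> form3 \<Rightarrow> bool" where
  "prefoliation d l H \<longleftrightarrow> d \<ge> 1 \<and> l \<noteq> 0 \<and> foliation (d - 1) H"

definition line :: "vec3 \<Rightarrow> vec3 set" where
  "line l = {m. m \<noteq> 0 \<and> pair3 l m = 0}"

fun homothety :: "complex \<Rightarrow> vec3 \<Rightarrow> vec3" where
  "homothety t (x, y, z) = (t * x, t * y, z)"

text \<open>
  Invariance of \<open>H\<close> under a homothety: the pulled back 1-form is a nonzero multiple of the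
  original one.
\<close>

definition homogeneous_prefoliation :: "nat \<Rightarrow> vec3 \<Rightarrow> form3 \<Rightarrow> bool" where
  "homogeneous_prefoliation d l H \<longleftrightarrow> prefoliation d l H \<and>
     (\<forall>t. t \<noteq> 0 \<longrightarrow>
        homothety t ` line l = line l \<and>
        (\<exists>k. k \<noteq> 0 \<and> (\<forall>m v. pair3 (covector H (homothety t m)) (homothety t v)
                              = k * pair3 (covector H m) v)))"

text \<open>A line is invariant if the 1-form vanishes on it (on the corresponding plane of \<open>\<complex>\<^sup>3\<close>).\<close>

definition invariant_line :: "vec3 \<Rightarrow> form3 \<Rightarrow> bool" where
  "invariant_line l H \<longleftrightarrow>
     (\<forall>m v. pair3 l m = 0 \<and> pair3 l v = 0 \<longrightarrow> pair3 (covector H m) v = 0)"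

text \<open>The coefficients of the 1-form \<open>A dx + B dy\<close> defining \<open>H\<close> in the affine chart \<open>z = 1\<close>.\<close>

fun affA :: "form3 \<Rightarrow> poly2" where
  "affA (a, b, c) = poly a 1"

fun affB :: "form3 \<Rightarrow> poly2" where
  "affB (a, b, c) = poly b 1"


section \<open>Gauss maps and transverse inflection\<close>

text \<open>
  The tangent line at a regular point \<open>m\<close> has the coordinates \<open>covector H m\<close>. The closure is
  that in the dual plane; on cones it is the closure in \<open>\<complex>\<^sup>3 - {0}\<close>.
\<close>

definition gauss_image :: "form3 \<Rightarrow> vec3 set \<Rightarrow> vec3 set" where
  "gauss_image H C =
     closure {(k * u, k * v, k * w) | k u v w.
                k \<noteq> 0 \<and> (u, v, w) \<noteq> 0 \<and> (\<exists>m\<in>C. (u, v, w) = covector H m)} - {0}"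

text \<open>The lift to \<open>\<complex>\<^sup>2\<close> of the self-map \<open>[y:x] \<mapsto> [-A(x,y):B(x,y)]\<close> of the projective line.\<close>

fun gauss_line_map :: "form3 \<Rightarrow> complex \<times> complex \<Rightarrow> complex \<times> complex" where
  "gauss_line_map H (y, x) = (- eval2 (affA H) x y, eval2 (affB H) x y)"

text \<open>
  The standard affine chart of the projective line around \<open>P\<close>, namely \<open>[t:1]\<close> or (around
  \<open>[1:0]\<close>) \<open>[1:t]\<close>, and the corresponding coordinate function.
\<close>

definition p1_param :: "complex \<times> complex \<Rightarrow> complex \<Rightarrow> complex \<times> complex" where
  "p1_param P t = (if snd P \<noteq> 0 then (t, 1) else (1, t))"

definition p1_coord :: "complex \<times> complex \<Rightarrow> complex \<times> complex \<Rightarrow> complex" where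
  "p1_coord P Q = (if snd P \<noteq> 0 then fst Q / snd Q else snd Q / fst Q)"

definition p1_critical ::
    "(complex \<times> complex \<Rightarrow> complex \<times> complex) \<Rightarrow> complex \<times> complex \<Rightarrow> bool" where
  "p1_critical G P \<longleftrightarrow> deriv (\<lambda>t. p1_coord (G P) (G (p1_param P t))) (p1_coord P P) = 0"

definition p1_fixed ::
    "(complex \<times> complex \<Rightarrow> complex \<times> complex) \<Rightarrow> complex \<times> complex \<Rightarrow> bool" where
  "p1_fixed G P \<longleftrightarrow> fst (G P) * snd P = snd (G P) * fst P"

text \<open>
  The support of the transverse inflection divisor: the union of the lines \<open>b y - a x = 0\<close>.
  The multiplicities of the divisor play no role for its image under the Gauss map.
\<close>

definition transverse_inflection :: "form3 \<Rightarrow> vec3 set" where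
  "transverse_inflection H =
     (\<Union>(a, b) \<in> {P. P \<noteq> 0 \<and> p1_critical (gauss_line_map H) P \<and> \<not> p1_fixed (gauss_line_map H) P}.
        line (- a, b, 0))"


section \<open>Webs in two variables and their curvature\<close>

text \<open>
  A 1-form \<open>e dp + f dq\<close> is given by the function with values \<open>(e,f)\<close>; a 2-form is given by its
  coefficient in front of \<open>dp \<and> dq\<close>. A web is given at each point by a binary form in
  \<open>(dp,dq)\<close>, whose zeros are the tangent directions of the leaves.
\<close>

type_synonym pt = "complex \<times> complex"
type_synonym form1 = "pt \<Rightarrow> complex \<times> complex"
type_synonym form2 = "pt \<Rightarrow> complex"
type_synonym web = "pt \<Rightarrow> complex \<Rightarrow> complex \<Rightarrow> complex"

definition holomorphic2_on :: "(pt \<Rightarrow> complex) \<Rightarrow> pt set \<Rightarrow> bool" where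
  "holomorphic2_on f U \<longleftrightarrow>
     open U \<and> (\<forall>z\<in>U. \<exists>a b. (f has_derivative (\<lambda>(h, k). a * h + b * k)) (at z))"

definition pd1 :: "(pt \<Rightarrow> complex) \<Rightarrow> pt \<Rightarrow> complex" where
  "pd1 f z = deriv (\<lambda>s. f (s, snd z)) (fst z)"

definition pd2 :: "(pt \<Rightarrow> complex) \<Rightarrow> pt \<Rightarrow> complex" where
  "pd2 f z = deriv (\<lambda>s. f (fst z, s)) (snd z)"

definition ext_deriv :: "form1 \<Rightarrow> form2" where
  "ext_deriv \<omega> z = pd1 (\<lambda>z. snd (\<omega> z)) z - pd2 (\<lambda>z. fst (\<omega> z)) z"

definition wedge :: "complex \<times> complex \<Rightarrow> complex \<times> complex \<Rightarrow> complex" where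
  "wedge v w = fst v * snd w - snd v * fst w"

definition delta :: "(nat \<Rightarrow> form1) \<Rightarrow> nat \<Rightarrow> nat \<Rightarrow> pt \<Rightarrow> complex" where
  "delta \<omega> i j z = wedge (\<omega> i z) (\<omega> j z)"

definition fmult :: "(pt \<Rightarrow> complex) \<Rightarrow> form1 \<Rightarrow> form1" where
  "fmult f \<omega> z = (f z * fst (\<omega> z), f z * snd (\<omega> z))"

text \<open>
  The three equations are linear in the value of \<open>\<eta>\<close> at \<open>z\<close> and determine it uniquely where the
  three foliations are transverse, so that \<open>\<eta>\<close> can be defined point by point.
\<close>

definition eta :: "(nat \<Rightarrow> form1) \<Rightarrow> nat \<Rightarrow> nat \<Rightarrow> nat \<Rightarrow> form1" where
  "eta \<omega> r s t z = (THE e.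
     ext_deriv (fmult (delta \<omega> s t) (\<omega> r)) z = wedge e (fmult (delta \<omega> s t) (\<omega> r) z) \<and>
     ext_deriv (fmult (delta \<omega> t r) (\<omega> s)) z = wedge e (fmult (delta \<omega> t r) (\<omega> s) z) \<and>
     ext_deriv (fmult (delta \<omega> r s) (\<omega> t)) z = wedge e (fmult (delta \<omega> r s) (\<omega> t) z))"

definition forms_curvature :: "nat \<Rightarrow> (nat \<Rightarrow> form1) \<Rightarrow> form2" where
  "forms_curvature d \<omega> =
     ext_deriv (\<lambda>z. \<Sum>(r, s, t) \<in> {(r, s, t). r < s \<and> s < t \<and> t < d}. eta \<omega> r s t z)"

text \<open>On \<open>U\<close>, the \<open>d\<close>-web \<open>W\<close> is the superposition of the foliations \<open>\<omega> 0 = 0, \<dots>, \<omega> (d - 1) = 0\<close>.\<close>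

definition superposition :: "nat \<Rightarrow> web \<Rightarrow> pt set \<Rightarrow> (nat \<Rightarrow> form1) \<Rightarrow> bool" where
  "superposition d W U \<omega> \<longleftrightarrow> open U \<and>
     (\<forall>i<d. holomorphic2_on (\<lambda>z. fst (\<omega> i z)) U \<and> holomorphic2_on (\<lambda>z. snd (\<omega> i z)) U) \<and>
     (\<forall>i<d. \<forall>j<d. i \<noteq> j \<longrightarrow> (\<forall>z\<in>U. delta \<omega> i j z \<noteq> 0)) \<and>
     (\<forall>z\<in>U. \<forall>dp dq. W z dp dq = 0 \<longleftrightarrow> (\<exists>i<d. fst (\<omega> i z) * dp + snd (\<omega> i z) * dq = 0))"

definition web_regular :: "nat \<Rightarrow> web \<Rightarrow> pt set" where
  "web_regular d W = {z. \<exists>U \<omega>. z \<in> U \<and> superposition d W U \<omega>}"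

text \<open>The values outside \<open>web_regular d W\<close> are meaningless and never used.\<close>

definition web_curvature :: "nat \<Rightarrow> web \<Rightarrow> form2" where
  "web_curvature d W z =
     (THE k. \<exists>U \<omega>. z \<in> U \<and> superposition d W U \<omega> \<and> k = forms_curvature d \<omega> z)"

definition flat_web :: "nat \<Rightarrow> web \<Rightarrow> bool" where
  "flat_web d W \<longleftrightarrow> (\<forall>z\<in>web_regular d W. web_curvature d W z = 0)"


section \<open>Legendre transform\<close>

text \<open>
  The binary form of degree \<open>n\<close> in \<open>(dp,dq)\<close> associated to the equation \<open>F(x) = 0\<close>,
  \<open>x = dq/dp\<close>, where \<open>F\<close> has degree at most \<open>n\<close>; the directions with \<open>dp = 0\<close> correspond to the
  root \<open>x = \<infinity>\<close>.
\<close>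

definition binary_form :: "nat \<Rightarrow> complex poly \<Rightarrow> complex \<Rightarrow> complex \<Rightarrow> complex" where
  "binary_form n F dp dq = (\<Sum>k\<le>n. coeff F k * dq ^ k * dp ^ (n - k))"

text \<open>
  The equation is \<open>f(x, p x - q) = 0\<close> with \<open>f(x,y) = \<alpha> x + \<beta> y + \<gamma>\<close>. For the line at infinity
  (\<open>\<alpha> = \<beta> = 0\<close>) the binary form is \<open>\<gamma> dp\<close>.
\<close>

fun leg_line :: "vec3 \<Rightarrow> web" where
  "leg_line (\<alpha>, \<beta>, \<gamma>) (p, q) = binary_form 1 [:\<gamma> - \<beta> * q, \<alpha> + \<beta> * p:]"

text \<open>
  \<open>poly A [:-q, p:]\<close> is \<open>A(x, p x - q)\<close> as a polynomial in \<open>x\<close>.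
\<close>

fun leg_foliation :: "nat \<Rightarrow> form3 \<Rightarrow> web" where
  "leg_foliation n H (p, q) =
     binary_form n (poly (affA H) [:- q, p:] + smult p (poly (affB H) [:- q, p:]))"

definition leg :: "nat \<Rightarrow> vec3 \<Rightarrow> form3 \<Rightarrow> web" where
  "leg d l H z dp dq = leg_line l z dp dq * leg_foliation (d - 1) H z dp dq"


section \<open>Holomorphy of the curvature along a curve of the dual plane\<close>

definition pullback2 :: "(pt \<Rightarrow> pt) \<Rightarrow> form2 \<Rightarrow> form2" where
  "pullback2 \<phi> k z = k (\<phi> z) *
     (pd1 (\<lambda>z. fst (\<phi> z)) z * pd2 (\<lambda>z. snd (\<phi> z)) z -
      pd2 (\<lambda>z. fst (\<phi> z)) z * pd1 (\<lambda>z. snd (\<phi> z)) z)"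

text \<open>
  The 2-form \<open>k\<close>, defined on the dense set \<open>R\<close> of the chart \<open>(p,q)\<close>, extends holomorphically to a
  neighbourhood of the point \<open>z0\<close> of another chart; \<open>\<phi>\<close> is the change of charts, defined on \<open>D\<close>.
\<close>

definition extends_at :: "pt set \<Rightarrow> form2 \<Rightarrow> pt set \<Rightarrow> (pt \<Rightarrow> pt) \<Rightarrow> pt \<Rightarrow> bool" where
  "extends_at R k D \<phi> z0 \<longleftrightarrow>
     (\<exists>N g. z0 \<in> N \<and> holomorphic2_on g N \<and>
            (\<forall>z\<in>N \<inter> D. \<phi> z \<in> R \<longrightarrow> g z = pullback2 \<phi> k z))"

text \<open>
  The charts of the dual plane are \<open>(p,q)\<close> for the line \<open>y = p x - q\<close>, i.e. \<open>[p:-1:-q]\<close>;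
  \<open>(p',q')\<close> for the line \<open>x = p' y - q'\<close>, i.e. \<open>[1:-p':q']\<close>; and \<open>(r,s)\<close> for \<open>[r:s:1]\<close>.
\<close>

fun holomorphic_at_dual :: "pt set \<Rightarrow> form2 \<Rightarrow> vec3 \<Rightarrow> bool" where
  "holomorphic_at_dual R k (u, v, w) \<longleftrightarrow>
     (if v \<noteq> 0 then extends_at R k UNIV (\<lambda>z. z) (- u / v, w / v)
      else if u \<noteq> 0 then extends_at R k {z. fst z \<noteq> 0} (\<lambda>(p', q'). (1 / p', - q' / p')) (0, w / u)
      else extends_at R k {z. snd z \<noteq> 0} (\<lambda>(r, s). (- r / s, 1 / s)) (0, 0))"

text \<open>
  Holomorphic at the generic points of each irreducible component of \<open>C\<close>. The locus where a
  meromorphic 2-form is not holomorphic is a curve, so it contains an irreducible component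
  of \<open>C\<close> or meets it in finitely many points; hence the condition says that the points of \<open>C\<close> at
  which the form is holomorphic are dense in \<open>C\<close>.
\<close>

definition curvature_holomorphic_on :: "nat \<Rightarrow> web \<Rightarrow> vec3 set \<Rightarrow> bool" where
  "curvature_holomorphic_on d W C \<longleftrightarrow>
     C \<subseteq> closure {\<xi> \<in> C. holomorphic_at_dual (web_regular d W) (web_curvature d W) \<xi>}"

end

theory Submission
  imports Defs "HOL-Complex_Analysis.Complex_Analysis"
    "HOL-Computational_Algebra.Fundamental_Theorem_Algebra"
begin

text \<open>
  Let \<open>H\<close> be given by \<open>A dx + B dy\<close> and \<open>\<ell>\<close> by \<open>y = s\<^sub>0 x\<close>. The leaves of the web through \<open>(p,q)\<close>
  are \<open>dq/q = dp/(p - s)\<close>, where \<open>s\<close> runs over \<open>s\<^sub>0\<close> and the points with Gauss image \<open>p\<close>, so the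
  web is invariant under \<open>q \<mapsto> \<lambda> q\<close> and its curvature is \<open>b'(p) dp \<and> dq/q\<close>. With \<open>M = p - s\<close>, the
  function \<open>b\<close> is the sum over all triples of branches of
  \<open>\<Sum> M\<^sub>i' M\<^sub>j M\<^sub>k / ((M\<^sub>i - M\<^sub>j) (M\<^sub>i - M\<^sub>k))\<close>, the outer sum being cyclic.
  It is single-valued and holomorphic outside a finite set.

  Let \<open>p\<^sub>0\<close> be such that no point over \<open>p\<^sub>0\<close> other than the fixed point \<open>p\<^sub>0\<close> is critical or equal
  to \<open>s\<^sub>0\<close>. The branches through the fixed point behave like the \<open>m\<close>-th roots of
  \<open>p - p\<^sub>0\<close>; hence the quotients \<open>M\<^sub>j / (M\<^sub>i - M\<^sub>j)\<close> are bounded, \<open>(p - p\<^sub>0) M\<^sub>i'\<close> tends to \<open>0\<close>, and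
  \<open>p\<^sub>0\<close> is not a pole of \<open>b\<close>. For every other \<open>p\<^sub>0\<close>, the line \<open>p = p\<^sub>0\<close> is a component of the curve
  along which the curvature is assumed to be holomorphic. So the form \<open>b'(p) dp\<close> is holomorphic on the
  projective line, and vanishes.
\<close>

section \<open>Holomorphic functions of two variables\<close>

text \<open>The sum over triples is forced by monodromy: going around a critical value permutes the
  branches, and only a symmetric expression descends to a function of p. So \<open>bsum\<close> runs
  over three-element sets of branches, while the curvature is defined with labelled forms;
  \<open>sum_clusters_indexed\<close> joins the two. The value p = infinity, vertical directions and
  roots escaping to infinity would each ask for separate care. Instead one Moebius map, P = 1/(p -
  c) and S = 1/(s - c), is applied to both projective lines. It keeps the fixed points of the Gauss
  map (S = P), and for all but finitely many c the points in question are finite. At a tame value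
  the estimate on b is only o(1/|P - P0|), which is enough at an isolated singularity. The
  hypothesis provides holomorphy only on a dense part of the curve; this suffices because the curve
  lies in finitely many lines p = const and the growth of b'(p) can be read off at a single point of
  each.\<close>

lemma holomorphic2_on_has_pd1:
  assumes "holomorphic2_on f U" "z \<in> U"
  shows "((\<lambda>s. f (s, snd z)) has_field_derivative pd1 f z) (at (fst z))"
proof -
  obtain a b where ab: "(f has_derivative (\<lambda>(h, k). a * h + b * k)) (at z)"
    using assms by (auto simp: holomorphic2_on_def)
  have "((\<lambda>s. (s, snd z)) has_derivative (\<lambda>h. (h, 0))) (at (fst z))"
    by (intro derivative_intros)
  from diff_chain_at[OF this, of f "\<lambda>(h, k). a * h + b * k"] ab
  have "((\<lambda>s. f (s, snd z)) has_field_derivative a) (at (fst z))"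
    by (simp add: has_field_derivative_def o_def)
  then show ?thesis by (simp add: pd1_def DERIV_imp_deriv)
qed

lemma holomorphic2_on_has_pd2:
  assumes "holomorphic2_on f U" "z \<in> U"
  shows "((\<lambda>s. f (fst z, s)) has_field_derivative pd2 f z) (at (snd z))"
proof -
  obtain a b where ab: "(f has_derivative (\<lambda>(h, k). a * h + b * k)) (at z)"
    using assms by (auto simp: holomorphic2_on_def)
  have "((\<lambda>s. (fst z, s)) has_derivative (\<lambda>h. (0, h))) (at (snd z))"
    by (intro derivative_intros)
  from diff_chain_at[OF this, of f "\<lambda>(h, k). a * h + b * k"] ab
  have "((\<lambda>s. f (fst z, s)) has_field_derivative b) (at (snd z))"
    by (simp add: has_field_derivative_def o_def)
  then show ?thesis by (simp add: pd2_def DERIV_imp_deriv)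
qed

lemma holomorphic2_on_open: "holomorphic2_on f U \<Longrightarrow> open U"
  by (simp add: holomorphic2_on_def)

lemma holomorphic2_on_continuous_on:
  assumes "holomorphic2_on f U"
  shows "continuous_on U f"
  unfolding continuous_on_eq_continuous_at[OF holomorphic2_on_open[OF assms]]
  using assms by (auto simp: holomorphic2_on_def intro: has_derivative_continuous)

lemma holomorphic2_on_subset:
  "holomorphic2_on f U \<Longrightarrow> open V \<Longrightarrow> V \<subseteq> U \<Longrightarrow> holomorphic2_on f V"
  by (auto simp: holomorphic2_on_def)

lemma holomorphic2_on_mult:
  assumes "holomorphic2_on f U" "holomorphic2_on g U"
  shows "holomorphic2_on (\<lambda>z. f z * g z) U"
  unfolding holomorphic2_on_def
proof (intro conjI ballI)
  show "open U" using assms by (simp add: holomorphic2_on_def)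
  fix z assume z: "z \<in> U"
  obtain a b where 1: "(f has_derivative (\<lambda>(h, k). a * h + b * k)) (at z)"
    using assms z by (auto simp: holomorphic2_on_def)
  obtain a' b' where 2: "(g has_derivative (\<lambda>(h, k). a' * h + b' * k)) (at z)"
    using assms z by (auto simp: holomorphic2_on_def)
  have "((\<lambda>z. f z * g z) has_derivative (\<lambda>(h, k). (f z * a' + a * g z) * h + (f z * b' + b * g z) * k)) (at z)"
    by (rule has_derivative_eq_rhs[OF has_derivative_mult[OF 1 2]]) (auto simp: fun_eq_iff algebra_simps)
  then show "\<exists>a b. ((\<lambda>z. f z * g z) has_derivative (\<lambda>(h, k). a * h + b * k)) (at z)" by blast
qed

lemma holomorphic2_on_add:
  assumes "holomorphic2_on f U" "holomorphic2_on g U"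
  shows "holomorphic2_on (\<lambda>z. f z + g z) U"
  unfolding holomorphic2_on_def
proof (intro conjI ballI)
  show "open U" using assms by (simp add: holomorphic2_on_def)
  fix z assume z: "z \<in> U"
  obtain a b where 1: "(f has_derivative (\<lambda>(h, k). a * h + b * k)) (at z)"
    using assms z by (auto simp: holomorphic2_on_def)
  obtain a' b' where 2: "(g has_derivative (\<lambda>(h, k). a' * h + b' * k)) (at z)"
    using assms z by (auto simp: holomorphic2_on_def)
  have "((\<lambda>z. f z + g z) has_derivative (\<lambda>(h, k). (a + a') * h + (b + b') * k)) (at z)"
    by (rule has_derivative_eq_rhs[OF has_derivative_add[OF 1 2]]) (auto simp: fun_eq_iff algebra_simps)
  then show "\<exists>a b. ((\<lambda>z. f z + g z) has_derivative (\<lambda>(h, k). a * h + b * k)) (at z)" by blast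
qed

lemma holomorphic2_on_compose:
  assumes "holomorphic2_on f U" "h holomorphic_on T" "open T" "f ` U \<subseteq> T"
  shows "holomorphic2_on (\<lambda>z. h (f z)) U"
  unfolding holomorphic2_on_def
proof (intro conjI ballI)
  show "open U" using assms by (simp add: holomorphic2_on_def)
  fix z assume z: "z \<in> U"
  obtain a b where 1: "(f has_derivative (\<lambda>(h, k). a * h + b * k)) (at z)"
    using assms z by (auto simp: holomorphic2_on_def)
  have "(h has_field_derivative deriv h (f z)) (at (f z))"
    using assms z by (intro holomorphic_derivI) auto
  then have 2: "(h has_derivative (\<lambda>k. deriv h (f z) * k)) (at (f z))"
    by (simp add: has_field_derivative_def)
  have "((\<lambda>z. h (f z)) has_derivative (\<lambda>(x, k). (deriv h (f z) * a) * x + (deriv h (f z) * b) * k)) (at z)"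
    using diff_chain_at[OF 1 2] by (simp add: o_def algebra_simps case_prod_unfold)
  then show "\<exists>a b. ((\<lambda>z. h (f z)) has_derivative (\<lambda>(h, k). a * h + b * k)) (at z)" by blast
qed

lemma holomorphic2_on_const: "open U \<Longrightarrow> holomorphic2_on (\<lambda>z. c) U"
  unfolding holomorphic2_on_def
  by (auto intro!: exI[of _ 0] has_derivative_eq_rhs[OF has_derivative_const])

lemma holomorphic2_on_fst: "open U \<Longrightarrow> holomorphic2_on fst U"
  unfolding holomorphic2_on_def
proof (intro conjI ballI)
  fix z :: pt
  have "(fst has_derivative (\<lambda>(h, k). 1 * h + 0 * k)) (at z)"
    by (rule has_derivative_eq_rhs[OF bounded_linear_imp_has_derivative[OF bounded_linear_fst]]) auto
  then show "\<exists>a b. (fst has_derivative (\<lambda>(h, k). a * h + b * k)) (at z)" by blast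
qed

lemma holomorphic2_on_snd: "open U \<Longrightarrow> holomorphic2_on snd U"
  unfolding holomorphic2_on_def
proof (intro conjI ballI)
  fix z :: pt
  have "(snd has_derivative (\<lambda>(h, k). 0 * h + 1 * k)) (at z)"
    by (rule has_derivative_eq_rhs[OF bounded_linear_imp_has_derivative[OF bounded_linear_snd]]) auto
  then show "\<exists>a b. (snd has_derivative (\<lambda>(h, k). a * h + b * k)) (at z)" by blast
qed

lemma pd_cong:
  assumes "open U" "z \<in> U" "\<And>w. w \<in> U \<Longrightarrow> f w = g w"
  shows "pd1 f z = pd1 g z" "pd2 f z = pd2 g z"
proof -
  have "open ((\<lambda>s. (s, snd z)) -` U)" "open ((\<lambda>s. (fst z, s)) -` U)"
    by (intro open_vimage assms continuous_intros)+
  moreover have "fst z \<in> (\<lambda>s. (s, snd z)) -` U" "snd z \<in> (\<lambda>s. (fst z, s)) -` U"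
    using assms by auto
  ultimately have "eventually (\<lambda>s. f (s, snd z) = g (s, snd z)) (nhds (fst z))"
    "eventually (\<lambda>s. f (fst z, s) = g (fst z, s)) (nhds (snd z))"
    unfolding eventually_nhds using assms(3) by blast+
  then show "pd1 f z = pd1 g z" "pd2 f z = pd2 g z"
    unfolding pd1_def pd2_def by (auto intro: deriv_cong_ev)
qed

section \<open>Cauchy estimates and equality of mixed partial derivatives\<close>

lemma Cauchy_difference_quotient_bound:
  assumes "f holomorphic_on ball p (2 * R)" "0 < R"
    and "\<And>s. s \<in> ball p (2 * R) \<Longrightarrow> norm (f s) \<le> B"
    and h: "h \<noteq> 0" "norm h < R"
  shows "norm ((f (p + h) - f p) / h - deriv f p) \<le> (2 * B / R ^ 2 * 4) * norm h"
proof -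
  have sub: "cball s (R / 2) \<subseteq> ball p (2 * R)" if "s \<in> ball p R" for s
  proof
    fix x assume "x \<in> cball s (R / 2)"
    then show "x \<in> ball p (2 * R)"
      using that \<open>0 < R\<close> dist_triangle[of p x s] by (auto simp: dist_commute)
  qed
  \<comment> \<open>Cauchy's inequality on the disc of radius R/2 about s: the bound is 2! B /
    (R/2)^2.\<close>
  have 2: "norm ((deriv ^^ 2) f s) \<le> 2 * B / R ^ 2 * 4" if "s \<in> ball p R" for s
  proof -
    have "norm ((deriv ^^ 2) f s) \<le> fact 2 * B / (R / 2) ^ 2"
    proof (rule Cauchy_inequality)
      show "f holomorphic_on ball s (R / 2)"
        using sub[OF that] assms(1) by (meson ball_subset_cball holomorphic_on_subset order_trans)
      show "continuous_on (cball s (R / 2)) f"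
        using sub[OF that] assms(1) holomorphic_on_imp_continuous_on continuous_on_subset by blast
      show "0 < R / 2" using assms by simp
      fix x assume "norm (s - x) = R / 2"
      then have "x \<in> cball s (R / 2)" by (simp add: dist_norm)
      then show "norm (f x) \<le> B" using sub[OF that] assms(3) by blast
    qed
    then show ?thesis by (simp add: power2_eq_square field_simps)
  qed
  have d: "((deriv ^^ i) f has_field_derivative (deriv ^^ Suc i) f x) (at x within ball p R)"
    if "x \<in> ball p R" for i x
  proof -
    have "x \<in> ball p (2 * R)" using that \<open>0 < R\<close> by auto
    then have "((deriv ^^ i) f has_field_derivative deriv ((deriv ^^ i) f) x) (at x)"
      by (meson assms(1) holomorphic_derivI holomorphic_higher_deriv open_ball)
    then show ?thesis by (simp add: has_field_derivative_at_within)
  qed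
  have "norm ((deriv ^^ 0) f (p + h) - (\<Sum>i\<le>1. (deriv ^^ i) f p * (p + h - p) ^ i / fact i))
      \<le> (2 * B / R ^ 2 * 4) * norm (p + h - p) ^ Suc 1 / fact 1"
    by (rule complex_Taylor[of "ball p R" 1 "\<lambda>i. (deriv ^^ i) f"])
       (use d 2 h \<open>0 < R\<close> in \<open>auto simp: dist_norm numeral_2_eq_2\<close>)
  then have *: "norm (f (p + h) - f p - deriv f p * h) \<le> (2 * B / R ^ 2 * 4) * norm h ^ 2"
    by (simp add: algebra_simps power2_eq_square)
  have "(f (p + h) - f p) / h - deriv f p = (f (p + h) - f p - deriv f p * h) / h"
    using h by (simp add: field_simps)
  then have "norm ((f (p + h) - f p) / h - deriv f p) = norm (f (p + h) - f p - deriv f p * h) / norm h"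
    by (simp add: norm_divide)
  also have "\<dots> \<le> (2 * B / R ^ 2 * 4) * norm h ^ 2 / norm h"
    by (rule divide_right_mono[OF *]) simp
  also have "\<dots> = (2 * B / R ^ 2 * 4) * norm h"
    using h by (simp add: power2_eq_square)
  finally show ?thesis .
qed

text \<open>No regularity of the partial derivatives is assumed. Difference quotients in the first
  variable are holomorphic in the second and converge uniformly to \<open>pd1 f\<close>. By
  Weierstrass their derivatives converge to that of \<open>pd1 f\<close>; but these derivatives are
  the difference quotients of \<open>pd2 f\<close>. So both mixed derivatives exist and
  agree.\<close>

lemma mixed_partials:
  assumes f: "holomorphic2_on f U" and z: "z \<in> U"
  obtains D where "((\<lambda>s. pd2 f (s, snd z)) has_field_derivative D) (at (fst z))"
    and "((\<lambda>s. pd1 f (fst z, s)) has_field_derivative D) (at (snd z))"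
proof -
  obtain p q where pq: "z = (p, q)" by (cases z)
  have U: "open U" using f by (rule holomorphic2_on_open)
  obtain V W where VW: "open V" "open W" "z \<in> V \<times> W" "V \<times> W \<subseteq> U"
    using open_prod_elim[OF U z] by metis
  obtain R1 where R1: "R1 > 0" "cball p R1 \<subseteq> V"
    using VW pq open_contains_cball by (metis mem_Sigma_iff)
  obtain R where R: "R > 0" "cball q R \<subseteq> W"
    using VW pq open_contains_cball by (metis mem_Sigma_iff)
  have sub: "(s, w) \<in> U" if "s \<in> cball p R1" "w \<in> cball q R" for s w
    using that R1 R VW by blast
  have "compact (f ` (cball p R1 \<times> cball q R))"
    by (intro compact_continuous_image compact_Times compact_cball
        continuous_on_subset[OF holomorphic2_on_continuous_on[OF f]]) (use sub in auto)
  then obtain B where B: "\<And>s w. s \<in> cball p R1 \<Longrightarrow> w \<in> cball q R \<Longrightarrow> norm (f (s, w)) \<le> B"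
    by (metis (no_types, lifting) bounded_iff compact_imp_bounded image_eqI mem_Sigma_iff)
  have holp: "(\<lambda>s. f (s, w)) holomorphic_on ball p (2 * (R1 / 2))" if "w \<in> cball q R" for w
    unfolding holomorphic_on_def field_differentiable_def
  proof
    fix s assume "s \<in> ball p (2 * (R1 / 2))"
    then have "(s, w) \<in> U" using sub that by auto
    from holomorphic2_on_has_pd1[OF f this]
    have "((\<lambda>s. f (s, w)) has_field_derivative pd1 f (s, w)) (at s within ball p (2 * (R1 / 2)))"
      by (auto intro: has_field_derivative_at_within)
    then show "\<exists>f'. ((\<lambda>s. f (s, w)) has_field_derivative f') (at s within ball p (2 * (R1 / 2)))" ..
  qed
  define F where "F = (\<lambda>h w. (f (p + h, w) - f (p, w)) / h)"
  define F' where "F' = (\<lambda>h w. (pd2 f (p + h, w) - pd2 f (p, w)) / h)"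
  have dF: "(F h has_field_derivative F' h w) (at w)" if "w \<in> cball q R" "norm h \<le> R1" for h w
  proof (cases "h = 0")
    case False
    have "((\<lambda>s. f (p + h, s)) has_field_derivative pd2 f (p + h, w)) (at w)"
      "((\<lambda>s. f (p, s)) has_field_derivative pd2 f (p, w)) (at w)"
      using holomorphic2_on_has_pd2[OF f, of "(p + h, w)"] holomorphic2_on_has_pd2[OF f, of "(p, w)"]
        sub[of "p + h" w] sub[of p w] that R1 by (auto simp: dist_norm)
    then show ?thesis unfolding F_def F'_def
      by (intro DERIV_cdivide DERIV_diff)
  qed (simp add: F_def F'_def)
  have ev: "\<forall>\<^sub>F h in at 0. norm h < R1 / 2 \<and> h \<noteq> 0"
    unfolding eventually_at using R1 by (auto intro!: exI[of _ "R1 / 2"])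
  have 1: "\<forall>\<^sub>F h in at 0. continuous_on (cball q R) (F h) \<and>
      (\<forall>w\<in>ball q R. (F h has_field_derivative F' h w) (at w))"
    using ev
  proof eventually_elim
    case (elim h)
    then have "norm h \<le> R1" using R1 by simp
    then show ?case using dF[of _ h]
      by (auto intro!: continuous_at_imp_continuous_on DERIV_isCont)
  qed
  define C where "C = 2 * B / (R1 / 2) ^ 2 * 4"
  have C: "norm (F h w - pd1 f (p, w)) \<le> C * norm h" if "norm h < R1 / 2" "h \<noteq> 0" "w \<in> cball q R" for h w
    unfolding F_def C_def pd1_def fst_conv snd_conv
    by (rule Cauchy_difference_quotient_bound[OF holp]) (use B that R1 in auto)
  have 2: "uniform_limit (cball q R) F (\<lambda>w. pd1 f (p, w)) (at 0)"
    unfolding uniform_limit_iff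
  proof (intro allI impI)
    fix e :: real assume e: "e > 0"
    have "((\<lambda>h::complex. C * norm h) \<longlongrightarrow> C * norm (0::complex)) (at 0)" by (intro tendsto_intros)
    then have "\<forall>\<^sub>F h::complex in at 0. C * norm h < e"
      using e by (intro order_tendstoD) auto
    with ev show "\<forall>\<^sub>F h in at 0. \<forall>w\<in>cball q R. dist (F h w) (pd1 f (p, w)) < e"
    proof eventually_elim
      case (elim h)
      then show ?case using C[of h] by (force simp: dist_norm)
    qed
  qed
  obtain g' where g': "\<And>w. w \<in> ball q R \<Longrightarrow>
      ((\<lambda>w. pd1 f (p, w)) has_field_derivative g' w) (at w) \<and> ((\<lambda>h. F' h w) \<longlongrightarrow> g' w) (at 0)"
    using has_complex_derivative_uniform_limit[OF 1 2 _ R(1)] by auto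
  have "((\<lambda>s. pd2 f (s, q)) has_field_derivative g' q) (at p)"
    unfolding DERIV_def using g'[of q] R by (simp add: F'_def)
  moreover have "((\<lambda>s. pd1 f (p, s)) has_field_derivative g' q) (at q)"
    using g'[of q] R by simp
  ultimately show ?thesis using that pq by simp
qed

section \<open>Webs invariant under homotheties\<close>

lemma ext_deriv_cong:
  assumes "open U" "z \<in> U" "\<And>w. w \<in> U \<Longrightarrow> \<theta> w = \<theta>' w"
  shows "ext_deriv \<theta> z = ext_deriv \<theta>' z"
  unfolding ext_deriv_def
  using pd_cong(1)[OF assms(1,2), of "\<lambda>z. snd (\<theta> z)" "\<lambda>z. snd (\<theta>' z)"]
    pd_cong(2)[OF assms(1,2), of "\<lambda>z. fst (\<theta> z)" "\<lambda>z. fst (\<theta>' z)"] assms(3)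
  by simp

lemma eta_eqI:
  assumes "delta \<omega> r s z \<noteq> 0" "delta \<omega> s t z \<noteq> 0" "delta \<omega> t r z \<noteq> 0"
    and e: "ext_deriv (fmult (delta \<omega> s t) (\<omega> r)) z = wedge e (fmult (delta \<omega> s t) (\<omega> r) z)"
      "ext_deriv (fmult (delta \<omega> t r) (\<omega> s)) z = wedge e (fmult (delta \<omega> t r) (\<omega> s) z)"
      "ext_deriv (fmult (delta \<omega> r s) (\<omega> t)) z = wedge e (fmult (delta \<omega> r s) (\<omega> t) z)"
  shows "eta \<omega> r s t z = e"
  unfolding eta_def
proof (rule the_equality)
  fix e' assume e': "ext_deriv (fmult (delta \<omega> s t) (\<omega> r)) z = wedge e' (fmult (delta \<omega> s t) (\<omega> r) z) \<and>
     ext_deriv (fmult (delta \<omega> t r) (\<omega> s)) z = wedge e' (fmult (delta \<omega> t r) (\<omega> s) z) \<and>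
     ext_deriv (fmult (delta \<omega> r s) (\<omega> t)) z = wedge e' (fmult (delta \<omega> r s) (\<omega> t) z)"
  obtain a b c d where ab: "\<omega> r z = (a, b)" "\<omega> s z = (c, d)" by (cases "\<omega> r z", cases "\<omega> s z")
  obtain x y x' y' where xy: "e = (x, y)" "e' = (x', y')" by (cases e, cases e')
  have rs: "a * d - b * c \<noteq> 0" using assms(1) by (simp add: delta_def wedge_def ab)
  have "delta \<omega> s t z * (x * b - y * a) = delta \<omega> s t z * (x' * b - y' * a)"
    "delta \<omega> t r z * (x * d - y * c) = delta \<omega> t r z * (x' * d - y' * c)"
    using e e' by (simp_all add: wedge_def fmult_def ab xy algebra_simps)
  then have 1: "x * b - y * a = x' * b - y' * a" "x * d - y * c = x' * d - y' * c"
    using assms by auto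
  have "(x - x') * (a * d - b * c) = 0" "(y - y') * (a * d - b * c) = 0"
    using 1 by algebra+
  then show "e' = e" using rs xy by simp
qed (use e in auto)

text \<open>
  \<open>m\<close> stands for the derivative of \<open>M\<close>. Up to the choice of coordinates and the scaling of the
  forms, \<open>\<eta>\<close> is \<open>eta_coeff' dp + eta_coeff dq/q\<close>.
\<close>

definition eta_coeff :: "('a \<Rightarrow> complex) \<Rightarrow> ('a \<Rightarrow> complex) \<Rightarrow> 'a \<Rightarrow> 'a \<Rightarrow> 'a \<Rightarrow> complex" where
  "eta_coeff M m r s t =
     m r * (M s * M t) / ((M r - M s) * (M r - M t)) +
     m s * (M t * M r) / ((M s - M t) * (M s - M r)) +
     m t * (M r * M s) / ((M t - M r) * (M t - M s))"

definition eta_coeff' :: "('a \<Rightarrow> complex) \<Rightarrow> ('a \<Rightarrow> complex) \<Rightarrow> 'a \<Rightarrow> 'a \<Rightarrow> 'a \<Rightarrow> complex" where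
  "eta_coeff' M m r s t =
     m r * (M r - M s - M t) / ((M r - M s) * (M r - M t)) +
     m s * (M s - M t - M r) / ((M s - M t) * (M s - M r)) +
     m t * (M t - M r - M s) / ((M t - M r) * (M t - M s))"

lemma eta_coeff_rotate:
  "eta_coeff M m s t r = eta_coeff M m r s t" "eta_coeff' M m s t r = eta_coeff' M m r s t"
  by (simp_all add: eta_coeff_def eta_coeff'_def algebra_simps)

text \<open>Up to the factor -N, the left side is the derivative of
  \<open>M r * (M t - M s)\<close>; the identity is what the equation of \<eta> for the first form
  amounts to. As both coefficients are invariant under rotation of r, s, t, it yields the equations
  for all three forms.\<close>

lemma eta_coeff_identity:
  assumes "M r \<noteq> M s" "M s \<noteq> M t" "M t \<noteq> M r"
  shows "m r * (M t - M s) + M r * (m t - m s) =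
    (M t - M s) * (eta_coeff' M m r s t * M r + eta_coeff M m r s t)"
proof -
  define u v w where "u = M r - M s" and "v = M s - M t" and "w = M t - M r"
  have nz: "u \<noteq> 0" "v \<noteq> 0" "w \<noteq> 0" using assms by (auto simp: u_def v_def w_def)
  have lin: "(a * x / k + b * y / k' + c * z / k'') * l + (a * x' / k + b * y' / k' + c * z' / k'') =
    a * (x * l + x') / k + b * (y * l + y') / k' + c * (z * l + z') / k''"
    for a b c x y z x' y' z' k k' k'' l :: complex
    by (simp add: add_divide_distrib algebra_simps)
  have D: "(M r - M s) * (M r - M t) = - (u * w)" "(M s - M t) * (M s - M r) = - (v * u)"
    "(M t - M r) * (M t - M s) = - (w * v)"
    unfolding u_def v_def w_def by algebra+
  have E: "eta_coeff' M m r s t * M r + eta_coeff M m r s t =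
    m r * ((M r - M s - M t) * M r + M s * M t) / - (u * w) +
    m s * ((M s - M t - M r) * M r + M t * M r) / - (v * u) +
    m t * ((M t - M r - M s) * M r + M r * M s) / - (w * v)"
    unfolding eta_coeff_def eta_coeff'_def D by (rule lin)
  \<comment> \<open>Each numerator turns into a product that cancels against its denominator,
    leaving at most the factor v.\<close>
  have c1: "(M r - M s - M t) * M r + M s * M t = - u * w"
    "(M s - M t - M r) * M r + M t * M r = - u * M r"
    "(M t - M r - M s) * M r + M r * M s = w * M r"
    unfolding u_def v_def w_def by algebra+
  have "eta_coeff' M m r s t * M r + eta_coeff M m r s t = m r + m s * M r / v - m t * M r / v"
    unfolding E c1 using nz by (simp add: field_simps)
  then have "(M t - M s) * (eta_coeff' M m r s t * M r + eta_coeff M m r s t) =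
     - v * (m r + m s * M r / v - m t * M r / v)"
    by (simp add: v_def)
  also have "\<dots> = - v * m r - m s * M r + m t * M r" using nz by (simp add: field_simps)
  finally show ?thesis by (simp add: v_def algebra_simps)
qed

text \<open>The powers of q are those of a product of \<delta> and \<omega>: \<delta> has a factor
  1/q, and the dq-coefficient of \<omega> has another one.\<close>

lemma ext_deriv_normal_form:
  assumes U: "open U" "z \<in> U" and G: "holomorphic2_on G U" and q: "snd z \<noteq> 0"
    and \<theta>: "\<And>w. w \<in> U \<Longrightarrow> \<theta> w = (G w * F (fst w) / snd w, G w * E (fst w) / (snd w)\<^sup>2)"
    and E: "(E has_field_derivative E') (at (fst z))"
  shows "ext_deriv \<theta> z = pd1 G z * E (fst z) / (snd z)\<^sup>2 + G z * E' / (snd z)\<^sup>2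
    - pd2 G z * F (fst z) / snd z + G z * F (fst z) / (snd z)\<^sup>2"
proof -
  have 1: "((\<lambda>s. G (s, snd z) * E s / (snd z)\<^sup>2) has_field_derivative
    (pd1 G z * E (fst z) + E' * G z) / (snd z)\<^sup>2) (at (fst z))"
    using holomorphic2_on_has_pd1[OF G U(2)] E q
    by (auto intro!: derivative_eq_intros simp: field_simps)
  have 2: "((\<lambda>s. G (fst z, s) * F (fst z) / s) has_field_derivative
    (pd2 G z * F (fst z) / snd z - G z * F (fst z) / (snd z)\<^sup>2)) (at (snd z))"
    using holomorphic2_on_has_pd2[OF G U(2)] q
    by (auto intro!: derivative_eq_intros simp: field_simps power2_eq_square)
  have "ext_deriv \<theta> z = ext_deriv (\<lambda>w. (G w * F (fst w) / snd w, G w * E (fst w) / (snd w)\<^sup>2)) z"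
    by (rule ext_deriv_cong[OF U \<theta>])
  also have "\<dots> = (pd1 G z * E (fst z) + E' * G z) / (snd z)\<^sup>2 -
     (pd2 G z * F (fst z) / snd z - G z * F (fst z) / (snd z)\<^sup>2)"
    unfolding ext_deriv_def pd1_def pd2_def using DERIV_imp_deriv[OF 1] DERIV_imp_deriv[OF 2]
    by (simp add: pd1_def pd2_def)
  finally show ?thesis by (simp add: add_divide_distrib mult.commute)
qed

section \<open>The forms \<eta> and the curvature of an invariant web\<close>

text \<open>
  In the coordinates \<open>p\<close> and \<open>log q\<close>, the web is invariant under translations of \<open>log q\<close>. The slopes
  are \<open>- \<psi> - N / M i\<close>; the factors \<open>g i\<close> do not change the foliations.
\<close>

locale invariant_web =
  fixes V W :: "complex set" and d :: nat and N \<psi> :: "complex \<Rightarrow> complex"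
    and M m :: "nat \<Rightarrow> complex \<Rightarrow> complex" and g :: "nat \<Rightarrow> pt \<Rightarrow> complex" and \<omega> :: "nat \<Rightarrow> form1"
  assumes V: "open V" and W: "open W" "0 \<notin> W"
    and N: "N holomorphic_on V" "\<And>p. p \<in> V \<Longrightarrow> N p \<noteq> 0" and \<psi>: "\<psi> holomorphic_on V"
    and M: "\<And>i p. i < d \<Longrightarrow> p \<in> V \<Longrightarrow> (M i has_field_derivative - N p * m i p) (at p)"
    and M_distinct: "\<And>i j p. i < d \<Longrightarrow> j < d \<Longrightarrow> i \<noteq> j \<Longrightarrow> p \<in> V \<Longrightarrow> M i p \<noteq> M j p"
    and g: "\<And>i. i < d \<Longrightarrow> holomorphic2_on (g i) (V \<times> W)"
      "\<And>i z. i < d \<Longrightarrow> z \<in> V \<times> W \<Longrightarrow> g i z \<noteq> 0"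
    and \<omega>: "\<And>i z. i < d \<Longrightarrow> z \<in> V \<times> W \<Longrightarrow>
      \<omega> i z = (g i z * (N (fst z) + M i (fst z) * \<psi> (fst z)), g i z * M i (fst z) / snd z)"
begin

lemma open_VW: "open (V \<times> W)"
  using V W by (simp add: open_Times)

definition coeff_q :: "nat \<Rightarrow> nat \<Rightarrow> nat \<Rightarrow> complex \<Rightarrow> complex" where
  "coeff_q r s t p = eta_coeff (\<lambda>i. M i p) (\<lambda>i. m i p) r s t"

text \<open>The extra terms come from the coordinates. The forms are multiples of N dp + M (dq/q +
  \<psi> dp), so dq/q is accompanied by \<psi> dp; and N'/N comes from the factor N of
  \<delta>.\<close>

definition coeff_p :: "nat \<Rightarrow> nat \<Rightarrow> nat \<Rightarrow> complex \<Rightarrow> complex" where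
  "coeff_p r s t p = - N p * eta_coeff' (\<lambda>i. M i p) (\<lambda>i. m i p) r s t + coeff_q r s t p * \<psi> p
     + deriv N p / N p"

lemma coeff_rotate: "coeff_q s t r = coeff_q r s t" "coeff_p s t r = coeff_p r s t"
  by (simp_all add: coeff_q_def coeff_p_def fun_eq_iff eta_coeff_rotate[of _ _ s t r])

text \<open>Each of the three products of \<delta> and \<omega> contains all three factors. The
  rescaling is therefore common to them and adds the logarithmic differential of
  \<open>gauge\<close> to \<eta>.\<close>

definition gauge :: "nat \<Rightarrow> nat \<Rightarrow> nat \<Rightarrow> pt \<Rightarrow> complex" where
  "gauge r s t z = g r z * g s z * g t z"

lemma gauge_rotate: "gauge s t r = gauge r s t"
  by (simp add: gauge_def fun_eq_iff)

lemma gauge_holomorphic: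
  assumes "r < d" "s < d" "t < d"
  shows "holomorphic2_on (gauge r s t) (V \<times> W)"
  using g(1) assms unfolding gauge_def by (intro holomorphic2_on_mult) auto

lemma gauge_nonzero: "r < d \<Longrightarrow> s < d \<Longrightarrow> t < d \<Longrightarrow> z \<in> V \<times> W \<Longrightarrow> gauge r s t z \<noteq> 0"
  using g(2) by (simp add: gauge_def)

lemma delta_\<omega>:
  assumes "i < d" "j < d" "z \<in> V \<times> W"
  shows "delta \<omega> i j z = g i z * g j z * N (fst z) * (M j (fst z) - M i (fst z)) / snd z"
  by (simp add: delta_def wedge_def \<omega>[OF assms(1,3)] \<omega>[OF assms(2,3)] add_divide_distrib[symmetric]
      diff_divide_distrib[symmetric]) (simp add: algebra_simps)

lemma delta_\<omega>_nonzero: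
  assumes "i < d" "j < d" "i \<noteq> j" "z \<in> V \<times> W"
  shows "delta \<omega> i j z \<noteq> 0"
  using assms W N(2) g(2)[OF assms(1,4)] g(2)[OF assms(2,4)] M_distinct[OF assms(1-3), of "fst z"]
  by (auto simp: delta_\<omega>)

text \<open>The form is G times (F/q) dp + (E/q^2) dq. Its exterior derivative is the wedge of d log
  G with it, plus G (E' + F)/q^2. So the claim reduces to E' = \<open>coeff_p\<close> E -
  \<open>coeff_q\<close> F, and the additional F accounts for the -1 next to
  \<open>coeff_q\<close>.\<close>

lemma structure_equation:
  assumes rst: "r < d" "s < d" "t < d" "r \<noteq> s" "s \<noteq> t" "t \<noteq> r" and z: "z \<in> V \<times> W"
  shows "ext_deriv (fmult (delta \<omega> s t) (\<omega> r)) z =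
    wedge (coeff_p r s t (fst z) + pd1 (gauge r s t) z / gauge r s t z,
           (coeff_q r s t (fst z) - 1) / snd z + pd2 (gauge r s t) z / gauge r s t z)
      (fmult (delta \<omega> s t) (\<omega> r) z)"
proof -
  obtain p q where pq: "z = (p, q)" by (cases z)
  have p: "p \<in> V" and q: "q \<noteq> 0" using z W pq by auto
  define G where "G = gauge r s t"
  have G: "holomorphic2_on G (V \<times> W)" "G z \<noteq> 0"
    using gauge_holomorphic gauge_nonzero rst z by (auto simp: G_def)
  define E where "E = (\<lambda>p. N p * (M t p - M s p) * M r p)"
  define F where "F = (\<lambda>p. N p * (M t p - M s p) * (N p + M r p * \<psi> p))"
  define A where "A = eta_coeff' (\<lambda>i. M i p) (\<lambda>i. m i p) r s t"
  define B where "B = coeff_q r s t p"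
  have \<theta>: "fmult (delta \<omega> s t) (\<omega> r) w = (G w * F (fst w) / snd w, G w * E (fst w) / (snd w)\<^sup>2)"
    if "w \<in> V \<times> W" for w
    using that rst W
    by (simp add: fmult_def delta_\<omega> \<omega> G_def gauge_def E_def F_def power2_eq_square)
  have Np: "(N has_field_derivative deriv N p) (at p)"
    using N V p by (intro holomorphic_derivI) auto
  have id: "m r p * (M t p - M s p) + M r p * (m t p - m s p) = (M t p - M s p) * (A * M r p + B)"
    unfolding A_def B_def coeff_q_def
    by (rule eta_coeff_identity) (use rst p M_distinct in auto)
  define E' where "E' = (deriv N p * (M t p - M s p) + N p * (- N p * m t p - - N p * m s p)) * M r p
     + (- N p * m r p) * (N p * (M t p - M s p))"
  have "(E has_field_derivative E') (at p)"
    unfolding E_def E'_def using M[OF rst(1) p] M[OF rst(2) p] M[OF rst(3) p] Np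
    by (auto intro!: derivative_eq_intros simp: algebra_simps)
  then have ext: "ext_deriv (fmult (delta \<omega> s t) (\<omega> r)) z = pd1 G z * E p / q\<^sup>2 + G z * E' / q\<^sup>2
      - pd2 G z * F p / q + G z * F p / q\<^sup>2"
    using ext_deriv_normal_form[OF open_VW z G(1) _ \<theta>, of E'] pq q by simp
  have "E' = deriv N p * (M t p - M s p) * M r p
      - (N p)\<^sup>2 * (m r p * (M t p - M s p) + M r p * (m t p - m s p))"
    unfolding E'_def by (simp add: algebra_simps power2_eq_square)
  also have "\<dots> = deriv N p * (M t p - M s p) * M r p - (N p)\<^sup>2 * ((M t p - M s p) * (A * M r p + B))"
    unfolding id ..
  also have "\<dots> = coeff_p r s t p * E p - B * F p"
    using N(2)[OF p]
    by (simp add: coeff_p_def A_def[symmetric] B_def[symmetric] E_def F_def field_simps power2_eq_square)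
  finally have E': "E' = coeff_p r s t p * E p - B * F p" .
  show ?thesis
    unfolding ext E' \<theta>[OF z] G_def[symmetric] wedge_def fst_conv snd_conv
    using q G(2) pq by (simp add: B_def[symmetric] field_simps power2_eq_square)
qed

lemma eta_\<omega>:
  assumes rst: "r < d" "s < d" "t < d" "r \<noteq> s" "s \<noteq> t" "t \<noteq> r" and z: "z \<in> V \<times> W"
  shows "eta \<omega> r s t z =
    (coeff_p r s t (fst z) + pd1 (gauge r s t) z / gauge r s t z,
     (coeff_q r s t (fst z) - 1) / snd z + pd2 (gauge r s t) z / gauge r s t z)"
proof (rule eta_eqI)
  show "delta \<omega> r s z \<noteq> 0" "delta \<omega> s t z \<noteq> 0" "delta \<omega> t r z \<noteq> 0"
    using assms by (metis delta_\<omega>_nonzero)+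
qed (use structure_equation[of r s t z] structure_equation[of s t r z] structure_equation[of t r s z] assms
    coeff_rotate[of s t r] coeff_rotate[of t r s] gauge_rotate[of s t r] gauge_rotate[of t r s] in simp_all)

lemma m_eq: "i < d \<Longrightarrow> p \<in> V \<Longrightarrow> m i p = - deriv (M i) p / N p"
  using DERIV_imp_deriv[OF M] N(2) by simp

lemma M_holomorphic: "i < d \<Longrightarrow> M i holomorphic_on V"
  using M V by (metis holomorphic_on_open)

lemma m_holomorphic:
  assumes "i < d"
  shows "m i holomorphic_on V"
proof -
  have "(\<lambda>p. - deriv (M i) p / N p) holomorphic_on V"
    using N V by (intro holomorphic_intros holomorphic_deriv M_holomorphic assms) auto
  then show ?thesis by (rule holomorphic_transform) (simp add: m_eq assms)
qed

lemma coeff_q_holomorphic: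
  assumes "r < d" "s < d" "t < d" "r \<noteq> s" "s \<noteq> t" "t \<noteq> r"
  shows "coeff_q r s t holomorphic_on V"
  unfolding coeff_q_def[abs_def] eta_coeff_def
  using assms M_distinct
  by (intro holomorphic_intros M_holomorphic m_holomorphic) auto

text \<open>Only the part \<open>coeff_q\<close> dq/q of each \<eta> contributes:
  \<open>coeff_p\<close> dp depends on p alone, dq/q is closed, and so is the logarithmic
  differential of the gauge, by symmetry of the mixed partial derivatives.\<close>

lemma ext_deriv_eta_sum:
  assumes T: "\<And>r s t. (r, s, t) \<in> T \<Longrightarrow> r < d \<and> s < d \<and> t < d \<and> r \<noteq> s \<and> s \<noteq> t \<and> t \<noteq> r"
    and z: "z \<in> V \<times> W"
  shows "ext_deriv (\<lambda>z. \<Sum>(r, s, t) \<in> T. eta \<omega> r s t z) z =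
     deriv (\<lambda>p. \<Sum>(r, s, t) \<in> T. coeff_q r s t p) (fst z) / snd z"
proof -
  obtain p q where pq: "z = (p, q)" by (cases z)
  have p: "p \<in> V" and q: "q \<noteq> 0" using z W pq by auto
  define P Q :: "nat \<times> nat \<times> nat \<Rightarrow> pt \<Rightarrow> complex" where
    "P = (\<lambda>(r, s, t) w. coeff_p r s t (fst w) + pd1 (gauge r s t) w / gauge r s t w)" and
    "Q = (\<lambda>(r, s, t) w. (coeff_q r s t (fst w) - 1) / snd w + pd2 (gauge r s t) w / gauge r s t w)"
  have *: "(\<Sum>(r, s, t) \<in> T. eta \<omega> r s t w) = (\<Sum>x\<in>T. P x w, \<Sum>x\<in>T. Q x w)" if "w \<in> V \<times> W" for w
  proof -
    have "(\<Sum>(r, s, t) \<in> T. eta \<omega> r s t w) = (\<Sum>x\<in>T. (P x w, Q x w))"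
      by (rule sum.cong) (use T that in \<open>auto simp: P_def Q_def eta_\<omega>\<close>)
    also have "\<dots> = (\<Sum>x\<in>T. P x w, \<Sum>x\<in>T. Q x w)"
      by (simp add: prod_eq_iff fst_sum snd_sum)
    finally show ?thesis .
  qed
  have "\<exists>D. ((\<lambda>s. Q (i, j, k) (s, q)) has_field_derivative deriv (coeff_q i j k) p / q + D) (at p) \<and>
      ((\<lambda>s. P (i, j, k) (p, s)) has_field_derivative D) (at q)" if ijk: "(i, j, k) \<in> T" for i j k
  proof -
    define G where "G = gauge i j k"
    have G: "holomorphic2_on G (V \<times> W)" "G (p, q) \<noteq> 0"
      using gauge_holomorphic gauge_nonzero T[OF ijk] z pq by (auto simp: G_def)
    obtain D0 where D0: "((\<lambda>s. pd2 G (s, q)) has_field_derivative D0) (at p)"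
      "((\<lambda>s. pd1 G (p, s)) has_field_derivative D0) (at q)"
      using mixed_partials[OF G(1) z] pq by auto
    have G1: "((\<lambda>s. G (s, q)) has_field_derivative pd1 G (p, q)) (at p)"
      and G2: "((\<lambda>s. G (p, s)) has_field_derivative pd2 G (p, q)) (at q)"
      using holomorphic2_on_has_pd1[OF G(1) z] holomorphic2_on_has_pd2[OF G(1) z] pq by auto
    have c: "(coeff_q i j k has_field_derivative deriv (coeff_q i j k) p) (at p)"
      using coeff_q_holomorphic T[OF ijk] V p by (intro holomorphic_derivI) auto
    \<comment> \<open>The mixed second derivative of log G; it occurs in both partial derivatives
      and cancels.\<close>
    define D where "D = D0 / G (p, q) - pd1 G (p, q) * pd2 G (p, q) / (G (p, q))\<^sup>2"
    have "((\<lambda>s. (coeff_q i j k s - 1) / q + pd2 G (s, q) / G (s, q)) has_field_derivative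
        deriv (coeff_q i j k) p / q + D) (at p)"
      using D0 G1 c G(2) q unfolding D_def
      by (auto intro!: derivative_eq_intros simp: field_simps power2_eq_square)
    moreover have "((\<lambda>s. coeff_p i j k p + pd1 G (p, s) / G (p, s)) has_field_derivative D) (at q)"
      using D0 G2 G(2) unfolding D_def
      by (auto intro!: derivative_eq_intros simp: field_simps power2_eq_square)
    ultimately show ?thesis by (auto simp: P_def Q_def G_def)
  qed
  then have "\<forall>x\<in>T. \<exists>D. ((\<lambda>s. Q x (s, q)) has_field_derivative
      (case x of (i, j, k) \<Rightarrow> deriv (coeff_q i j k) p / q) + D) (at p) \<and>
      ((\<lambda>s. P x (p, s)) has_field_derivative D) (at q)"
    by auto
  from bchoice[OF this] obtain D where D: "\<And>x. x \<in> T \<Longrightarrow> ((\<lambda>s. Q x (s, q)) has_field_derivative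
      (case x of (i, j, k) \<Rightarrow> deriv (coeff_q i j k) p / q) + D x) (at p)"
      "\<And>x. x \<in> T \<Longrightarrow> ((\<lambda>s. P x (p, s)) has_field_derivative D x) (at q)"
    by blast
  have "ext_deriv (\<lambda>z. \<Sum>(r, s, t) \<in> T. eta \<omega> r s t z) z =
      ext_deriv (\<lambda>w. (\<Sum>x\<in>T. P x w, \<Sum>x\<in>T. Q x w)) z"
    by (rule ext_deriv_cong[OF open_VW z *])
  also have "\<dots> = (\<Sum>x\<in>T. (case x of (i, j, k) \<Rightarrow> deriv (coeff_q i j k) p / q) + D x) - (\<Sum>x\<in>T. D x)"
    unfolding ext_deriv_def pd1_def pd2_def pq fst_conv snd_conv
    using DERIV_imp_deriv[OF DERIV_sum[OF D(1), of T]] DERIV_imp_deriv[OF DERIV_sum[OF D(2), of T]]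
    by simp
  also have "\<dots> = (\<Sum>(i, j, k)\<in>T. deriv (coeff_q i j k) p) / q"
    by (simp add: sum.distrib sum_divide_distrib case_prod_unfold)
  also have "((\<lambda>p. \<Sum>x\<in>T. (case x of (i, j, k) \<Rightarrow> coeff_q i j k p)) has_field_derivative
      (\<Sum>x\<in>T. case x of (i, j, k) \<Rightarrow> deriv (coeff_q i j k) p)) (at p)"
  proof (rule DERIV_sum)
    fix x assume "x \<in> T"
    then obtain i j k where x: "x = (i, j, k)" "(i, j, k) \<in> T" by (cases x) auto
    have "(coeff_q i j k has_field_derivative deriv (coeff_q i j k) p) (at p)"
      using coeff_q_holomorphic T[OF x(2)] V p by (intro holomorphic_derivI) auto
    then show "((\<lambda>p. case x of (i, j, k) \<Rightarrow> coeff_q i j k p) has_field_derivative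
      (case x of (i, j, k) \<Rightarrow> deriv (coeff_q i j k) p)) (at p)"
      using x by simp
  qed
  then have "(\<Sum>x\<in>T. case x of (i, j, k) \<Rightarrow> deriv (coeff_q i j k) p) =
     deriv (\<lambda>p. \<Sum>x\<in>T. (case x of (i, j, k) \<Rightarrow> coeff_q i j k p)) p"
    by (simp add: DERIV_imp_deriv)
  finally show ?thesis by (simp add: pq)
qed

lemma forms_curvature_\<omega>:
  assumes "z \<in> V \<times> W"
  shows "forms_curvature d \<omega> z =
    deriv (\<lambda>p. \<Sum>(r, s, t) \<in> {(r, s, t). r < s \<and> s < t \<and> t < d}.
      eta_coeff (\<lambda>i. M i p) (\<lambda>i. m i p) r s t) (fst z) / snd z"
  unfolding forms_curvature_def coeff_q_def[symmetric]
  by (rule ext_deriv_eta_sum) (use assms in auto)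

end

section \<open>Pencils of polynomials and their branches\<close>

lemma card_roots_le:
  fixes p :: "complex poly"
  assumes "p \<noteq> 0" "degree p \<le> n"
  shows "finite {z. poly p z = 0}" "card {z. poly p z = 0} \<le> n"
  using assms poly_roots_finite[of p] card_poly_roots_bound[of p] by (auto simp: order_trans)

text \<open>A double root could be split off once without changing the set of roots, which would
  then be larger than the degree of the remaining factor.\<close>

lemma simple_root_if_card_roots:
  fixes p :: "complex poly"
  assumes p: "p \<noteq> 0" "card {z. poly p z = 0} = degree p" and a: "poly p a = 0"
  shows "poly (pderiv p) a \<noteq> 0"
proof
  assume d: "poly (pderiv p) a = 0"
  obtain q where q: "p = [:-a, 1:] * q" using a by (metis dvdE poly_eq_0_iff_dvd)
  have "poly (pderiv p) a = poly q a"
    unfolding q pderiv_mult by (simp add: pderiv_pCons)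
  then have "poly q a = 0" using d by simp
  then have "{z. poly p z = 0} = {z. poly q z = 0}" by (auto simp: q)
  moreover have "q \<noteq> 0" using p q by auto
  then have "card {z. poly q z = 0} \<le> degree q" by (intro card_roots_le) auto
  moreover have "degree p = degree [:-a, 1:] + degree q"
    unfolding q using \<open>q \<noteq> 0\<close> by (intro degree_mult_eq) auto
  ultimately show False using p by simp
qed

lemma card_roots_if_simple:
  fixes p :: "complex poly"
  assumes "\<And>a. poly p a = 0 \<Longrightarrow> poly (pderiv p) a \<noteq> 0"
  shows "card {z. poly p z = 0} = degree p"
proof -
  have rs: "rsquarefree p" using assms by (auto simp: rsquarefree_roots)
  have fin: "finite {z. poly p z = 0}" using rs by (intro poly_roots_finite) (auto simp: rsquarefree_def)
  have "degree p = degree (smult (lead_coeff p) (\<Prod>z | poly p z = 0. [:-z, 1:]))"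
    using complex_poly_decompose_rsquarefree[OF rs] by simp
  also have "\<dots> = (\<Sum>z | poly p z = 0. 1)"
    using rs fin by (subst degree_smult_eq, subst degree_prod_eq_sum_degree) (auto simp: rsquarefree_def)
  finally show ?thesis by simp
qed

section \<open>Symmetric sums over triples of branches\<close>

definition cluster :: "('a \<Rightarrow> complex) \<Rightarrow> ('a \<Rightarrow> complex) \<Rightarrow> 'a set \<Rightarrow> complex" where
  "cluster M m A = (\<Sum>x\<in>A. m x * (\<Prod>y\<in>A - {x}. M y / (M x - M y)))"

lemma cluster_triple:
  assumes "x \<noteq> y" "y \<noteq> z" "z \<noteq> x"
  shows "cluster M m {x, y, z} = eta_coeff M m x y z"
proof -
  have "{x, y, z} - {x} = {y, z}" "{x, y, z} - {y} = {z, x}" "{x, y, z} - {z} = {x, y}"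
    using assms by auto
  then show ?thesis using assms by (simp add: cluster_def eta_coeff_def)
qed

lemma increasing_triple_eq:
  fixes r s t r' s' t' :: nat
  assumes "r < s" "s < t" "r' < s'" "s' < t'" "{r, s, t} = {r', s', t'}"
  shows "r = r' \<and> s = s' \<and> t = t'"
proof -
  have "r \<in> {r', s', t'}" "s \<in> {r', s', t'}" "t \<in> {r', s', t'}"
    "r' \<in> {r, s, t}" "s' \<in> {r, s, t}" "t' \<in> {r, s, t}"
    using assms(5) by blast+
  then show ?thesis using assms(1-4) by auto
qed

lemma card_3_increasing:
  fixes A :: "nat set"
  assumes "card A = 3"
  obtains r s t where "r < s" "s < t" "A = {r, s, t}"
proof -
  obtain x y z where "A = {x, y, z}" "x \<noteq> y" "y \<noteq> z" "x \<noteq> z"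
    using assms by (auto simp: card_3_iff)
  then consider "x < y" "y < z" | "x < z" "z < y" | "y < x" "x < z" | "y < z" "z < x" | "z < x" "x < y"
    | "z < y" "y < x" by linarith
  then show ?thesis
    by cases (use that \<open>A = {x, y, z}\<close> in \<open>force simp: insert_commute\<close>)+
qed

lemma sum_clusters_indexed:
  assumes inj: "inj_on \<sigma> {..<d::nat}"
  shows "(\<Sum>A | A \<subseteq> \<sigma> ` {..<d} \<and> card A = 3. cluster M m A) =
    (\<Sum>(r, s, t) \<in> {(r, s, t). r < s \<and> s < t \<and> t < d}. eta_coeff (\<lambda>i. M (\<sigma> i)) (\<lambda>i. m (\<sigma> i)) r s t)"
proof -
  let ?T = "{(r, s, t). r < s \<and> s < t \<and> t < d}"
  let ?h = "\<lambda>(r, s, t). \<sigma> ` {r, s, t}"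
  have bij: "bij_betw ?h ?T {A. A \<subseteq> \<sigma> ` {..<d} \<and> card A = 3}"
    unfolding bij_betw_def
  proof
    show "inj_on ?h ?T"
    proof (rule inj_onI)
      fix x y assume xy: "x \<in> ?T" "y \<in> ?T" "?h x = ?h y"
      obtain r s t r' s' t' where e: "x = (r, s, t)" "y = (r', s', t')" by (cases x, cases y)
      have "{r, s, t} = {r', s', t'}"
        using xy e inj inj_on_image_eq_iff[OF inj, of "{r, s, t}" "{r', s', t'}"] by auto
      then show "x = y" using increasing_triple_eq[of r s t r' s' t'] xy e by auto
    qed
    show "?h ` ?T = {A. A \<subseteq> \<sigma> ` {..<d} \<and> card A = 3}"
    proof (intro equalityI subsetI)
      fix A assume "A \<in> ?h ` ?T"
      then obtain r s t where rst: "r < s" "s < t" "t < d" "A = \<sigma> ` {r, s, t}" by auto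
      have "card A = card {r, s, t}"
        unfolding rst(4) by (rule card_image) (rule inj_on_subset[OF inj], use rst in auto)
      then show "A \<in> {A. A \<subseteq> \<sigma> ` {..<d} \<and> card A = 3}" using rst by auto
    next
      fix A assume "A \<in> {A. A \<subseteq> \<sigma> ` {..<d} \<and> card A = 3}"
      then obtain B where B: "B \<subseteq> {..<d}" "A = \<sigma> ` B" "card A = 3"
        by (auto simp: subset_image_iff)
      then have "card B = 3" using card_image[OF inj_on_subset[OF inj B(1)]] by simp
      then obtain r s t where "r < s" "s < t" "B = {r, s, t}" by (rule card_3_increasing)
      then show "A \<in> ?h ` ?T" using B by (auto intro!: image_eqI[of _ _ "(r, s, t)"])
    qed
  qed
  have "(\<Sum>A | A \<subseteq> \<sigma> ` {..<d} \<and> card A = 3. cluster M m A) = (\<Sum>x\<in>?T. cluster M m (?h x))"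
    by (rule sum.reindex_bij_betw[OF bij, symmetric])
  also have "\<dots> = (\<Sum>(r, s, t) \<in> ?T. eta_coeff (\<lambda>i. M (\<sigma> i)) (\<lambda>i. m (\<sigma> i)) r s t)"
  proof (rule sum.cong)
    fix x assume "x \<in> ?T"
    then obtain r s t where x: "x = (r, s, t)" "r < s" "s < t" "t < d" by auto
    then have "\<sigma> r \<noteq> \<sigma> s" "\<sigma> s \<noteq> \<sigma> t" "\<sigma> t \<noteq> \<sigma> r"
      using inj by (auto dest!: inj_onD)
    then show "cluster M m (?h x) = (case x of (r, s, t) \<Rightarrow> eta_coeff (\<lambda>i. M (\<sigma> i)) (\<lambda>i. m (\<sigma> i)) r s t)"
      using cluster_triple[of "\<sigma> r" "\<sigma> s" "\<sigma> t" M m] x by (simp add: eta_coeff_def)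
  qed simp
  finally show ?thesis .
qed

section \<open>Fibres and branches of a pencil of polynomials\<close>

text \<open>
  The line \<open>\<ell>\<close> contributes the branch \<open>k + e P\<close>: it is constant (\<open>e = 0\<close>) if \<open>\<ell>\<close> passes through the
  origin, and it is \<open>P\<close> itself for the line at infinity. The velocity of a branch \<open>S\<close> is the
  derivative of \<open>P - S\<close>.
\<close>

locale pencil =
  fixes f g :: "complex poly" and n :: nat and k e :: complex
  assumes degree_f: "degree f \<le> n" and degree_g: "degree g \<le> n"
    and coprime: "\<And>S. \<not> (poly f S = 0 \<and> poly g S = 0)"
begin

definition member :: "complex \<Rightarrow> complex poly" where
  "member P = f + smult P g"

definition fibre :: "complex \<Rightarrow> complex set" where
  "fibre P = {S. poly (member P) S = 0}"

definition branches :: "complex \<Rightarrow> complex set" where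
  "branches P = insert (k + e * P) (fibre P)"

definition velocity :: "complex \<Rightarrow> complex \<Rightarrow> complex" where
  "velocity P S = (if S \<in> fibre P then 1 + poly g S / poly (pderiv (member P)) S else 1 - e)"

text \<open>The count forces the fibre to have n simple roots, none of them on the branch of the
  line; the leading coefficient forbids a root at infinity.\<close>

definition regular :: "complex \<Rightarrow> bool" where
  "regular P \<longleftrightarrow> coeff (member P) n \<noteq> 0 \<and> card (branches P) = n + 1"

definition bsum :: "complex \<Rightarrow> complex" where
  "bsum P = (\<Sum>A | A \<subseteq> branches P \<and> card A = 3. cluster (\<lambda>S. P - S) (velocity P) A)"

lemma poly_member: "poly (member P) S = poly f S + P * poly g S"
  by (simp add: member_def)

lemma poly_pderiv_member: "poly (pderiv (member P)) S = poly (pderiv f) S + P * poly (pderiv g) S"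
  by (simp add: member_def pderiv_add pderiv_smult)

lemma mem_fibre: "S \<in> fibre P \<longleftrightarrow> poly f S + P * poly g S = 0"
  by (simp add: fibre_def poly_member)

lemma degree_member: "degree (member P) \<le> n"
  unfolding member_def using degree_f degree_g
  by (intro degree_add_le) (auto intro: order_trans[OF degree_smult_le])

lemma degree_member_eq: "coeff (member P) n \<noteq> 0 \<Longrightarrow> degree (member P) = n"
  by (intro antisym degree_member le_degree)

lemma finite_fibre: "coeff (member P) n \<noteq> 0 \<Longrightarrow> finite (fibre P) \<and> card (fibre P) \<le> n"
  unfolding fibre_def using card_roots_le[OF _ degree_member, of P]
  by (cases "member P = 0") auto

lemma g_nonzero_fibre: "S \<in> fibre P \<Longrightarrow> poly g S \<noteq> 0"
  using coprime[of S] by (auto simp: mem_fibre)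

lemma fibre_imp_quotient: "S \<in> fibre P \<Longrightarrow> P = - poly f S / poly g S"
  using g_nonzero_fibre[of S P] by (auto simp: mem_fibre field_simps add_eq_0_iff)

lemma regularD:
  assumes "regular P"
  shows "finite (fibre P)" "card (fibre P) = n" "k + e * P \<notin> fibre P"
    "\<And>S. S \<in> fibre P \<Longrightarrow> poly (pderiv (member P)) S \<noteq> 0"
proof -
  have c: "coeff (member P) n \<noteq> 0" using assms by (simp add: regular_def)
  show fin: "finite (fibre P)" using finite_fibre[OF c] by simp
  show *: "k + e * P \<notin> fibre P" "card (fibre P) = n"
    using assms finite_fibre[OF c] by (auto simp: regular_def branches_def card_insert_if split: if_splits)
  show "poly (pderiv (member P)) S \<noteq> 0" if "S \<in> fibre P" for S
    by (rule simple_root_if_card_roots)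
       (use that c * degree_member_eq[OF c] in \<open>auto simp: fibre_def\<close>)
qed

lemma regularI:
  assumes "coeff (member P) n \<noteq> 0" "k + e * P \<notin> fibre P"
    "\<And>S. S \<in> fibre P \<Longrightarrow> poly (pderiv (member P)) S \<noteq> 0"
  shows "regular P"
proof -
  have "card (fibre P) = n"
    using card_roots_if_simple[of "member P"] assms degree_member_eq by (auto simp: fibre_def)
  then show ?thesis using assms finite_fibre by (simp add: regular_def branches_def)
qed

text \<open>On the fibre P can be eliminated as -f/g. The condition for a multiple root becomes the
  vanishing of a polynomial in S alone, which leaves finitely many critical values.\<close>

lemma wronskian_fibre:
  assumes "S \<in> fibre P"
  shows "poly (pderiv (member P)) S * poly g S = poly (pderiv f * g - f * pderiv g) S"
proof -
  have f: "poly f S = - P * poly g S" using assms by (simp add: mem_fibre add_eq_0_iff)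
  show ?thesis by (simp add: poly_pderiv_member f algebra_simps)
qed

lemma quotient_derivative:
  assumes "S \<in> fibre P"
  shows "((\<lambda>S. - poly f S / poly g S) has_field_derivative
    - poly (pderiv (member P)) S / poly g S) (at S)"
proof -
  have gnz: "poly g S \<noteq> 0" by (rule g_nonzero_fibre[OF assms])
  have f: "poly f S = - P * poly g S" using assms by (simp add: mem_fibre add_eq_0_iff)
  show ?thesis
    using gnz by (auto intro!: derivative_eq_intros poly_DERIV simp: poly_pderiv_member f field_simps)
qed

text \<open>The branch is the local inverse of -f/g, whose derivative does not vanish at a simple
  root.\<close>

lemma simple_root_branch:
  assumes S1: "S1 \<in> fibre P1" and simple: "poly (pderiv (member P1)) S1 \<noteq> 0"
  obtains r \<sigma> where "r > 0" "\<sigma> P1 = S1"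
    "\<And>P. P \<in> ball P1 r \<Longrightarrow> \<sigma> P \<in> fibre P"
    "\<And>P. P \<in> ball P1 r \<Longrightarrow>
      (\<sigma> has_field_derivative - poly g (\<sigma> P) / poly (pderiv (member P)) (\<sigma> P)) (at P)"
proof -
  define G where "G = (\<lambda>S. - poly f S / poly g S)"
  define T where "T = {S. poly g S \<noteq> 0}"
  have T: "open T" unfolding T_def by (intro open_Collect_neq continuous_intros)
  have G: "G holomorphic_on T" unfolding G_def T_def by (intro holomorphic_intros) auto
  have S1T: "S1 \<in> T" and G1: "G S1 = P1"
    using g_nonzero_fibre[OF S1] fibre_imp_quotient[OF S1] by (simp_all add: T_def G_def)
  have fib: "S \<in> fibre (G S)" if "S \<in> T" for S
    using that by (simp add: mem_fibre G_def T_def)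
  have dG: "deriv G S = - poly (pderiv (member (G S))) S / poly g S" if "S \<in> T" for S
    using quotient_derivative[OF fib[OF that]] DERIV_imp_deriv unfolding G_def by blast
  have "deriv G S1 \<noteq> 0" using dG[OF S1T] simple G1 S1T by (simp add: T_def)
  then obtain r0 where r0: "r0 > 0" "ball S1 r0 \<subseteq> T" "open (G ` ball S1 r0)" "inj_on G (ball S1 r0)"
    using has_complex_derivative_locally_invertible[OF G S1T T] by metis
  obtain h where h: "h holomorphic_on (G ` ball S1 r0)"
    "\<And>S. S \<in> ball S1 r0 \<Longrightarrow> deriv G S * deriv h (G S) = 1"
    "\<And>S. S \<in> ball S1 r0 \<Longrightarrow> h (G S) = S"
    using holomorphic_has_inverse[OF holomorphic_on_subset[OF G r0(2)] open_ball r0(4)] by metis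
  have "P1 \<in> G ` ball S1 r0" using G1 r0(1) by force
  then obtain r where r: "r > 0" "ball P1 r \<subseteq> G ` ball S1 r0"
    using r0(3) open_contains_ball by blast
  show ?thesis
  proof (rule that[OF r(1)])
    show "h P1 = S1" using h(3)[of S1] G1 r0(1) by simp
    fix P assume "P \<in> ball P1 r"
    then obtain S where S: "S \<in> ball S1 r0" "P = G S" using r(2) by blast
    then have hP: "h P = S" and ST: "S \<in> T" using h(3) r0(2) by auto
    show "h P \<in> fibre P" using fib[OF ST] hP S by simp
    have "(h has_field_derivative deriv h P) (at P)"
      using h(1) r0(3) S by (intro holomorphic_derivI) auto
    moreover have "deriv h P = - poly g (h P) / poly (pderiv (member P)) (h P)"
    proof -
      have "- poly (pderiv (member P)) S / poly g S * deriv h P = 1"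
        using h(2)[OF S(1)] dG[OF ST] S by simp
      moreover from this have "poly (pderiv (member P)) S \<noteq> 0" "poly g S \<noteq> 0" by auto
      ultimately show ?thesis unfolding hP by (simp add: field_simps) (metis add.inverse_inverse)
    qed
    ultimately show "(h has_field_derivative - poly g (h P) / poly (pderiv (member P)) (h P)) (at P)"
      by simp
  qed
qed

text \<open>Continuing the simple roots gives n distinct points in every nearby fibre. A fibre has
  at most n points, so nothing else can appear in it.\<close>

lemma regular_branches:
  assumes P1: "regular P1"
  obtains r \<sigma> where "r > 0"
    "\<And>P. P \<in> ball P1 r \<Longrightarrow> regular P"
    "\<And>P. P \<in> ball P1 r \<Longrightarrow> inj_on (\<lambda>i. \<sigma> i P) {..<n + 1}"
    "\<And>P. P \<in> ball P1 r \<Longrightarrow> branches P = (\<lambda>i. \<sigma> i P) ` {..<n + 1}"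
    "\<And>i P. i < n + 1 \<Longrightarrow> P \<in> ball P1 r \<Longrightarrow>
      (\<sigma> i has_field_derivative 1 - velocity P (\<sigma> i P)) (at P)"
proof -
  note reg = regularD[OF P1]
  obtain h where h: "bij_betw h {0..<n} (fibre P1)"
    using ex_bij_betw_nat_finite[OF reg(1)] reg(2) by metis
  have "\<forall>i\<in>{..<n}. \<exists>r\<sigma>. fst r\<sigma> > 0 \<and> snd r\<sigma> P1 = h i \<and> (\<forall>P\<in>ball P1 (fst r\<sigma>). snd r\<sigma> P \<in> fibre P \<and>
     (snd r\<sigma> has_field_derivative - poly g (snd r\<sigma> P) / poly (pderiv (member P)) (snd r\<sigma> P)) (at P))"
  proof
    fix i assume "i \<in> {..<n}"
    then have "h i \<in> fibre P1" using h by (auto simp: bij_betw_def)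
    with reg(4) obtain r \<sigma> where "r > 0" "\<sigma> P1 = h i"
      "\<And>P. P \<in> ball P1 r \<Longrightarrow> \<sigma> P \<in> fibre P"
      "\<And>P. P \<in> ball P1 r \<Longrightarrow>
        (\<sigma> has_field_derivative - poly g (\<sigma> P) / poly (pderiv (member P)) (\<sigma> P)) (at P)"
      using simple_root_branch by metis
    then show "\<exists>r\<sigma>. fst r\<sigma> > 0 \<and> snd r\<sigma> P1 = h i \<and> (\<forall>P\<in>ball P1 (fst r\<sigma>). snd r\<sigma> P \<in> fibre P \<and>
     (snd r\<sigma> has_field_derivative - poly g (snd r\<sigma> P) / poly (pderiv (member P)) (snd r\<sigma> P)) (at P))"
      by (intro exI[of _ "(r, \<sigma>)"]) auto
  qed
  from bchoice[OF this] obtain r\<sigma> where r\<sigma>: "\<And>i. i < n \<Longrightarrow> fst (r\<sigma> i) > 0 \<and> snd (r\<sigma> i) P1 = h i \<and>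
     (\<forall>P\<in>ball P1 (fst (r\<sigma> i)). snd (r\<sigma> i) P \<in> fibre P \<and>
     (snd (r\<sigma> i) has_field_derivative - poly g (snd (r\<sigma> i) P) / poly (pderiv (member P)) (snd (r\<sigma> i) P)) (at P))"
    by auto
  \<comment> \<open>The indices below n belong to the roots, index n to the line.\<close>
  define \<sigma> where "\<sigma> = (\<lambda>i. if i < n then snd (r\<sigma> i) else (\<lambda>P. k + e * P))"
  have ev1: "\<forall>\<^sub>F P in nhds P1. \<sigma> i P \<in> fibre P \<and>
     (\<sigma> i has_field_derivative - poly g (\<sigma> i P) / poly (pderiv (member P)) (\<sigma> i P)) (at P)"
    if "i < n" for i
    unfolding eventually_nhds
    by (rule exI[of _ "ball P1 (fst (r\<sigma> i))"]) (use r\<sigma>[OF that] that in \<open>auto simp: \<sigma>_def\<close>)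
  have cont: "isCont (\<sigma> i) P1" for i
  proof (cases "i < n")
    case True
    then show ?thesis using eventually_nhds_x_imp_x[OF ev1[OF True]] DERIV_isCont by blast
  next
    case False
    then show ?thesis by (auto simp: \<sigma>_def)
  qed
  have ne: "\<sigma> i P1 \<noteq> \<sigma> j P1" if "i < n + 1" "j < n + 1" "i \<noteq> j" for i j
  proof -
    have hij: "h i \<noteq> h j" if "i < n" "j < n"
      using h that \<open>i \<noteq> j\<close> by (auto simp: bij_betw_def dest: inj_onD)
    have hi: "h i \<in> fibre P1" if "i < n" for i using h that by (auto simp: bij_betw_def)
    show ?thesis
      using that r\<sigma>[of i] r\<sigma>[of j] reg(3) hi[of i] hi[of j] hij by (auto simp: \<sigma>_def)
  qed
  have ev2: "\<forall>\<^sub>F P in nhds P1. \<sigma> i P \<noteq> \<sigma> j P" if "i < n + 1" "j < n + 1" "i \<noteq> j" for i j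
  proof -
    have "isCont (\<lambda>P. \<sigma> i P - \<sigma> j P) P1" by (intro continuous_intros cont)
    then have "\<forall>\<^sub>F P in nhds P1. \<sigma> i P - \<sigma> j P \<noteq> 0"
      using ne[OF that] by (intro tendsto_imp_eventually_ne[where c = "\<sigma> i P1 - \<sigma> j P1"])
        (auto simp: continuous_at tendsto_nhds_iff)
    then show ?thesis by simp
  qed
  have "isCont (\<lambda>P. coeff (member P) n) P1" unfolding member_def by (auto intro!: continuous_intros)
  then have ev3: "\<forall>\<^sub>F P in nhds P1. coeff (member P) n \<noteq> 0"
    using P1 by (intro tendsto_imp_eventually_ne[where c = "coeff (member P1) n"])
      (auto simp: continuous_at tendsto_nhds_iff regular_def)
  have ev1': "\<forall>\<^sub>F P in nhds P1. \<forall>i\<in>{..<n}. \<sigma> i P \<in> fibre P \<and>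
     (\<sigma> i has_field_derivative - poly g (\<sigma> i P) / poly (pderiv (member P)) (\<sigma> i P)) (at P)"
    by (intro eventually_ball_finite ballI finite_lessThan ev1) simp
  have ev2': "\<forall>\<^sub>F P in nhds P1. \<forall>i\<in>{..<n + 1}. \<forall>j\<in>{..<n + 1} - {i}. \<sigma> i P \<noteq> \<sigma> j P"
    by (intro eventually_ball_finite ballI finite_lessThan finite_Diff ev2) auto
  have "\<forall>\<^sub>F P in nhds P1. (\<forall>i\<in>{..<n}. \<sigma> i P \<in> fibre P \<and>
     (\<sigma> i has_field_derivative - poly g (\<sigma> i P) / poly (pderiv (member P)) (\<sigma> i P)) (at P)) \<and>
     (\<forall>i\<in>{..<n + 1}. \<forall>j\<in>{..<n + 1} - {i}. \<sigma> i P \<noteq> \<sigma> j P) \<and> coeff (member P) n \<noteq> 0"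
    by (intro eventually_conj ev1' ev2' ev3)
  then obtain r where r: "r > 0" and *: "\<And>P. P \<in> ball P1 r \<Longrightarrow> (\<forall>i\<in>{..<n}. \<sigma> i P \<in> fibre P \<and>
     (\<sigma> i has_field_derivative - poly g (\<sigma> i P) / poly (pderiv (member P)) (\<sigma> i P)) (at P)) \<and>
     (\<forall>i\<in>{..<n + 1}. \<forall>j\<in>{..<n + 1} - {i}. \<sigma> i P \<noteq> \<sigma> j P) \<and> coeff (member P) n \<noteq> 0"
    unfolding eventually_nhds_metric by (auto simp: dist_commute)
  have inj: "inj_on (\<lambda>i. \<sigma> i P) {..<n + 1}" if "P \<in> ball P1 r" for P
    using *[OF that] by (intro inj_onI) blast
  have fib: "fibre P = (\<lambda>i. \<sigma> i P) ` {..<n}" if P: "P \<in> ball P1 r" for P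
  proof (rule sym, rule card_seteq)
    have c: "coeff (member P) n \<noteq> 0" using *[OF P] by blast
    show "finite (fibre P)" using finite_fibre[OF c] by simp
    show "(\<lambda>i. \<sigma> i P) ` {..<n} \<subseteq> fibre P" using *[OF P] by auto
    have "card ((\<lambda>i. \<sigma> i P) ` {..<n}) = n"
      by (subst card_image) (auto intro: inj_on_subset[OF inj[OF P]])
    then show "card (fibre P) \<le> card ((\<lambda>i. \<sigma> i P) ` {..<n})" using finite_fibre[OF c] by simp
  qed
  have br: "branches P = (\<lambda>i. \<sigma> i P) ` {..<n + 1}" if "P \<in> ball P1 r" for P
    unfolding branches_def fib[OF that] using lessThan_Suc[of n] by (simp add: \<sigma>_def)
  show ?thesis
  proof (rule that[OF r])
    fix P assume P: "P \<in> ball P1 r"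
    show "regular P" unfolding regular_def
      using *[OF P] br[OF P] card_image[OF inj[OF P]] by simp
    show "inj_on (\<lambda>i. \<sigma> i P) {..<n + 1}" "branches P = (\<lambda>i. \<sigma> i P) ` {..<n + 1}"
      using inj[OF P] br[OF P] .
    fix i assume i: "i < n + 1"
    show "(\<sigma> i has_field_derivative 1 - velocity P (\<sigma> i P)) (at P)"
    proof (cases "i < n")
      case True
      then show ?thesis using *[OF P] by (auto simp: velocity_def)
    next
      case False
      then have "i = n" using i by simp
      moreover have "\<sigma> n P \<notin> fibre P" unfolding fib[OF P] using *[OF P] by auto
      ultimately show ?thesis by (auto simp: velocity_def \<sigma>_def intro!: derivative_eq_intros)
    qed
  qed
qed

lemma bsum_indexed:
  assumes "inj_on \<sigma> {..<n + 1}" "branches P = \<sigma> ` {..<n + 1}"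
  shows "bsum P = (\<Sum>(r, s, t) \<in> {(r, s, t). r < s \<and> s < t \<and> t < n + 1}.
    eta_coeff (\<lambda>i. P - \<sigma> i) (\<lambda>i. velocity P (\<sigma> i)) r s t)"
  unfolding bsum_def assms(2) by (rule sum_clusters_indexed[OF assms(1)])

lemma open_regular: "open {P. regular P}"
  unfolding open_contains_ball
proof
  fix P assume "P \<in> {P. regular P}"
  then show "\<exists>r>0. ball P r \<subseteq> {P. regular P}"
    using regular_branches[of P] by (metis mem_Collect_eq subsetI)
qed

text \<open>Near a regular value the sum is a rational expression in holomorphic branches with
  distinct values. Since it runs over sets, all local labellings give the same function.\<close>

lemma bsum_holomorphic: "bsum holomorphic_on {P. regular P}"
  unfolding holomorphic_on_open[OF open_regular]
proof
  fix P1 assume "P1 \<in> {P. regular P}"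
  then obtain r \<sigma> where r: "r > 0"
    "\<And>P. P \<in> ball P1 r \<Longrightarrow> regular P"
    "\<And>P. P \<in> ball P1 r \<Longrightarrow> inj_on (\<lambda>i. \<sigma> i P) {..<n + 1}"
    "\<And>P. P \<in> ball P1 r \<Longrightarrow> branches P = (\<lambda>i. \<sigma> i P) ` {..<n + 1}"
    "\<And>i P. i < n + 1 \<Longrightarrow> P \<in> ball P1 r \<Longrightarrow>
      (\<sigma> i has_field_derivative 1 - velocity P (\<sigma> i P)) (at P)"
    using regular_branches[of P1] by auto
  have h\<sigma>: "\<sigma> i holomorphic_on ball P1 r" if "i < n + 1" for i
    unfolding holomorphic_on_open[OF open_ball] using r(5)[OF that] by blast
  have hv: "(\<lambda>P. velocity P (\<sigma> i P)) holomorphic_on ball P1 r" if "i < n + 1" for i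
  proof -
    have "(\<lambda>P. 1 - deriv (\<sigma> i) P) holomorphic_on ball P1 r"
      by (intro holomorphic_intros holomorphic_deriv h\<sigma> that open_ball)
    then show ?thesis
      by (rule holomorphic_transform) (use DERIV_imp_deriv[OF r(5)[OF that]] in auto)
  qed
  have "(\<lambda>P. \<Sum>(x, s, t) \<in> {(r, s, t). r < s \<and> s < t \<and> t < n + 1}.
    eta_coeff (\<lambda>i. P - \<sigma> i P) (\<lambda>i. velocity P (\<sigma> i P)) x s t) holomorphic_on ball P1 r"
  proof (intro holomorphic_on_sum)
    fix x :: "nat \<times> nat \<times> nat" assume "x \<in> {(r, s, t). r < s \<and> s < t \<and> t < n + 1}"
    then obtain a b c where x: "x = (a, b, c)" "a < b" "b < c" "c < n + 1" by auto
    have ne: "\<sigma> i P \<noteq> \<sigma> j P" if "i < n + 1" "j < n + 1" "i \<noteq> j" "P \<in> ball P1 r" for i j P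
      using r(3)[OF that(4)] that by (auto dest: inj_onD)
    have "(\<lambda>P. eta_coeff (\<lambda>i. P - \<sigma> i P) (\<lambda>i. velocity P (\<sigma> i P)) a b c) holomorphic_on ball P1 r"
      unfolding eta_coeff_def
      by (intro holomorphic_intros h\<sigma> hv) (use x ne[of a b] ne[of b c] ne[of a c] in force)+
    then show "(\<lambda>P. case x of (x, s, t) \<Rightarrow>
        eta_coeff (\<lambda>i. P - \<sigma> i P) (\<lambda>i. velocity P (\<sigma> i P)) x s t) holomorphic_on ball P1 r"
      by (simp add: x)
  qed
  then have "bsum holomorphic_on ball P1 r"
    by (rule holomorphic_transform) (rule bsum_indexed[OF r(3,4), symmetric])
  then show "\<exists>f'. (bsum has_field_derivative f') (at P1)"
    using r(1) by (auto simp: holomorphic_on_open)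
qed

text \<open>At a root of f, where g does not vanish, f' g has a smaller order than f g'. A vanishing
  Wronskian thus leaves f, and by symmetry g, without roots; both are constant, against the nonzero
  coefficient of degree n.\<close>

lemma wronskian_nonzero:
  assumes "n \<ge> 1" "coeff f n \<noteq> 0 \<or> coeff g n \<noteq> 0"
  shows "pderiv f * g - f * pderiv g \<noteq> 0"
proof
  assume W: "pderiv f * g - f * pderiv g = 0"
  have const: "degree p = 0"
    if eq: "pderiv p * q = p * pderiv q" and cop: "\<And>S. \<not> (poly p S = 0 \<and> poly q S = 0)"
    for p q :: "complex poly"
  proof (rule ccontr)
    assume d: "degree p \<noteq> 0"
    then obtain S where S: "poly p S = 0"
      using Fundamental_Theorem_Algebra.fundamental_theorem_of_algebra[of p]
      by (auto simp: constant_degree)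
    have q: "poly q S \<noteq> 0" using cop S by blast
    have p': "pderiv p \<noteq> 0" using d by (simp add: pderiv_eq_0_iff)
    have "pderiv p * q \<noteq> 0" using p' q by auto
    then have "order S (pderiv p) + order S q = order S p + order S (pderiv q)"
      using order_mult[of "pderiv p" q S] order_mult[of p "pderiv q" S] eq by simp
    moreover have "order S q = 0" using q by (simp add: order_0I)
    moreover have "order S p = Suc (order S (pderiv p))"
      using p' S d by (intro order_pderiv) (auto simp: order_root)
    ultimately show False by simp
  qed
  have "degree f = 0" "degree g = 0"
    using const[of f g] const[of g f] coprime W by (auto simp: mult.commute)
  then show False using assms by (auto simp: coeff_eq_0)
qed

text \<open>Regularity fails if the leading coefficient drops, at critical values, and where the
  branch of the line meets the fibre. For the line at infinity the last set consists of the fixed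
  points, the roots of \<open>f + pCons 0 g\<close>.\<close>

lemma finite_not_regular:
  assumes n: "n \<ge> 1" "coeff f n \<noteq> 0 \<or> coeff g n \<noteq> 0"
    and line: "e = 0 \<or> (k = 0 \<and> e = 1 \<and> f + pCons 0 g \<noteq> 0)"
  shows "finite {P. \<not> regular P}"
proof -
  define W where "W = pderiv f * g - f * pderiv g"
  define E1 where "E1 = {P. coeff (member P) n = 0}"
  define E2 where "E2 = (\<lambda>S. - poly f S / poly g S) ` {S. poly W S = 0}"
  define E3 where "E3 = {P. k + e * P \<in> fibre P}"
  have "E1 = {P. poly [:coeff f n, coeff g n:] P = 0}"
    by (simp add: E1_def member_def)
  moreover have "[:coeff f n, coeff g n:] \<noteq> 0" using n by auto
  ultimately have "finite E1" using poly_roots_finite by metis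
  moreover have "finite E2" unfolding E2_def W_def
    by (intro finite_imageI poly_roots_finite wronskian_nonzero n)
  moreover have "finite E3"
  proof (cases "e = 0")
    case True
    then have "E3 = {P. poly [:poly f k, poly g k:] P = 0}" by (simp add: E3_def mem_fibre)
    moreover have "[:poly f k, poly g k:] \<noteq> 0" using coprime[of k] by auto
    ultimately show ?thesis using poly_roots_finite by metis
  next
    case False
    then have "E3 = {P. poly (f + pCons 0 g) P = 0}" using line by (simp add: E3_def mem_fibre)
    then show ?thesis using poly_roots_finite[of "f + pCons 0 g"] line False by auto
  qed
  moreover have "{P. \<not> regular P} \<subseteq> E1 \<union> E2 \<union> E3"
  proof
    fix P assume P: "P \<in> {P. \<not> regular P}"
    show "P \<in> E1 \<union> E2 \<union> E3"
    proof (rule ccontr)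
      assume no: "P \<notin> E1 \<union> E2 \<union> E3"
      have "poly (pderiv (member P)) S \<noteq> 0" if S: "S \<in> fibre P" for S
      proof
        assume "poly (pderiv (member P)) S = 0"
        then have "poly W S = 0" using wronskian_fibre[OF S] by (simp add: W_def)
        then have "P \<in> E2" using fibre_imp_quotient[OF S] by (auto simp: E2_def)
        then show False using no by simp
      qed
      then have "regular P" using no by (intro regularI) (auto simp: E1_def E3_def)
      then show False using P by simp
    qed
  qed
  ultimately show ?thesis by (meson finite_UnI finite_subset)
qed

end

section \<open>Growth at a tame point\<close>

lemma prod_mset_lower_bound:
  fixes A :: "complex multiset"
  assumes r: "r > 0"
  shows "\<exists>c>0. \<forall>S. (\<forall>a\<in>#A. r \<le> dist a S) \<longrightarrow> c * (1 + norm S) ^ size A \<le> norm (\<Prod>a\<in>#A. S - a)"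
proof (induction A)
  case empty
  then show ?case by (auto intro!: exI[of _ 1])
next
  case (add x A)
  then obtain c where c: "c > 0"
    "\<And>S. (\<forall>a\<in>#A. r \<le> dist a S) \<Longrightarrow> c * (1 + norm S) ^ size A \<le> norm (\<Prod>a\<in>#A. S - a)" by auto
  \<comment> \<open>From \<open>r \<le> norm (S - x)\<close>, weighted by 1 + |x|, and
    \<open>norm S - norm x \<le> norm (S - x)\<close>, weighted by r.\<close>
  define t where "t = r / (1 + r + norm x)"
  have t: "t > 0" using r by (simp add: t_def add_pos_nonneg)
  have step: "t * (1 + norm S) \<le> norm (S - x)" if "r \<le> dist x S" for S
  proof -
    have 1: "r \<le> norm (S - x)" using that by (simp add: dist_norm norm_minus_commute)
    have 2: "norm S - norm x \<le> norm (S - x)" by (rule norm_triangle_ineq2)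
    have "r * (1 + norm S) = (1 + norm x) * r + r * (norm S - norm x)" by (simp add: algebra_simps)
    also have "\<dots> \<le> (1 + norm x) * norm (S - x) + r * norm (S - x)"
      using 1 2 r by (intro add_mono mult_left_mono) auto
    finally have "r * (1 + norm S) \<le> (1 + r + norm x) * norm (S - x)" by (simp add: algebra_simps)
    then show ?thesis using r by (simp add: t_def divide_le_eq add_pos_nonneg mult.commute)
  qed
  show ?case
  proof (intro exI[of _ "t * c"] conjI allI impI)
    show "t * c > 0" using t c by simp
    fix S assume S: "\<forall>a\<in>#add_mset x A. r \<le> dist a S"
    have "(t * (1 + norm S)) * (c * (1 + norm S) ^ size A) \<le> norm (S - x) * norm (\<Prod>a\<in>#A. S - a)"
      using S step[of S] c t by (intro mult_mono) auto
    then show "t * c * (1 + norm S) ^ size (add_mset x A) \<le> norm (\<Prod>a\<in>#add_mset x A. S - a)"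
      by (simp only: image_mset_add_mset prod_mset.add_mset norm_mult size_add_mset power_Suc)
        (simp only: mult_ac)
  qed
qed

lemma poly_prod_mset_linear:
  "poly (\<Prod>x\<in>#A. [:-x, 1:]) S = (\<Prod>a\<in>#A. S - a)" for S :: complex
  by (induction A) (auto simp: algebra_simps)

text \<open>The growth factor makes the bound uniform up to infinity, so that it also controls roots
  of nearby polynomials that are far away.\<close>

lemma poly_lower_bound:
  fixes F :: "complex poly"
  assumes "F \<noteq> 0" "r > 0"
  obtains c where "c > 0"
    "\<And>S. (\<And>a. poly F a = 0 \<Longrightarrow> r \<le> dist a S) \<Longrightarrow> c * (1 + norm S) ^ degree F \<le> norm (poly F S)"
proof -
  obtain A where A: "size A = degree F" "F = smult (lead_coeff F) (\<Prod>x\<in>#A. [:-x, 1:])"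
    using alg_closed_imp_factorization[OF assms(1)] by blast
  have ev: "poly F S = lead_coeff F * (\<Prod>a\<in>#A. S - a)" for S
    by (subst A(2)) (simp add: poly_prod_mset_linear)
  have root: "poly F a = 0" if "a \<in># A" for a
  proof -
    have "0 \<in># image_mset ((-) a) A" using that by force
    then have "(\<Prod>b\<in>#A. a - b) = 0" by (simp only: prod_mset_zero_iff)
    then show ?thesis by (simp add: ev)
  qed
  obtain c where c: "c > 0"
    "\<And>S. (\<forall>a\<in>#A. r \<le> dist a S) \<Longrightarrow> c * (1 + norm S) ^ size A \<le> norm (\<Prod>a\<in>#A. S - a)"
    using prod_mset_lower_bound[OF assms(2)] by metis
  show ?thesis
  proof (rule that[of "norm (lead_coeff F) * c"])
    show "norm (lead_coeff F) * c > 0" using c assms by simp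
    fix S assume "\<And>a. poly F a = 0 \<Longrightarrow> r \<le> dist a S"
    then have "c * (1 + norm S) ^ degree F \<le> norm (\<Prod>a\<in>#A. S - a)"
      using c(2)[of S] root A(1) by auto
    then show "norm (lead_coeff F) * c * (1 + norm S) ^ degree F \<le> norm (poly F S)"
      by (simp add: ev norm_mult mult_left_mono mult.assoc)
  qed
qed

lemma poly_upper_bound:
  fixes g :: "complex poly"
  assumes "degree g \<le> n"
  obtains C where "C > 0" "\<And>S. norm (poly g S) \<le> C * (1 + norm S) ^ n"
proof
  define C where "C = 1 + (\<Sum>i\<le>degree g. norm (coeff g i))"
  show "C > 0" unfolding C_def by (intro add_pos_nonneg sum_nonneg) auto
  fix S
  have "norm (poly g S) \<le> (\<Sum>i\<le>degree g. norm (coeff g i * S ^ i))"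
    unfolding poly_altdef by (rule norm_sum)
  also have "\<dots> \<le> (\<Sum>i\<le>degree g. norm (coeff g i) * (1 + norm S) ^ n)"
  proof (rule sum_mono)
    fix i assume i: "i \<in> {..degree g}"
    have "norm S ^ i \<le> (1 + norm S) ^ i" by (intro power_mono) auto
    also have "\<dots> \<le> (1 + norm S) ^ n" using i assms by (intro power_increasing) auto
    finally show "norm (coeff g i * S ^ i) \<le> norm (coeff g i) * (1 + norm S) ^ n"
      by (simp add: norm_mult norm_power mult_left_mono)
  qed
  also have "\<dots> \<le> C * (1 + norm S) ^ n"
    by (simp add: C_def sum_distrib_right distrib_right)
  finally show "norm (poly g S) \<le> C * (1 + norm S) ^ n" .
qed

lemma unity_roots_separated:
  assumes "m > 0"
  obtains \<kappa> where "\<kappa> > 0" "\<And>u::complex. u ^ m = 1 \<Longrightarrow> u \<noteq> 1 \<Longrightarrow> \<kappa> \<le> norm (u - 1)"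
proof
  \<comment> \<open>The element 1 keeps the minimum meaningful if 1 is the only root of
    unity.\<close>
  define X where "X = insert 1 ((\<lambda>u::complex. norm (u - 1)) ` ({u. u ^ m = 1} - {1}))"
  have fin: "finite X" unfolding X_def using assms by (intro finite.insertI finite_imageI finite_Diff finite_roots_unity) auto
  show "Min X > 0" using fin by (subst Min_gr_iff) (auto simp: X_def)
  show "Min X \<le> norm (u - 1)" if "u ^ m = 1" "u \<noteq> 1" for u :: complex
    by (rule Min_le[OF fin]) (use that in \<open>auto simp: X_def\<close>)
qed

text \<open>The cofactor of (w - a)^m has no zeros on a disc; it has a holomorphic logarithm there
  and hence an m-th root.\<close>

lemma holomorphic_local_power:
  assumes "G holomorphic_on T" "open T" "a \<in> T" and nonconst: "\<And>r. r > 0 \<Longrightarrow> \<not> G constant_on ball a r"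
  obtains r m \<psi> where "0 < (r::real)" "0 < (m::nat)" "ball a r \<subseteq> T" "\<psi> holomorphic_on ball a r"
    "\<And>w. w \<in> ball a r \<Longrightarrow> G w - G a = \<psi> w ^ m" "\<psi> a = 0" "deriv \<psi> a \<noteq> 0"
proof -
  obtain r0 where r0: "r0 > 0" "ball a r0 \<subseteq> T" using assms open_contains_ball by blast
  have hol: "(\<lambda>w. G w - G a) holomorphic_on ball a r0"
    using assms r0 by (intro holomorphic_intros) (auto intro: holomorphic_on_subset)
  have nc: "\<not> (\<lambda>w. G w - G a) constant_on ball a r0"
  proof
    assume "(\<lambda>w. G w - G a) constant_on ball a r0"
    then obtain y where "\<And>w. w \<in> ball a r0 \<Longrightarrow> G w - G a = y" by (auto simp: constant_on_def)
    then have "G constant_on ball a r0"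
      unfolding constant_on_def by (intro exI[of _ "y + G a"]) (auto simp: algebra_simps)
    then show False using nonconst[OF r0(1)] by blast
  qed
  obtain h r m where h: "0 < m" "0 < r" "ball a r \<subseteq> ball a r0" "h holomorphic_on ball a r"
    "\<And>w. w \<in> ball a r \<Longrightarrow> G w - G a = (w - a) ^ m * h w"
    "\<And>w. w \<in> ball a r \<Longrightarrow> h w \<noteq> 0"
    by (rule holomorphic_factor_zero_nonconstant[OF hol open_ball connected_ball _ _ nc]) (use r0 in auto)
  obtain L where L: "L holomorphic_on ball a r" "\<And>z. z \<in> ball a r \<Longrightarrow> h z = exp (L z)"
    using contractible_imp_holomorphic_log[OF h(4) _ h(6)] convex_imp_contractible by blast
  define \<psi> where "\<psi> = (\<lambda>w. (w - a) * exp (L w / of_nat m))"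
  show ?thesis
  proof (rule that[OF h(2) h(1)])
    show "ball a r \<subseteq> T" using h r0 by auto
    show "\<psi> holomorphic_on ball a r" unfolding \<psi>_def using h(1) by (intro holomorphic_intros L) auto
    show "\<psi> a = 0" by (simp add: \<psi>_def)
    show "G w - G a = \<psi> w ^ m" if "w \<in> ball a r" for w
    proof -
      have "exp (L w / of_nat m) ^ m = exp (L w)"
        using h(1) by (simp add: exp_of_nat_mult[symmetric])
      then show ?thesis using h(5)[OF that] L(2)[OF that] by (simp add: \<psi>_def power_mult_distrib)
    qed
    have "(L has_field_derivative deriv L a) (at a)"
      using L h(2) by (intro holomorphic_derivI) auto
    then have "(\<psi> has_field_derivative exp (L a / of_nat m)) (at a)"
      unfolding \<psi>_def using h(1) by (auto intro!: derivative_eq_intros)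
    then show "deriv \<psi> a \<noteq> 0" by (simp add: DERIV_imp_deriv)
  qed
qed

lemma holomorphic_local_bounds:
  assumes \<psi>: "\<psi> holomorphic_on ball a r" "r > 0" "\<psi> a = 0" "deriv \<psi> a \<noteq> 0"
  obtains \<rho> K c where "0 < \<rho>" "\<rho> \<le> r" "0 < K" "0 < c" "inj_on \<psi> (ball a \<rho>)"
    "\<And>S T. S \<in> ball a \<rho> \<Longrightarrow> T \<in> ball a \<rho> \<Longrightarrow> norm (\<psi> S - \<psi> T) \<le> K * norm (S - T)"
    "\<And>S. S \<in> ball a \<rho> \<Longrightarrow> c * norm (S - a) \<le> norm (\<psi> S)"
proof -
  have a: "a \<in> ball a r" using assms by simp
  obtain r1 where r1: "r1 > 0" "ball a r1 \<subseteq> ball a r" "inj_on \<psi> (ball a r1)"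
    using has_complex_derivative_locally_injective[OF \<psi>(1) a open_ball \<psi>(4)] by metis
  have da: "(\<psi> has_field_derivative deriv \<psi> a) (at a)" using \<psi> a by (intro holomorphic_derivI) auto
  define c where "c = norm (deriv \<psi> a) / 2"
  have c: "c > 0" using \<psi>(4) by (simp add: c_def)
  have "((\<lambda>S. norm ((\<psi> S - \<psi> a) / (S - a))) \<longlongrightarrow> norm (deriv \<psi> a)) (at a)"
    using da by (intro tendsto_norm) (simp add: has_field_derivative_iff)
  then have "\<forall>\<^sub>F S in at a. c < norm ((\<psi> S - \<psi> a) / (S - a))"
    using c by (intro order_tendstoD(1)) (auto simp: c_def)
  then obtain r2 where r2: "r2 > 0" "\<And>S. S \<noteq> a \<Longrightarrow> dist S a < r2 \<Longrightarrow> c < norm ((\<psi> S - \<psi> a) / (S - a))"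
    unfolding eventually_at by auto
  define \<rho> where "\<rho> = Min {r1, r2, r / 2}"
  have \<rho>: "0 < \<rho>" "\<rho> \<le> r1" "\<rho> \<le> r2" "\<rho> \<le> r / 2" using r1 r2 \<psi> by (auto simp: \<rho>_def)
  have "compact (deriv \<psi> ` cball a \<rho>)"
  proof (intro compact_continuous_image compact_cball)
    have "cball a \<rho> \<subseteq> ball a r" using \<rho> \<psi>(2) by (auto simp: subset_iff)
    moreover have "deriv \<psi> holomorphic_on ball a r" using \<psi>(1) by (intro holomorphic_deriv) auto
    ultimately show "continuous_on (cball a \<rho>) (deriv \<psi>)"
      using continuous_on_subset holomorphic_on_imp_continuous_on by blast
  qed
  then have "bounded (deriv \<psi> ` cball a \<rho>)" by (rule compact_imp_bounded)
  then obtain K where K: "K > 0" "\<And>S. S \<in> cball a \<rho> \<Longrightarrow> norm (deriv \<psi> S) \<le> K"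
    unfolding bounded_pos by blast
  show ?thesis
  proof (rule that[of \<rho> K c])
    show "0 < \<rho>" "\<rho> \<le> r" "0 < K" "0 < c" using \<rho> \<psi>(2) K c by auto
    show "inj_on \<psi> (ball a \<rho>)" by (rule inj_on_subset[OF r1(3) subset_ball[OF \<rho>(2)]])
    show "norm (\<psi> S - \<psi> T) \<le> K * norm (S - T)" if "S \<in> ball a \<rho>" "T \<in> ball a \<rho>" for S T
    proof (rule field_differentiable_bound[OF convex_ball _ _ that])
      fix z assume z: "z \<in> ball a \<rho>"
      then have zr: "z \<in> ball a r" using \<rho> \<psi>(2) by auto
      show "(\<psi> has_field_derivative deriv \<psi> z) (at z within ball a \<rho>)"
        by (rule has_field_derivative_at_within[OF holomorphic_derivI[OF \<psi>(1) open_ball zr]])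
      show "norm (deriv \<psi> z) \<le> K" using K z by auto
    qed
    show "c * norm (S - a) \<le> norm (\<psi> S)" if "S \<in> ball a \<rho>" for S
    proof (cases "S = a")
      case False
      then have "c < norm (\<psi> S) / norm (S - a)"
        using r2(2)[OF False] that \<rho> \<psi>(3) by (simp add: dist_commute norm_divide)
      then show ?thesis using False by (simp add: field_simps)
    qed simp
  qed
qed

section \<open>Behaviour of the fibres near a given value\<close>

context pencil
begin

text \<open>On the fibre of P, \<open>member P0\<close> takes the value (P0 - P) g(S). Away from its
  roots it is at least c (1 + |S|)^n in size, while g is at most C (1 + |S|)^n; hence the radius c /
  C. In particular no root escapes to infinity.\<close>

lemma fibre_near_fibre:
  assumes P0: "coeff (member P0) n \<noteq> 0" and r: "r > 0"
  shows "\<forall>\<^sub>F P in nhds P0. \<forall>S\<in>fibre P. \<exists>a\<in>fibre P0. S \<in> ball a r"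
proof -
  have "member P0 \<noteq> 0" using P0 by auto
  then obtain c where c: "c > 0" "\<And>S. (\<And>a. poly (member P0) a = 0 \<Longrightarrow> r \<le> dist a S) \<Longrightarrow>
      c * (1 + norm S) ^ degree (member P0) \<le> norm (poly (member P0) S)"
    using poly_lower_bound[OF _ r] by metis
  obtain C where C: "C > 0" "\<And>S. norm (poly g S) \<le> C * (1 + norm S) ^ n"
    using poly_upper_bound[OF degree_g] by metis
  have "\<exists>a\<in>fibre P0. S \<in> ball a r" if P: "dist P P0 < c / C" and S: "S \<in> fibre P" for P S
  proof (rule ccontr)
    assume "\<not> (\<exists>a\<in>fibre P0. S \<in> ball a r)"
    then have "c * (1 + norm S) ^ n \<le> norm (poly (member P0) S)"
      using c(2)[of S] degree_member_eq[OF P0] by (auto simp: fibre_def not_less)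
    also have "poly (member P0) S = (P0 - P) * poly g S"
      using S by (simp add: mem_fibre poly_member algebra_simps add_eq_0_iff)
    also have "norm \<dots> \<le> dist P P0 * (C * (1 + norm S) ^ n)"
      using C(2)[of S] by (simp add: norm_mult dist_norm norm_minus_commute mult_left_mono)
    also have "\<dots> < (c / C) * (C * (1 + norm S) ^ n)"
      using P C by (intro mult_strict_right_mono mult_pos_pos zero_less_power) (auto intro: add_pos_nonneg)
    also have "\<dots> = c * (1 + norm S) ^ n" using C by simp
    finally show False by simp
  qed
  then show ?thesis unfolding eventually_nhds_metric using c C by (intro exI[of _ "c / C"]) auto
qed

lemma quotient_holomorphic: "(\<lambda>S. - poly f S / poly g S) holomorphic_on {S. poly g S \<noteq> 0}"
  by (intro holomorphic_intros) auto

lemma open_g_nonzero: "open {S. poly g S \<noteq> 0}"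
  by (intro open_Collect_neq continuous_intros)

text \<open>Near the fixed point -f/g equals P0 + \<psi>^m with a local coordinate \<psi>. In this
  coordinate, points of one fibre differ by m-th roots of unity, so their mutual distance dominates
  their distance to P0. The value at the centre P0 is P0 itself, so \<open>P - T\<close> is of that
  order as well.\<close>

lemma fixed_point_local:
  assumes c0: "coeff (member P0) n \<noteq> 0" and fx: "P0 \<in> fibre P0"
  obtains r K where "0 < r" "0 < K"
    "\<And>P S T. S \<in> ball P0 r \<Longrightarrow> T \<in> ball P0 r \<Longrightarrow> S \<in> fibre P \<Longrightarrow> T \<in> fibre P \<Longrightarrow> S \<noteq> T \<Longrightarrow>
      norm (P - T) \<le> K * norm (S - T)"
    "\<And>P S. S \<in> ball P0 r \<Longrightarrow> S \<in> fibre P \<Longrightarrow> norm (P - P0) \<le> K * norm (S - P0)"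
    "\<And>\<epsilon>. \<epsilon> > 0 \<Longrightarrow> \<forall>\<^sub>F S in nhds P0. \<forall>P. S \<in> fibre P \<longrightarrow> norm ((P - P0) * velocity P S) \<le> \<epsilon>"
proof -
  define G where "G = (\<lambda>S. - poly f S / poly g S)"
  define X where "X = {S. poly g S \<noteq> 0}"
  have X: "open X" "G holomorphic_on X" using quotient_holomorphic open_g_nonzero by (auto simp: X_def G_def)
  have fibG: "S \<in> X" "P = G S" if "S \<in> fibre P" for S P
    using g_nonzero_fibre[OF that] fibre_imp_quotient[OF that] by (auto simp: X_def G_def)
  have GP0: "G P0 = P0" "P0 \<in> X" using fibG[OF fx] by auto
  have nonconst: "\<not> G constant_on ball P0 r" if "r > 0" for r
  proof
    assume con: "G constant_on ball P0 r"
    obtain r1 where r1: "r1 > 0" "ball P0 r1 \<subseteq> X" using X GP0 open_contains_ball by blast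
    have "ball P0 (min r r1) \<subseteq> {S. poly (member P0) S = 0}"
    proof
      fix S assume S: "S \<in> ball P0 (min r r1)"
      then have "G S = P0" using con GP0 that unfolding constant_on_def by (metis ball_min_Int IntE centre_in_ball)
      moreover have "S \<in> X" using S r1 by auto
      ultimately have "- poly f S = P0 * poly g S" by (auto simp: G_def X_def)
      then show "S \<in> {S. poly (member P0) S = 0}"
        by (simp add: poly_member neg_eq_iff_add_eq_0)
    qed
    moreover have "infinite (ball P0 (min r r1))"
      using that r1 by (intro uncountable_infinite uncountable_ball) auto
    moreover have "finite {S. poly (member P0) S = 0}"
      using c0 by (intro poly_roots_finite) auto
    ultimately show False using finite_subset by blast
  qed
  obtain r0 m \<psi> where \<psi>: "0 < r0" "0 < m" "ball P0 r0 \<subseteq> X" "\<psi> holomorphic_on ball P0 r0"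
    "\<And>w. w \<in> ball P0 r0 \<Longrightarrow> G w - G P0 = \<psi> w ^ m" "\<psi> P0 = 0" "deriv \<psi> P0 \<noteq> 0"
    using holomorphic_local_power[OF X(2,1) GP0(2) nonconst] by metis
  obtain \<rho> K1 c where loc: "0 < \<rho>" "\<rho> \<le> r0" "0 < K1" "0 < c" "inj_on \<psi> (ball P0 \<rho>)"
    "\<And>S T. S \<in> ball P0 \<rho> \<Longrightarrow> T \<in> ball P0 \<rho> \<Longrightarrow> norm (\<psi> S - \<psi> T) \<le> K1 * norm (S - T)"
    "\<And>S. S \<in> ball P0 \<rho> \<Longrightarrow> c * norm (S - P0) \<le> norm (\<psi> S)"
    using holomorphic_local_bounds[OF \<psi>(4,1,6,7)] by metis
  obtain \<kappa> where \<kappa>: "\<kappa> > 0" "\<And>u::complex. u ^ m = 1 \<Longrightarrow> u \<noteq> 1 \<Longrightarrow> \<kappa> \<le> norm (u - 1)"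
    using unity_roots_separated[OF \<psi>(2)] by metis
  \<comment> \<open>The bound 1/K1 makes \<open>norm (\<psi> S) \<le> 1\<close>, so that the m-th
    power is dominated by the first.\<close>
  define r where "r = min \<rho> (1 / K1)"
  have r: "0 < r" "r \<le> \<rho>" "r \<le> 1 / K1" using loc by (auto simp: r_def)
  have \<psi>eq: "P - P0 = \<psi> S ^ m" if "S \<in> ball P0 r" "S \<in> fibre P" for S P
    using \<psi>(5)[of S] that r loc fibG[OF that(2)] GP0 by auto
  have \<psi>le: "norm (\<psi> S) \<le> K1 * norm (S - P0)" if "S \<in> ball P0 r" for S
    using loc(6)[of S P0] that r loc(1) \<psi>(6) by auto
  have PP0: "norm (P - P0) \<le> K1 * norm (S - P0)" if S: "S \<in> ball P0 r" "S \<in> fibre P" for S P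
  proof -
    have "norm (S - P0) \<le> 1 / K1"
      using S(1) r(3) by (simp add: dist_norm norm_minus_commute)
    then have "K1 * norm (S - P0) \<le> 1" using loc(3) by (simp add: field_simps)
    then have "norm (\<psi> S) \<le> 1" using \<psi>le[OF S(1)] by simp
    then have "norm (\<psi> S) ^ m \<le> norm (\<psi> S) ^ 1" using \<psi>(2) by (intro power_decreasing) auto
    then show ?thesis using \<psi>eq[OF S] \<psi>le[OF S(1)] by (simp add: norm_power)
  qed
  \<comment> \<open>The first summand serves two points of one fibre, the second a point and
    P0.\<close>
  define K where "K = (K1 + 1) * (K1 / (\<kappa> * c)) + K1"
  have K: "K > 0" "K1 \<le> K" using \<kappa> loc by (auto simp: K_def intro!: add_pos_pos)
  show ?thesis
  proof (rule that[OF r(1) K(1)])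
    show "norm (P - P0) \<le> K * norm (S - P0)" if "S \<in> ball P0 r" "S \<in> fibre P" for S P
      using PP0[OF that] K(2) by (meson mult_right_mono norm_ge_zero order_trans)
    show "norm (P - T) \<le> K * norm (S - T)"
      if ST: "S \<in> ball P0 r" "T \<in> ball P0 r" "S \<in> fibre P" "T \<in> fibre P" "S \<noteq> T" for P S T
    proof -
      have ne: "\<psi> S \<noteq> \<psi> T" using ST r loc(5) by (auto dest!: inj_onD)
      have pow: "\<psi> S ^ m = \<psi> T ^ m" using \<psi>eq ST by metis
      have T0: "\<psi> T \<noteq> 0" using pow ne \<psi>(2) by (auto simp: power_0_left)
      have "\<kappa> \<le> norm (\<psi> S / \<psi> T - 1)"
        by (rule \<kappa>(2)) (use pow ne T0 in \<open>auto simp: power_divide\<close>)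
      also have "\<psi> S / \<psi> T - 1 = (\<psi> S - \<psi> T) / \<psi> T" using T0 by (simp add: field_simps)
      finally have "\<kappa> * norm (\<psi> T) \<le> norm (\<psi> S - \<psi> T)" using T0 by (simp add: norm_divide field_simps)
      moreover have "\<kappa> * (c * norm (T - P0)) \<le> \<kappa> * norm (\<psi> T)"
        using loc(7)[of T] ST r \<kappa> by (intro mult_left_mono) auto
      moreover have "norm (\<psi> S - \<psi> T) \<le> K1 * norm (S - T)" using loc(6)[of S T] ST r by auto
      ultimately have "(\<kappa> * c) * norm (T - P0) \<le> K1 * norm (S - T)" by linarith
      then have TP0: "norm (T - P0) \<le> (K1 / (\<kappa> * c)) * norm (S - T)"
        using \<kappa> loc by (simp add: field_simps)
      have "norm (P - T) \<le> norm (P - P0) + norm (T - P0)"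
        using norm_triangle_ineq4[of "P - P0" "T - P0"] by simp
      also have "\<dots> \<le> (K1 + 1) * norm (T - P0)" using PP0[OF ST(2,4)] by (simp add: algebra_simps)
      also have "\<dots> \<le> (K1 + 1) * ((K1 / (\<kappa> * c)) * norm (S - T))"
        using TP0 loc by (intro mult_left_mono) auto
      also have "\<dots> \<le> K * norm (S - T)" using loc by (simp add: K_def algebra_simps)
      finally show ?thesis .
    qed
    fix \<epsilon> :: real assume \<epsilon>: "\<epsilon> > 0"
    \<comment> \<open>Differentiating P - P0 = \<psi>^m shows that the product is \<psi>^m - \<psi>
      / (m \<psi>'). It tends to 0 although the velocity itself is unbounded for m > 1.\<close>
    define E where "E = (\<lambda>S. norm (\<psi> S) ^ m + norm (\<psi> S) / (of_nat m * norm (deriv \<psi> S)))"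
    have c\<psi>: "isCont \<psi> P0" "isCont (deriv \<psi>) P0"
      using \<psi>(1,4) holomorphic_deriv[OF \<psi>(4)]
      by (auto intro!: continuous_on_interior[of "ball P0 r0"] holomorphic_on_imp_continuous_on)
    have "isCont E P0" unfolding E_def using \<psi>(2,7)
      by (intro continuous_intros c\<psi>) auto
    moreover have "E P0 = 0" using \<psi>(2,6) by (simp add: E_def)
    ultimately have "(E \<longlongrightarrow> 0) (nhds P0)" by (metis continuous_at tendsto_nhds_iff)
    then have "\<forall>\<^sub>F S in nhds P0. E S < \<epsilon>" using \<epsilon> by (rule order_tendstoD)
    moreover have "\<forall>\<^sub>F S in nhds P0. S \<in> ball P0 r" using r(1) by (intro eventually_nhds_in_open) auto
    ultimately show "\<forall>\<^sub>F S in nhds P0. \<forall>P. S \<in> fibre P \<longrightarrow> norm ((P - P0) * velocity P S) \<le> \<epsilon>"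
    proof eventually_elim
      case (elim S)
      have Sr0: "S \<in> ball P0 r0" using elim(2) r loc by auto
      show ?case
      proof (intro allI impI)
        fix P assume S: "S \<in> fibre P"
        have v: "velocity P S = 1 + poly g S / poly (pderiv (member P)) S"
          using S by (simp add: velocity_def)
        have SX: "poly g S \<noteq> 0" by (rule g_nonzero_fibre[OF S])
        have "norm ((P - P0) * velocity P S) \<le> E S"
        proof (cases "poly (pderiv (member P)) S = 0")
          \<comment> \<open>Division by 0 gives 0: the velocity is 1 at a multiple root, and the
            first summand of E is enough.\<close>
          case True
          then show ?thesis using \<psi>eq[OF elim(2) S] by (simp add: v E_def norm_power)
        next
          case False
          have 1: "(G has_field_derivative - poly (pderiv (member P)) S / poly g S) (at S)"
            unfolding G_def by (rule quotient_derivative[OF S])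
          have "(\<psi> has_field_derivative deriv \<psi> S) (at S)"
            using \<psi>(4) Sr0 by (intro holomorphic_derivI) auto
          then have "((\<lambda>w. \<psi> w ^ m + G P0) has_field_derivative of_nat m * \<psi> S ^ (m - 1) * deriv \<psi> S) (at S)"
            by (auto intro!: derivative_eq_intros)
          then have "(G has_field_derivative of_nat m * \<psi> S ^ (m - 1) * deriv \<psi> S) (at S)"
            by (rule has_field_derivative_transform_within_open[OF _ open_ball Sr0])
               (use \<psi>(5) in \<open>auto simp: algebra_simps\<close>)
          from DERIV_unique[OF 1 this]
          have d: "- poly (pderiv (member P)) S / poly g S = of_nat m * \<psi> S ^ (m - 1) * deriv \<psi> S" .
          have "of_nat m * \<psi> S ^ (m - 1) * deriv \<psi> S \<noteq> 0"
            unfolding d[symmetric] using False SX by simp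
          then have nz: "\<psi> S ^ (m - 1) \<noteq> 0" "deriv \<psi> S \<noteq> 0" by (simp_all only: mult_eq_0_iff de_Morgan_disj not_False_eq_True)
          have "poly g S / poly (pderiv (member P)) S = - (1 / (- poly (pderiv (member P)) S / poly g S))"
            using False SX by simp
          then have v': "velocity P S = 1 - 1 / (of_nat m * \<psi> S ^ (m - 1) * deriv \<psi> S)"
            unfolding d v by simp
          have pm: "\<psi> S ^ m = \<psi> S * \<psi> S ^ (m - 1)" using \<psi>(2) by (metis power_eq_if neq0_conv)
          have "(P - P0) * velocity P S = \<psi> S ^ m - \<psi> S / (of_nat m * deriv \<psi> S)"
            unfolding v' \<psi>eq[OF elim(2) S] using nz \<psi>(2) by (simp add: pm field_simps)
          then show ?thesis
            using norm_triangle_ineq4[of "\<psi> S ^ m" "\<psi> S / (of_nat m * deriv \<psi> S)"]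
            by (simp add: E_def norm_power norm_divide norm_mult)
        qed
        then show "norm ((P - P0) * velocity P S) \<le> \<epsilon>" using elim(1) by simp
      qed
    qed
  qed
qed

text \<open>At a simple root -f/g is injective and the velocity stays bounded, so the factor P - P0
  makes the product small.\<close>

lemma simple_point_local:
  assumes a: "a \<in> fibre P0" and simple: "poly (pderiv (member P0)) a \<noteq> 0"
  obtains r where "0 < r"
    "\<And>P S T. S \<in> ball a r \<Longrightarrow> T \<in> ball a r \<Longrightarrow> S \<in> fibre P \<Longrightarrow> T \<in> fibre P \<Longrightarrow> S = T"
    "\<And>\<epsilon>. \<epsilon> > 0 \<Longrightarrow> \<forall>\<^sub>F S in nhds a. \<forall>P. S \<in> fibre P \<longrightarrow> norm ((P - P0) * velocity P S) \<le> \<epsilon>"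
proof -
  define G where "G = (\<lambda>S. - poly f S / poly g S)"
  define X where "X = {S. poly g S \<noteq> 0}"
  have X: "open X" "G holomorphic_on X" using quotient_holomorphic open_g_nonzero by (auto simp: X_def G_def)
  have fibG: "S \<in> X" "P = G S" if "S \<in> fibre P" for S P
    using g_nonzero_fibre[OF that] fibre_imp_quotient[OF that] by (auto simp: X_def G_def)
  have aX: "a \<in> X" "G a = P0" using fibG[OF a] by auto
  have "deriv G a \<noteq> 0"
    using DERIV_imp_deriv[OF quotient_derivative[OF a]] simple aX by (simp add: G_def X_def)
  then obtain r where r: "r > 0" "inj_on G (ball a r)"
    using has_complex_derivative_locally_injective[OF X(2) aX(1) X(1)] by metis
  show ?thesis
  proof (rule that[OF r(1)])
    show "S = T" if "S \<in> ball a r" "T \<in> ball a r" "S \<in> fibre P" "T \<in> fibre P" for P S T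
      using fibG(2)[OF that(3)] fibG(2)[OF that(4)] that r(2) by (auto dest: inj_onD)
    fix \<epsilon> :: real assume \<epsilon>: "\<epsilon> > 0"
    define E where "E = (\<lambda>S. norm ((G S - P0) *
      (1 + poly g S / (poly (pderiv f) S + G S * poly (pderiv g) S))))"
    have "isCont G a" using continuous_on_eq_continuous_at[OF X(1)]
      holomorphic_on_imp_continuous_on[OF X(2)] aX(1) by blast
    then have "isCont E a" unfolding E_def using simple
      by (intro continuous_intros) (auto simp: poly_pderiv_member aX)
    moreover have "E a = 0" by (simp add: E_def aX)
    ultimately have "(E \<longlongrightarrow> 0) (nhds a)" by (metis continuous_at tendsto_nhds_iff)
    then have "\<forall>\<^sub>F S in nhds a. E S < \<epsilon>" using \<epsilon> by (rule order_tendstoD)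
    then show "\<forall>\<^sub>F S in nhds a. \<forall>P. S \<in> fibre P \<longrightarrow> norm ((P - P0) * velocity P S) \<le> \<epsilon>"
    proof eventually_elim
      case (elim S)
      show ?case
      proof (intro allI impI)
        fix P assume S: "S \<in> fibre P"
        then have "norm ((P - P0) * velocity P S) = E S"
          using fibG(2)[OF S] by (simp add: velocity_def E_def poly_pderiv_member)
        then show "norm ((P - P0) * velocity P S) \<le> \<epsilon>" using elim by simp
      qed
    qed
  qed
qed

end

section \<open>Bounding the triple sum at a tame value\<close>

lemma norm_cluster_le:
  assumes A: "card A = 3" and V: "\<And>x. x \<in> A \<Longrightarrow> norm (w * m x) \<le> \<epsilon>"
    and K: "K \<ge> 0" "\<And>x y. x \<in> A \<Longrightarrow> y \<in> A \<Longrightarrow> x \<noteq> y \<Longrightarrow> norm (M y / (M x - M y)) \<le> K"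
  shows "norm (w * cluster M m A) \<le> 3 * (\<epsilon> * K ^ 2)"
proof -
  have fin: "finite A" using A by (metis card.infinite zero_neq_numeral)
  have "norm (w * cluster M m A) \<le> (\<Sum>x\<in>A. norm (w * m x) * norm (\<Prod>y\<in>A - {x}. M y / (M x - M y)))"
    unfolding cluster_def sum_distrib_left
    by (rule order_trans[OF norm_sum]) (simp add: norm_mult mult.assoc)
  also have "\<dots> \<le> (\<Sum>x\<in>A. \<epsilon> * K ^ 2)"
  proof (rule sum_mono)
    fix x assume x: "x \<in> A"
    have "norm (\<Prod>y\<in>A - {x}. M y / (M x - M y)) \<le> (\<Prod>y\<in>A - {x}. K)"
      unfolding prod_norm[symmetric] by (rule prod_mono) (use K x in auto)
    also have "\<dots> = K ^ 2" using A x fin by simp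
    finally show "norm (w * m x) * norm (\<Prod>y\<in>A - {x}. M y / (M x - M y)) \<le> \<epsilon> * K ^ 2"
      using V[OF x] by (intro mult_mono) (auto intro: order_trans[OF norm_ge_zero])
  qed
  also have "\<dots> = 3 * (\<epsilon> * K ^ 2)" using A by simp
  finally show ?thesis .
qed

text \<open>The summand of p vanishes through m, all others contain the factor \<open>M p\<close>.
  This disposes of the triples that contain the line at infinity, on whose branch M = P - P.\<close>

lemma cluster_eq_0:
  assumes "finite A" "p \<in> A" "M p = 0" "m p = 0"
  shows "cluster M m A = 0"
  unfolding cluster_def
proof (rule sum.neutral, rule ballI)
  fix x assume "x \<in> A"
  show "m x * (\<Prod>y\<in>A - {x}. M y / (M x - M y)) = 0"
  proof (cases "x = p")
    case False
    then have "(\<Prod>y\<in>A - {x}. M y / (M x - M y)) = 0"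
      using assms by (intro prod_zero) auto
    then show ?thesis by simp
  qed (use assms in simp)
qed

context pencil
begin

text \<open>The branch of the line at infinity is left out because its triples contribute nothing,
  by \<open>cluster_eq_0\<close>.\<close>

definition finite_branches :: "complex \<Rightarrow> complex set" where
  "finite_branches P = (if e = 0 then insert k (fibre P) else fibre P)"

text \<open>Branches may collide only at the fixed point, where P - S tends to 0 together with their
  differences.\<close>

definition tame :: "complex \<Rightarrow> bool" where
  "tame P0 \<longleftrightarrow> coeff (member P0) n \<noteq> 0 \<and>
     (\<forall>S\<in>fibre P0. S = P0 \<or> poly (pderiv (member P0)) S \<noteq> 0) \<and> (e = 0 \<longrightarrow> k \<in> fibre P0 \<longrightarrow> k = P0)"

text \<open>The point a is either k outside the fibre, or the fixed point, or a simple root off the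
  line. In the first and the last case a single branch comes close to a and the bound is vacuous;
  the fixed point is the only place that requires an estimate.\<close>

lemma tame_separation:
  assumes t: "tame P0" and a: "a \<in> finite_branches P0"
  obtains r K where "0 < r" "0 < K"
    "\<forall>\<^sub>F P in nhds P0. \<forall>S\<in>finite_branches P \<inter> ball a r. \<forall>T\<in>finite_branches P \<inter> ball a r.
      S \<noteq> T \<longrightarrow> norm (P - T) \<le> K * norm (S - T)"
proof -
  have c0: "coeff (member P0) n \<noteq> 0" using t by (simp add: tame_def)
  \<comment> \<open>The ball becomes so small that k can lie in it only as its centre.\<close>
  have shrink: "\<exists>r'. 0 < r' \<and> r' \<le> r \<and> (k \<in> ball a r' \<longrightarrow> k = a)" if "0 < r" for r
    using that by (intro exI[of _ "if k = a then r else min r (dist k a)"]) (auto simp: dist_commute)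
  consider "a \<notin> fibre P0" | "a \<in> fibre P0" "a = P0" | "a \<in> fibre P0" "a \<noteq> P0" by blast
  then show ?thesis
  proof cases
    case 1
    have fin: "finite (fibre P0)" using finite_fibre[OF c0] by simp
    obtain r where r: "r > 0" "\<And>b. b \<in> fibre P0 \<Longrightarrow> b \<noteq> a \<Longrightarrow> r \<le> dist a b"
      using finite_set_avoid[OF fin, of a] by auto
    have apart: "T \<notin> ball a (r / 2)" if "b \<in> fibre P0" "T \<in> ball b (r / 2)" for b T
    proof
      assume "T \<in> ball a (r / 2)"
      then have "dist a b < r" using that(2) dist_triangle_half_r[of T a r b] by (simp add: dist_commute)
      moreover have "r \<le> dist a b" using r(2)[OF that(1)] 1 that(1) by blast
      ultimately show False by simp
    qed
    have near: "\<forall>\<^sub>F P in nhds P0. \<forall>S\<in>fibre P. \<exists>b\<in>fibre P0. S \<in> ball b (r / 2)"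
      by (rule fibre_near_fibre[OF c0]) (use r in simp)
    have "\<forall>\<^sub>F P in nhds P0. \<forall>S\<in>finite_branches P \<inter> ball a (r / 2).
      \<forall>T\<in>finite_branches P \<inter> ball a (r / 2). S \<noteq> T \<longrightarrow> norm (P - T) \<le> 1 * norm (S - T)"
      using near
    proof eventually_elim
      case (elim P)
      then have "S \<notin> fibre P" if "S \<in> ball a (r / 2)" for S using apart that by blast
      then show ?case by (auto simp: finite_branches_def split: if_splits)
    qed
    then show ?thesis using r by (intro that[of "r / 2" 1]) auto
  next
    case 2
    then have fx: "coeff (member a) n \<noteq> 0" "a \<in> fibre a" using c0 by simp_all
    obtain r K where fp: "0 < r" "0 < K"
      "\<And>P S T. S \<in> ball a r \<Longrightarrow> T \<in> ball a r \<Longrightarrow> S \<in> fibre P \<Longrightarrow> T \<in> fibre P \<Longrightarrow> S \<noteq> T \<Longrightarrow>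
        norm (P - T) \<le> K * norm (S - T)"
      "\<And>P S. S \<in> ball a r \<Longrightarrow> S \<in> fibre P \<Longrightarrow> norm (P - a) \<le> K * norm (S - a)"
      by (rule fixed_point_local[OF fx]) (rule that; assumption)
    obtain r' where r': "0 < r'" "r' \<le> r" "k \<in> ball a r' \<Longrightarrow> k = a" using shrink[OF fp(1)] by blast
    have "norm (P - T) \<le> (K + 1) * norm (S - T)"
      if ST: "S \<in> finite_branches P" "S \<in> ball a r'" "T \<in> finite_branches P" "T \<in> ball a r'" "S \<noteq> T" for P S T
    proof -
      have b: "S \<in> ball a r" "T \<in> ball a r" using ST r' by auto
      consider "S \<in> fibre P" "T \<in> fibre P" | "S \<in> fibre P" "T = a" | "S = a" "T \<in> fibre P"
        using ST r'(3) by (auto simp: finite_branches_def split: if_splits)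
      then show ?thesis
      proof cases
        case 1
        have "norm (P - T) \<le> K * norm (S - T)" by (rule fp(3)[OF b 1 ST(5)])
        also have "\<dots> \<le> (K + 1) * norm (S - T)" by (intro mult_right_mono) auto
        finally show ?thesis .
      next
        case 2
        then have "norm (P - T) \<le> K * norm (S - T)" using fp(4)[OF b(1)] by simp
        also have "\<dots> \<le> (K + 1) * norm (S - T)" by (intro mult_right_mono) auto
        finally show ?thesis .
      next
        case 3
        have "norm (P - T) \<le> norm (P - a) + norm (T - a)"
          using norm_triangle_ineq4[of "P - a" "T - a"] by simp
        also have "\<dots> \<le> (K + 1) * norm (T - a)" using fp(4)[OF b(2) 3(2)] by (simp add: algebra_simps)
        finally show ?thesis using 3 by (simp add: norm_minus_commute)
      qed
    qed
    then show ?thesis using r' fp(2)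
      by (intro that[of r' "K + 1"] always_eventually) auto
  next
    case 3
    then have simple: "poly (pderiv (member P0)) a \<noteq> 0" using t by (auto simp: tame_def)
    obtain r where sp: "0 < r"
      "\<And>P S T. S \<in> ball a r \<Longrightarrow> T \<in> ball a r \<Longrightarrow> S \<in> fibre P \<Longrightarrow> T \<in> fibre P \<Longrightarrow> S = T"
      by (rule simple_point_local[OF 3(1) simple]) (rule that; assumption)
    obtain r' where r': "0 < r'" "r' \<le> r" "k \<in> ball a r' \<Longrightarrow> k = a" using shrink[OF sp(1)] by blast
    have "S = T"
      if ST: "S \<in> finite_branches P" "S \<in> ball a r'" "T \<in> finite_branches P" "T \<in> ball a r'" for P S T
    proof -
      have b: "S \<in> ball a r" "T \<in> ball a r" using ST r' by auto
      have "U \<in> fibre P" if "U \<in> finite_branches P" "U \<in> ball a r'" for U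
        using that r'(3) t 3 by (auto simp: finite_branches_def tame_def split: if_splits)
      then show ?thesis using sp(2)[OF b] ST by blast
    qed
    then show ?thesis using r'
      by (intro that[of r' 1] always_eventually) auto
  qed
qed

text \<open>The constant branch is set apart: its velocity 1 - e is available only where k lies
  outside the fibre, as it does at regular values.\<close>

lemma tame_velocity:
  assumes t: "tame P0" and \<epsilon>: "\<epsilon> > 0"
  shows "\<forall>\<^sub>F P in nhds P0. \<forall>S\<in>finite_branches P. norm ((P - P0) * velocity P S) \<le> \<epsilon> \<or> (e = 0 \<and> S = k)"
proof -
  have c0: "coeff (member P0) n \<noteq> 0" using t by (simp add: tame_def)
  have fin: "finite (fibre P0)" using finite_fibre[OF c0] by simp
  have "\<forall>a\<in>fibre P0. \<exists>r>0. \<forall>S\<in>ball a r. \<forall>P. S \<in> fibre P \<longrightarrow> norm ((P - P0) * velocity P S) \<le> \<epsilon>"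
  proof
    fix a assume a: "a \<in> fibre P0"
    have "\<forall>\<^sub>F S in nhds a. \<forall>P. S \<in> fibre P \<longrightarrow> norm ((P - P0) * velocity P S) \<le> \<epsilon>"
    proof (cases "a = P0")
      case True
      then have "P0 \<in> fibre P0" using a by simp
      then show ?thesis unfolding True by (rule fixed_point_local[OF c0]) (use \<epsilon> in blast)
    next
      case False
      then have "poly (pderiv (member P0)) a \<noteq> 0" using t a by (auto simp: tame_def)
      then show ?thesis by (rule simple_point_local[OF a]) (use \<epsilon> in blast)
    qed
    then show "\<exists>r>0. \<forall>S\<in>ball a r. \<forall>P. S \<in> fibre P \<longrightarrow> norm ((P - P0) * velocity P S) \<le> \<epsilon>"
      unfolding eventually_nhds_metric by (simp add: dist_commute Ball_def)
  qed
  from bchoice[OF this] obtain r where r: "\<And>a. a \<in> fibre P0 \<Longrightarrow> r a > 0"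
    "\<And>a S P. a \<in> fibre P0 \<Longrightarrow> S \<in> ball a (r a) \<Longrightarrow> S \<in> fibre P \<Longrightarrow> norm ((P - P0) * velocity P S) \<le> \<epsilon>"
    by blast
  define \<rho> where "\<rho> = Min (insert 1 (r ` fibre P0))"
  have "\<rho> > 0" using fin r(1) by (simp add: \<rho>_def)
  have \<rho>: "\<rho> \<le> r a" if "a \<in> fibre P0" for a using fin that by (simp add: \<rho>_def)
  show ?thesis using fibre_near_fibre[OF c0 \<open>\<rho> > 0\<close>]
  proof eventually_elim
    case (elim P)
    have "norm ((P - P0) * velocity P S) \<le> \<epsilon>" if S: "S \<in> fibre P" for S
    proof -
      obtain a where a: "a \<in> fibre P0" "S \<in> ball a \<rho>" using elim S by blast
      then have "S \<in> ball a (r a)" using \<rho>[OF a(1)] by auto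
      then show ?thesis using r(2) a S by blast
    qed
    then show ?case by (auto simp: finite_branches_def split: if_splits)
  qed
qed

text \<open>Branches near the same centre obey \<open>tame_separation\<close>. Branches near
  different centres stay at distance \<rho>, and the crude bound \<open>norm (P - T) \<le> R\<close>
  is enough for them.\<close>

lemma tame_ratio:
  assumes t: "tame P0"
  obtains K where "0 < K"
    "\<forall>\<^sub>F P in nhds P0. \<forall>S\<in>finite_branches P. \<forall>T\<in>finite_branches P. S \<noteq> T \<longrightarrow> norm (P - T) \<le> K * norm (S - T)"
proof -
  define F where "F = finite_branches P0"
  have c0: "coeff (member P0) n \<noteq> 0" using t by (simp add: tame_def)
  have fin: "finite F" using finite_fibre[OF c0] by (simp add: F_def finite_branches_def)
  have "\<forall>a\<in>F. \<exists>x. fst x > 0 \<and> snd x > 0 \<and>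
    (\<forall>\<^sub>F P in nhds P0. \<forall>S\<in>finite_branches P \<inter> ball a (fst x). \<forall>T\<in>finite_branches P \<inter> ball a (fst x).
      S \<noteq> T \<longrightarrow> norm (P - T) \<le> snd x * norm (S - T))"
  proof
    fix a assume "a \<in> F"
    then have "a \<in> finite_branches P0" by (simp add: F_def)
    then obtain r K where rK: "0 < r" "0 < K"
      "\<forall>\<^sub>F P in nhds P0. \<forall>S\<in>finite_branches P \<inter> ball a r. \<forall>T\<in>finite_branches P \<inter> ball a r.
        S \<noteq> T \<longrightarrow> norm (P - T) \<le> K * norm (S - T)"
      by (rule tame_separation[OF t])
    show "\<exists>x. fst x > 0 \<and> snd x > 0 \<and>
    (\<forall>\<^sub>F P in nhds P0. \<forall>S\<in>finite_branches P \<inter> ball a (fst x). \<forall>T\<in>finite_branches P \<inter> ball a (fst x).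
      S \<noteq> T \<longrightarrow> norm (P - T) \<le> snd x * norm (S - T))"
      by (rule exI[of _ "(r, K)"]) (unfold fst_conv snd_conv, intro conjI rK)
  qed
  from bchoice[OF this] obtain x where x: "\<And>a. a \<in> F \<Longrightarrow> fst (x a) > 0"
    "\<And>a. a \<in> F \<Longrightarrow> snd (x a) > 0"
    "\<And>a. a \<in> F \<Longrightarrow> \<forall>\<^sub>F P in nhds P0. \<forall>S\<in>finite_branches P \<inter> ball a (fst (x a)).
      \<forall>T\<in>finite_branches P \<inter> ball a (fst (x a)). S \<noteq> T \<longrightarrow> norm (P - T) \<le> snd (x a) * norm (S - T)"
    by blast
  \<comment> \<open>With a third of every distance between centres, points within \<rho> of
    different centres are at least \<rho> apart.\<close>
  define D where "D = insert 1 ((\<lambda>a. fst (x a)) ` F \<union> (\<lambda>(a, b). dist a b / 3) ` (F \<times> F - Id))"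
  define \<rho> where "\<rho> = Min D"
  have finD: "finite D" using fin by (simp add: D_def)
  have \<rho>: "\<rho> > 0" unfolding \<rho>_def using finD by (subst Min_gr_iff) (auto simp: D_def x(1))
  have \<rho>r: "\<rho> \<le> fst (x a)" if "a \<in> F" for a
    unfolding \<rho>_def using finD that by (intro Min_le) (auto simp: D_def)
  have \<rho>sep: "3 * \<rho> \<le> dist a b" if "a \<in> F" "b \<in> F" "a \<noteq> b" for a b
  proof -
    have "\<rho> \<le> dist a b / 3"
      unfolding \<rho>_def using finD that by (intro Min_le) (auto simp: D_def image_iff intro!: bexI[of _ "(a, b)"])
    then show ?thesis by simp
  qed
  \<comment> \<open>The summands bound |P - P0|, |b - T| and |P0 - b| for every centre b.\<close>
  define R where "R = 1 + \<rho> + (\<Sum>a\<in>F. dist P0 a)"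
  have R: "R > 0" unfolding R_def using \<rho> by (intro add_pos_nonneg sum_nonneg) auto
  define K where "K = (\<Sum>a\<in>F. snd (x a)) + R / \<rho>"
  have sumK: "0 \<le> (\<Sum>a\<in>F. snd (x a))" using x(2) by (intro sum_nonneg) (auto intro: less_imp_le)
  have K: "K > 0" "R / \<rho> \<le> K" using R \<rho> sumK by (auto simp: K_def intro: add_nonneg_pos)
  have Ka: "snd (x a) \<le> K" if "a \<in> F" for a
  proof -
    have "snd (x a) \<le> (\<Sum>a\<in>F. snd (x a))"
      using that fin x(2) by (intro member_le_sum) (auto intro: less_imp_le)
    moreover have "0 \<le> R / \<rho>" using R \<rho> by simp
    ultimately show ?thesis by (simp add: K_def)
  qed
  have ev3: "\<forall>\<^sub>F P in nhds P0. \<forall>a\<in>F. \<forall>S\<in>finite_branches P \<inter> ball a (fst (x a)).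
      \<forall>T\<in>finite_branches P \<inter> ball a (fst (x a)). S \<noteq> T \<longrightarrow> norm (P - T) \<le> snd (x a) * norm (S - T)"
    by (intro eventually_ball_finite fin ballI x(3))
  have ev2: "\<forall>\<^sub>F P in nhds P0. dist P P0 < 1"
    unfolding eventually_nhds_metric by (intro exI[of _ 1]) auto
  have "\<forall>\<^sub>F P in nhds P0. \<forall>S\<in>finite_branches P. \<forall>T\<in>finite_branches P. S \<noteq> T \<longrightarrow> norm (P - T) \<le> K * norm (S - T)"
    using fibre_near_fibre[OF c0 \<rho>] ev2 ev3
  proof eventually_elim
    case (elim P)
    have centre: "\<exists>a\<in>F. S \<in> ball a \<rho>" if "S \<in> finite_branches P" for S
      using that elim(1) \<rho> by (auto simp: finite_branches_def F_def split: if_splits)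
    show ?case
    proof (intro ballI impI)
      fix S T assume ST: "S \<in> finite_branches P" "T \<in> finite_branches P" "S \<noteq> T"
      obtain a b where ab: "a \<in> F" "S \<in> ball a \<rho>" "b \<in> F" "T \<in> ball b \<rho>" using centre ST by meson
      show "norm (P - T) \<le> K * norm (S - T)"
      proof (cases "a = b")
        case True
        then have "S \<in> ball a (fst (x a))" "T \<in> ball a (fst (x a))" using ab \<rho>r[OF ab(1)] by auto
        then have "norm (P - T) \<le> snd (x a) * norm (S - T)" using elim(3) ST ab(1) by blast
        also have "\<dots> \<le> K * norm (S - T)" using Ka[OF ab(1)] by (intro mult_right_mono) auto
        finally show ?thesis .
      next
        case False
        have "dist a b \<le> dist a S + dist S T + dist T b"
          using dist_triangle[of a b S] dist_triangle[of S b T] by linarith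
        then have "\<rho> \<le> norm (S - T)"
          using \<rho>sep[OF ab(1,3) False] ab(2,4) by (simp add: dist_commute dist_norm)
        have "norm (P - T) = dist P T" by (simp add: dist_norm)
        also have "\<dots> \<le> dist P P0 + dist P0 b + dist b T"
          using dist_triangle[of P T P0] dist_triangle[of P0 T b] by linarith
        also have "dist P0 b \<le> (\<Sum>a\<in>F. dist P0 a)" using ab(3) fin by (intro member_le_sum) auto
        finally have "norm (P - T) \<le> R" using elim(2) ab(4) by (simp add: R_def)
        also have "R \<le> (R / \<rho>) * norm (S - T)"
          using \<open>\<rho> \<le> norm (S - T)\<close> R \<rho> by (simp add: field_simps)
        also have "\<dots> \<le> K * norm (S - T)" using K(2) by (intro mult_right_mono) auto
        finally show ?thesis .
      qed
    qed
  qed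
  then show ?thesis using that K(1) by blast
qed

text \<open>The velocities, multiplied by P - P0, contribute an arbitrarily small \<epsilon>, and
  the two ratios in each of the three summands contribute K. There are at most 2^(n+1) triples, as
  many as subsets of the n + 1 branches.\<close>

lemma tame_bsum:
  assumes t: "tame P0" and line: "e = 0 \<or> (k = 0 \<and> e = 1)"
    and reg: "\<forall>\<^sub>F P in at P0. regular P"
  shows "((\<lambda>P. (P - P0) * bsum P) \<longlongrightarrow> 0) (at P0)"
proof -
  obtain K where K: "0 < K"
    "\<forall>\<^sub>F P in nhds P0. \<forall>S\<in>finite_branches P. \<forall>T\<in>finite_branches P. S \<noteq> T \<longrightarrow> norm (P - T) \<le> K * norm (S - T)"
    using tame_ratio[OF t] by blast
  have main: "\<forall>\<^sub>F P in at P0. norm ((P - P0) * bsum P) \<le> 2 ^ (n + 1) * (3 * (\<epsilon> * K\<^sup>2))" if \<epsilon>: "\<epsilon> > 0" for \<epsilon>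
  proof -
    have ev2: "\<forall>\<^sub>F P in nhds P0. dist P P0 < \<epsilon>"
      unfolding eventually_nhds_metric using \<epsilon> by blast
    have nh: "\<forall>\<^sub>F P in at P0. Q P" if "\<forall>\<^sub>F P in nhds P0. Q P" for Q
      using that by (auto simp: eventually_at_filter elim: eventually_mono)
    show ?thesis using reg nh[OF K(2)] nh[OF tame_velocity[OF t \<epsilon>]] nh[OF ev2]
    proof eventually_elim
      case (elim P)
      note R = regularD[OF elim(1)]
      have v: "norm ((P - P0) * velocity P S) \<le> \<epsilon>" if "S \<in> finite_branches P" for S
      proof (cases "e = 0 \<and> S = k")
        case True
        then have "S \<notin> fibre P" using R(3) by simp
        then have "velocity P S = 1 - e" by (simp add: velocity_def)
        then have "velocity P S = 1" using True by simp
        then show ?thesis using elim(4) by (simp add: dist_norm)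
      qed (use elim(3) that in blast)
      have finb: "finite (branches P)" using R(1) by (simp add: branches_def)
      have each: "norm ((P - P0) * cluster (\<lambda>S. P - S) (velocity P) A) \<le> 3 * (\<epsilon> * K\<^sup>2)"
        if A: "A \<subseteq> branches P" "card A = 3" for A
      proof (cases "A \<subseteq> finite_branches P")
        case True
        show ?thesis
        proof (rule norm_cluster_le[OF A(2)])
          fix x y assume xy: "x \<in> A" "y \<in> A" "x \<noteq> y"
          then have "norm (P - y) \<le> K * norm (x - y)" using elim(2) True by blast
          moreover have "norm (P - x - (P - y)) = norm (x - y)" by (simp add: norm_minus_commute)
          ultimately show "norm ((P - y) / (P - x - (P - y))) \<le> K"
            using xy by (simp add: norm_divide divide_le_eq)
        qed (use v True K in auto)
      next
        \<comment> \<open>A branch outside \<open>finite_branches\<close> can only be that of the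
          line at infinity.\<close>
        case False
        then have e: "e = 1" "k = 0" and PA: "P \<in> A"
          using A line by (auto simp: branches_def finite_branches_def split: if_splits)
        have "P \<notin> fibre P" using R(3) e by simp
        then have "velocity P P = 1 - e" by (simp add: velocity_def)
        then have "velocity P P = 0" using e by simp
        then have "cluster (\<lambda>S. P - S) (velocity P) A = 0"
          using cluster_eq_0[of A P] PA finite_subset[OF A(1) finb] by simp
        then show ?thesis using \<epsilon> by simp
      qed
      have "norm ((P - P0) * bsum P) \<le>
        (\<Sum>A | A \<subseteq> branches P \<and> card A = 3. norm ((P - P0) * cluster (\<lambda>S. P - S) (velocity P) A))"
        unfolding bsum_def sum_distrib_left by (rule norm_sum)
      also have "\<dots> \<le> (\<Sum>A | A \<subseteq> branches P \<and> card A = 3. 3 * (\<epsilon> * K\<^sup>2))"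
        by (rule sum_mono) (use each in blast)
      also have "\<dots> = of_nat (card {A. A \<subseteq> branches P \<and> card A = 3}) * (3 * (\<epsilon> * K\<^sup>2))" by simp
      also have "\<dots> \<le> 2 ^ (n + 1) * (3 * (\<epsilon> * K\<^sup>2))"
      proof (intro mult_right_mono)
        have "card {A. A \<subseteq> branches P \<and> card A = 3} \<le> card (Pow (branches P))"
          using finb by (intro card_mono) auto
        also have "\<dots> = 2 ^ (n + 1)" using elim(1) finb by (simp add: card_Pow regular_def)
        finally have "card {A. A \<subseteq> branches P \<and> card A = 3} \<le> 2 ^ (n + 1)" .
        then have "real (card {A. A \<subseteq> branches P \<and> card A = 3}) \<le> real (2 ^ (n + 1))"
          by (rule of_nat_mono)
        then show "real (card {A. A \<subseteq> branches P \<and> card A = 3}) \<le> 2 ^ (n + 1)" by simp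
      qed (use \<epsilon> in auto)
      finally show ?case .
    qed
  qed
  show ?thesis
    unfolding tendsto_iff dist_norm diff_zero
  proof (intro allI impI)
    fix \<delta> :: real assume \<delta>: "\<delta> > 0"
    define C where "C = 2 ^ (n + 1) * (3 * K\<^sup>2)"
    have C: "C > 0" using K(1) by (simp add: C_def)
    have "\<forall>\<^sub>F P in at P0. norm ((P - P0) * bsum P) \<le> 2 ^ (n + 1) * (3 * (\<delta> / (2 * C) * K\<^sup>2))"
      by (rule main) (use \<delta> C in simp)
    moreover have "2 ^ (n + 1) * (3 * (\<delta> / (2 * C) * K\<^sup>2)) = \<delta> / (2 * C) * C"
      unfolding C_def by (simp only: mult_ac)
    moreover have "\<dots> < \<delta>" using \<delta> C by simp
    ultimately show "\<forall>\<^sub>F P in at P0. norm ((P - P0) * bsum P) < \<delta>"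
      by (auto elim: eventually_mono)
  qed
qed

end

section \<open>The shape of a homogeneous foliation\<close>

lemma poly_poly_eq_eval2: "poly (poly P q) x = eval2 P x (poly q x)"
  by (induction P) (simp_all add: eval2_def)

lemma eval2_add: "eval2 (P + Q) x y = eval2 P x y + eval2 Q x y"
  and eval2_mult: "eval2 (P * Q) x y = eval2 P x y * eval2 Q x y"
  and eval2_0: "eval2 0 x y = 0"
  and eval2_smult: "eval2 (smult u P) x y = poly u x * eval2 P x y"
  and eval2_pCons: "eval2 (pCons u P) x y = poly u x + y * eval2 P x y"
  by (simp_all add: eval2_def)

lemma eval2_eq_0_imp_0:
  assumes "\<And>x y. eval2 P x y = 0"
  shows "P = 0"
proof (rule ccontr)
  assume "P \<noteq> 0"
  then have "finite {q. poly P q = 0}" by (rule poly_roots_finite)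
  moreover have "range (\<lambda>y. [:y:]) \<subseteq> {q. poly P q = 0}"
    using assms by (auto simp: eval2_def poly_all_0_iff_0[symmetric])
  ultimately have "finite (range (\<lambda>y::complex. [:y:]))" by (rule finite_subset[rotated])
  then have "finite (UNIV :: complex set)" by (rule finite_imageD) (auto intro: injI)
  then show False by (simp add: infinite_UNIV_char_0)
qed

lemma poly_const_sum:
  fixes P :: "'a::comm_ring_1 poly"
  assumes "\<And>k. k > D \<Longrightarrow> coeff P k = 0"
  shows "poly P u = (\<Sum>k\<le>D. coeff P k * u ^ k)"
proof -
  have "degree P \<le> D" using assms by (simp add: degree_le)
  then have "(\<Sum>k\<le>degree P. coeff P k * u ^ k) = (\<Sum>k\<le>D. coeff P k * u ^ k)"
    by (intro sum.mono_neutral_left) (auto simp: coeff_eq_0)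
  then show ?thesis by (simp add: poly_altdef)
qed

lemma eval2_sum: "eval2 (\<Sum>k\<in>I. F k) x y = (\<Sum>k\<in>I. eval2 (F k) x y)"
  by (induction I rule: infinite_finite_induct) (simp_all add: eval2_add eval2_0)

lemma eval2_const_power: "eval2 ([:[:z:]:] ^ k) x y = z ^ k"
  by (simp add: eval2_def)

lemma eval3_homogeneous3:
  assumes "homogeneous3 d P"
  shows "eval3 P (x, y, z) = (\<Sum>k\<le>d. eval2 (coeff P k) x y * z ^ k)"
proof -
  have "coeff P k = 0" if "k > d" for k
    by (rule poly_eqI, rule poly_eqI) (use assms that in \<open>auto simp: homogeneous3_def\<close>)
  then have "poly P [:[:z:]:] = (\<Sum>k\<le>d. coeff P k * [:[:z:]:] ^ k)" by (rule poly_const_sum)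
  then show ?thesis by (simp add: eval2_sum eval2_mult eval2_const_power)
qed

lemma coeff_homogeneous3:
  assumes "homogeneous3 d P"
  shows "coeff (coeff P k) j = (if j + k \<le> d then monom (coeff (coeff (coeff P k) j) (d - k - j)) (d - k - j) else 0)"
  by (rule poly_eqI) (use assms in \<open>force simp: homogeneous3_def\<close>)

lemma eval2_coeff_homogeneous3:
  assumes P: "homogeneous3 d P" and k: "k \<le> d"
  shows "eval2 (coeff P k) x y = (\<Sum>j\<le>d - k. coeff (coeff (coeff P k) j) (d - k - j) * y ^ j * x ^ (d - k - j))"
proof -
  have 0: "coeff (coeff P k) j = 0" if "j > d - k" for j
    by (subst coeff_homogeneous3[OF P]) (use that k in simp)
  have "eval2 (coeff P k) x y = poly (\<Sum>j\<le>d - k. coeff (coeff P k) j * [:y:] ^ j) x"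
    unfolding eval2_def by (subst poly_const_sum[OF 0]) auto
  also have "\<dots> = (\<Sum>j\<le>d - k. poly (coeff (coeff P k) j) x * y ^ j)"
    by (simp add: poly_sum)
  also have "\<dots> = (\<Sum>j\<le>d - k. coeff (coeff (coeff P k) j) (d - k - j) * y ^ j * x ^ (d - k - j))"
  proof (rule sum.cong)
    fix j assume "j \<in> {..d - k}"
    then have "coeff (coeff P k) j = monom (coeff (coeff (coeff P k) j) (d - k - j)) (d - k - j)"
      using k by (intro trans[OF coeff_homogeneous3[OF P]]) simp
    then have "poly (coeff (coeff P k) j) x = coeff (coeff (coeff P k) j) (d - k - j) * x ^ (d - k - j)"
      by (metis poly_monom)
    then show "poly (coeff (coeff P k) j) x * y ^ j =
      coeff (coeff (coeff P k) j) (d - k - j) * y ^ j * x ^ (d - k - j)" by simp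
  qed simp
  finally show ?thesis .
qed

lemma eval2_coeff_scale:
  assumes "homogeneous3 d P" "k \<le> d"
  shows "eval2 (coeff P k) (t * x) (t * y) = t ^ (d - k) * eval2 (coeff P k) x y"
proof -
  have e: "t ^ j * t ^ (d - k - j) = t ^ (d - k)" if "j \<le> d - k" for j
    using that by (metis le_add_diff_inverse power_add)
  show ?thesis unfolding eval2_coeff_homogeneous3[OF assms] sum_distrib_left
    by (rule sum.cong) (use e in \<open>auto simp: power_mult_distrib algebra_simps\<close>)
qed

text \<open>The coefficient of z^k is homogeneous of degree d - k in x and y, so the homothety
  multiplies it by 2^(d - k). Comparing coefficients in z fixes k. The factor s is that of the
  differential: 2 for dx and dy, 1 for dz.\<close>

lemma homothety_weight:
  assumes P: "homogeneous3 d P" and w: "\<And>m. s * eval3 P (homothety 2 m) = \<kappa> * eval3 P m"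
    and k: "coeff P k \<noteq> 0"
  shows "k \<le> d \<and> s * 2 ^ (d - k) = \<kappa>"
proof -
  have "k \<le> d"
  proof (rule ccontr)
    assume "\<not> k \<le> d"
    then have "coeff (coeff P k) j = 0" for j using coeff_homogeneous3[OF P, of k j] by auto
    then show False using k by (simp add: poly_eq_iff)
  qed
  moreover obtain x y where xy: "eval2 (coeff P k) x y \<noteq> 0" using eval2_eq_0_imp_0 k by blast
  have "(\<Sum>k\<le>d. (s * 2 ^ (d - k) - \<kappa>) * eval2 (coeff P k) x y * z ^ k) = 0" for z
  proof -
    have "(\<Sum>k\<le>d. (s * 2 ^ (d - k)) * eval2 (coeff P k) x y * z ^ k) =
      (\<Sum>k\<le>d. \<kappa> * eval2 (coeff P k) x y * z ^ k)"
      using w[of "(x, y, z)"]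
      by (simp add: eval3_homogeneous3[OF P] eval2_coeff_scale[OF P] sum_distrib_left mult.assoc
          del: eval3.simps cong: sum.cong_simp)
    then show ?thesis by (simp add: left_diff_distrib sum_subtractf)
  qed
  then have "(s * 2 ^ (d - k) - \<kappa>) * eval2 (coeff P k) x y = 0"
    using polyfun_eq_coeffs[of "\<lambda>k. (s * 2 ^ (d - k) - \<kappa>) * eval2 (coeff P k) x y" d "\<lambda>_. 0"] \<open>k \<le> d\<close>
    by simp
  then show ?thesis using xy \<open>k \<le> d\<close> by simp
qed

lemma coeff_pCons_monom: "(\<And>k. k \<noteq> j \<Longrightarrow> coeff P k = 0) \<Longrightarrow> P = monom (coeff P j) j"
  by (rule poly_eqI) auto

lemma binary_form_scale: "binary_form n F (t * x) (t * y) = t ^ n * binary_form n F x y"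
proof -
  have e: "t ^ k * t ^ (n - k) = t ^ n" if "k \<le> n" for k
    using that by (metis le_add_diff_inverse power_add)
  show ?thesis unfolding binary_form_def sum_distrib_left
    by (rule sum.cong) (use e in \<open>auto simp: power_mult_distrib algebra_simps\<close>)
qed

lemma binary_form_0_left: "binary_form n F 0 y = coeff F n * y ^ n"
proof -
  have "binary_form n F 0 y = (\<Sum>k\<in>{n}. coeff F k * y ^ k * 0 ^ (n - k))"
    unfolding binary_form_def by (rule sum.mono_neutral_right) (auto simp: power_0_left)
  then show ?thesis by simp
qed

lemma binary_form_1_left: "degree F \<le> n \<Longrightarrow> binary_form n F 1 y = poly F y"
  by (subst poly_const_sum[of n]) (auto simp: binary_form_def coeff_eq_0)

lemma binary_form_nonzero_left:
  assumes "degree F \<le> n" "x \<noteq> 0"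
  shows "binary_form n F x y = x ^ n * poly F (y / x)"
  using binary_form_scale[of n F x 1 "y / x"] binary_form_1_left[OF assms(1)] assms(2) by simp

text \<open>The powers of 2 are distinct, so the weights make a and b multiples of z^(k+1) and c one
  of z^k; without a common factor k = 0. If c vanishes, then a and b are free of z and x a + y b =
  0, so they are y e and -x e with a unit e; this means d = 1.\<close>

lemma homogeneous_foliation_shape:
  assumes d: "d \<ge> 3" and H: "foliation (d - 1) (a, b, c)"
    and inv: "\<And>m v. pair3 (covector (a, b, c) (homothety 2 m)) (homothety 2 v) =
      \<kappa> * pair3 (covector (a, b, c) m) v"
  obtains a1 b1 c0 where "a = monom a1 1" "b = monom b1 1" "c = [:c0:]" "c0 \<noteq> 0"
proof -
  have hom: "homogeneous3 d a" "homogeneous3 d b" "homogeneous3 d c"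
    and euler: "\<And>m. pair3 (covector (a, b, c) m) m = 0"
    and unit: "\<And>g. g dvd a \<Longrightarrow> g dvd b \<Longrightarrow> g dvd c \<Longrightarrow> g dvd 1"
    using H d by auto
  have ia: "2 * eval3 a (homothety 2 m) = \<kappa> * eval3 a m"
    and ib: "2 * eval3 b (homothety 2 m) = \<kappa> * eval3 b m"
    and ic: "1 * eval3 c (homothety 2 m) = \<kappa> * eval3 c m" for m
    using inv[of m "(1, 0, 0)"] inv[of m "(0, 1, 0)"] inv[of m "(0, 0, 1)"]
    by (cases m; simp add: mult.commute)+
  have wa: "k \<le> d \<and> 2 * 2 ^ (d - k) = \<kappa>" if "coeff a k \<noteq> 0" for k
    by (rule homothety_weight[OF hom(1) ia that])
  have wb: "k \<le> d \<and> 2 * 2 ^ (d - k) = \<kappa>" if "coeff b k \<noteq> 0" for k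
    by (rule homothety_weight[OF hom(2) ib that])
  have wc: "k \<le> d \<and> 1 * 2 ^ (d - k) = \<kappa>" if "coeff c k \<noteq> 0" for k
    by (rule homothety_weight[OF hom(3) ic that])
  have pow_inj: "i = j" if "(2::complex) ^ i = 2 ^ j" for i j :: nat
  proof -
    have "norm ((2::complex) ^ i) = norm ((2::complex) ^ j)" using that by simp
    then have "(2::real) ^ i = 2 ^ j" by (simp add: norm_power)
    then show ?thesis by (simp add: power_inject_exp)
  qed
  have unit_pow: "k = 0" if "monom 1 k dvd (1::poly3)" for k
  proof -
    have "degree (monom (1::poly2) k) = 0" using that by (metis degree_1 dvd_imp_degree_le le_0_eq one_neq_zero)
    then show ?thesis by (simp add: degree_monom_eq)
  qed
  have monom_dvd: "monom 1 k dvd (monom u j :: poly3)" if "k \<le> j" for k j u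
    by (rule dvdI[of _ _ "monom u (j - k)"]) (use that in \<open>simp add: mult_monom\<close>)
  show ?thesis
  proof (cases "c = 0")
    case False
    then obtain k where k: "coeff c k \<noteq> 0" by (metis leading_coeff_neq_0)
    have eq: "j = Suc k" if "coeff P j \<noteq> 0" "P = a \<or> P = b" for j P
    proof -
      have "j \<le> d \<and> 2 * 2 ^ (d - j) = \<kappa>" using that wa wb by blast
      then have "(2::complex) ^ Suc (d - j) = 2 ^ (d - k)" using wc[OF k] by simp
      then have "Suc (d - j) = d - k" by (rule pow_inj)
      then show ?thesis using wc[OF k] \<open>j \<le> d \<and> _\<close> by linarith
    qed
    have eqc: "j = k" if "coeff c j \<noteq> 0" for j
    proof -
      have "(2::complex) ^ (d - j) = 2 ^ (d - k)" using wc[OF k] wc[OF that] by simp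
      then have "d - j = d - k" by (rule pow_inj)
      then show ?thesis using wc[OF k] wc[OF that] by linarith
    qed
    have ma: "a = monom (coeff a (Suc k)) (Suc k)" and mb: "b = monom (coeff b (Suc k)) (Suc k)"
      and mc: "c = monom (coeff c k) k"
      using eq[of a] eq[of b] eqc by (intro coeff_pCons_monom; blast)+
    have "monom 1 k dvd (1::poly3)"
      by (rule unit; subst ma mb mc) (auto intro: monom_dvd)
    then have "k = 0" by (rule unit_pow)
    then have "a = monom (coeff a 1) 1" "b = monom (coeff b 1) 1" "c = [:coeff c 0:]"
      using ma mb mc by (simp_all add: monom_0)
    then show ?thesis using that False by (metis pCons_0_0)
  next
    case True
    obtain K where K: "\<And>k. coeff a k \<noteq> 0 \<Longrightarrow> k = K" "\<And>k. coeff b k \<noteq> 0 \<Longrightarrow> k = K"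
    proof -
      have *: "i = j" if "coeff a i \<noteq> 0 \<or> coeff b i \<noteq> 0" "coeff a j \<noteq> 0 \<or> coeff b j \<noteq> 0" for i j
      proof -
        have "(2::complex) * 2 ^ (d - i) = 2 * 2 ^ (d - j)" "i \<le> d" "j \<le> d" using that wa wb by metis+
        then have "d - i = d - j" using pow_inj by auto
        then show ?thesis using \<open>i \<le> d\<close> \<open>j \<le> d\<close> by linarith
      qed
      show ?thesis
      proof (cases "\<exists>k. coeff a k \<noteq> 0 \<or> coeff b k \<noteq> 0")
        case True
        then show ?thesis using that * by metis
      qed (use that in auto)
    qed
    have ma: "a = monom (coeff a K) K" and mb: "b = monom (coeff b K) K"
      using K by (intro coeff_pCons_monom; blast)+
    have "monom 1 K dvd (1::poly3)"
      by (rule unit; (subst ma mb)?) (auto intro: monom_dvd simp: True)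
    then have "K = 0" by (rule unit_pow)
    define a0 b0 where "a0 = coeff a 0" and "b0 = coeff b 0"
    have ab: "a = [:a0:]" "b = [:b0:]" using ma mb \<open>K = 0\<close> by (simp_all add: monom_0 a0_def b0_def)
    \<comment> \<open>\<open>[:[:0, 1:]:]\<close> is the polynomial x and \<open>[:0, 1:]\<close> is
      y; this is the relation of the radial field at z = 1.\<close>
    have "eval2 ([:[:0, 1:]:] * a0 + [:0, 1:] * b0) x y = 0" for x y
      using euler[of "(x, y, 1)"] ab True
      by (simp add: eval2_add eval2_smult eval2_pCons eval2_0 mult.commute)
    then have z: "[:[:0, 1:]:] * a0 + [:0, 1:] * b0 = 0" by (rule eval2_eq_0_imp_0)
    have "coeff ([:[:0, 1:]:] * a0 + [:0, 1:] * b0) 0 = 0" unfolding z by simp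
    then have "coeff a0 0 = 0" by simp
    then obtain e where e: "a0 = pCons 0 e" by (cases a0) auto
    have "pCons 0 ([:[:0, 1:]:] * e + b0) = 0" using z by (simp add: e)
    then have b0: "b0 = - ([:[:0, 1:]:] * e)" by (simp add: eq_neg_iff_add_eq_0 add.commute)
    have "[:e:] dvd (1::poly3)"
    proof (rule unit)
      have "e dvd a0" by (rule dvdI[of _ _ "[:0, 1:]"]) (simp add: e)
      then show "[:e:] dvd a" unfolding ab by simp
      show "[:e:] dvd b" unfolding ab by (simp add: b0 dvd_smult)
    qed (simp add: True)
    then have "e dvd 1" by (auto simp: is_unit_poly_iff)
    then obtain e0 where e0: "e = [:e0:]" "e0 dvd 1" by (auto simp: is_unit_poly_iff)
    then obtain u where u: "e0 = [:u:]" "u dvd 1" by (auto simp: is_unit_poly_iff)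
    then have "u \<noteq> 0" by auto
    \<comment> \<open>The monomial y occurs in a, whose monomials all have degree d.\<close>
    have "coeff (coeff (coeff a 0) 1) 0 \<noteq> 0" using ab e e0 u \<open>u \<noteq> 0\<close> by simp
    then have "0 + 1 + 0 = d" using hom(1) unfolding homogeneous3_def by blast
    then show ?thesis using d by simp
  qed
qed

text \<open>\<alpha> and \<beta> are A(1, y) and B(1, y). The binary form of fixed degree d - 1
  restores homogeneity, including a zero at x = 0. A common zero of A and B would be a common linear
  factor of all three coefficients, because the radial relation expresses c by A and B.\<close>

lemma homogeneous_foliation_forms:
  assumes d: "d \<ge> 3" and H: "foliation (d - 1) H"
    and inv: "\<And>m v. pair3 (covector H (homothety 2 m)) (homothety 2 v) = \<kappa> * pair3 (covector H m) v"
  obtains \<alpha> \<beta> where "degree \<alpha> \<le> d - 1" "degree \<beta> \<le> d - 1"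
    "\<And>x y. eval2 (affA H) x y = binary_form (d - 1) \<alpha> x y"
    "\<And>x y. eval2 (affB H) x y = binary_form (d - 1) \<beta> x y"
    "\<And>j. coeff (affA H) j = (if j \<le> d - 1 then monom (coeff \<alpha> j) (d - 1 - j) else 0)"
    "\<And>j. coeff (affB H) j = (if j \<le> d - 1 then monom (coeff \<beta> j) (d - 1 - j) else 0)"
    "\<And>x y z. covector H (x, y, z) =
      (z * binary_form (d - 1) \<alpha> x y, z * binary_form (d - 1) \<beta> x y,
       - (x * binary_form (d - 1) \<alpha> x y + y * binary_form (d - 1) \<beta> x y))"
    "\<And>x y. (x, y) \<noteq> 0 \<Longrightarrow> \<not> (binary_form (d - 1) \<alpha> x y = 0 \<and> binary_form (d - 1) \<beta> x y = 0)"
    "\<exists>x y. x * binary_form (d - 1) \<alpha> x y + y * binary_form (d - 1) \<beta> x y \<noteq> 0"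
proof -
  define n where "n = d - 1"
  have dn: "d = Suc n" using d by (simp add: n_def)
  obtain a b c where abc: "H = (a, b, c)" by (cases H)
  obtain a1 b1 c0 where s: "a = monom a1 1" "b = monom b1 1" "c = [:c0:]" "c0 \<noteq> 0"
    using homogeneous_foliation_shape[OF d H[unfolded abc] inv[unfolded abc]] by metis
  have hom: "homogeneous3 d a" "homogeneous3 d b" "homogeneous3 d c"
    and euler: "\<And>m. pair3 (covector (a, b, c) m) m = 0"
    and unit: "\<And>g. g dvd a \<Longrightarrow> g dvd b \<Longrightarrow> g dvd c \<Longrightarrow> g dvd 1"
    using H d abc by auto
  have affAB: "affA H = a1" "affB H = b1" by (simp_all add: abc s poly_monom)
  define F where "F = (\<lambda>P::poly2. \<Sum>j\<le>n. monom (coeff (coeff P j) (n - j)) j)"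
  have coeffF: "coeff (F P) j = (if j \<le> n then coeff (coeff P j) (n - j) else 0)" for P j
    by (simp add: F_def coeff_sum)
  have degF: "degree (F P) \<le> n" for P by (rule degree_le) (simp add: coeffF)
  have coeffP: "coeff P j = (if j \<le> n then monom (coeff (F P) j) (n - j) else 0)"
    if "homogeneous3 d (monom P 1)" for P j
  proof -
    have "coeff P j = coeff (coeff (monom P 1) 1) j" by simp
    also have "\<dots> = (if j + 1 \<le> d then monom (coeff (coeff (coeff (monom P 1) 1) j) (d - 1 - j)) (d - 1 - j) else 0)"
      by (rule coeff_homogeneous3[OF that])
    also have "\<dots> = (if j \<le> n then monom (coeff (F P) j) (n - j) else 0)"
      by (simp add: coeffF dn)
    finally show ?thesis .
  qed
  have evalF: "eval2 P x y = binary_form n (F P) x y" if "homogeneous3 d (monom P 1)" for P x y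
    using eval2_coeff_homogeneous3[OF that, of 1 x y] d
    by (simp add: dn binary_form_def coeffF cong: sum.cong_simp)
  define \<alpha> \<beta> where "\<alpha> = F a1" and "\<beta> = F b1"
  have A: "eval2 a1 x y = binary_form n \<alpha> x y" and B: "eval2 b1 x y = binary_form n \<beta> x y" for x y
    using evalF hom s by (simp_all add: \<alpha>_def \<beta>_def)
  have ev3: "eval3 (monom P 1) (x, y, z) = z * eval2 P x y" for P x y z
    by (simp add: poly_monom eval2_mult) (simp add: eval2_def)
  have C: "eval2 c0 x y = - (x * binary_form n \<alpha> x y + y * binary_form n \<beta> x y)" for x y
    using euler[of "(x, y, 1)"] ev3[of a1 x y 1] ev3[of b1 x y 1] s A[of x y] B[of x y]
    by (simp add: eq_neg_iff_add_eq_0 algebra_simps)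
  have cov: "covector H (x, y, z) = (z * binary_form n \<alpha> x y, z * binary_form n \<beta> x y,
       - (x * binary_form n \<alpha> x y + y * binary_form n \<beta> x y))" for x y z
    using ev3[of a1 x y z] ev3[of b1 x y z] s A[of x y] B[of x y] C[of x y] by (simp add: abc)
  have "eval2 (c0 + ([:[:0, 1:]:] * a1 + [:0, 1:] * b1)) x y = 0" for x y
    by (simp add: eval2_add eval2_smult eval2_pCons eval2_0 A B C)
  then have "c0 + ([:[:0, 1:]:] * a1 + [:0, 1:] * b1) = 0" by (rule eval2_eq_0_imp_0)
  then have c0: "c0 = - ([:[:0, 1:]:] * a1 + [:0, 1:] * b1)" by (simp add: add_eq_0_iff2)
  have common: "g dvd 1" if "g dvd a1" "g dvd b1" for g
  proof -
    have "[:g:] dvd a" "[:g:] dvd b" using that by (auto simp: s const_poly_dvd_iff)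
    moreover have "g dvd c0" unfolding c0 using that by (intro dvd_minus_iff[THEN iffD2] dvd_add dvd_mult)
    then have "[:g:] dvd c" by (simp add: s)
    ultimately have "[:g:] dvd (1::poly3)" by (rule unit)
    then show ?thesis by (auto simp: is_unit_poly_iff)
  qed
  have nz: "\<not> (binary_form n \<alpha> x y = 0 \<and> binary_form n \<beta> x y = 0)" if xy: "(x, y) \<noteq> 0" for x y
  proof
    assume z: "binary_form n \<alpha> x y = 0 \<and> binary_form n \<beta> x y = 0"
    show False
    proof (cases "x = 0")
      case True
      have "[:[:0, 1:]:] dvd P" if P: "homogeneous3 d (monom P 1)" "binary_form n (F P) 0 y = 0" for P
        unfolding const_poly_dvd_iff
      proof
        fix j
        have "coeff (F P) n = 0" using P(2) xy True by (simp add: binary_form_0_left zero_prod_def)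
        then have "poly (coeff P j) 0 = 0" using coeffP[OF P(1), of j] by (auto simp: poly_monom power_0_left)
        then show "[:0, 1:] dvd coeff P j" using poly_eq_0_iff_dvd[of "coeff P j" 0] by simp
      qed
      then have "[:[:0, 1:]:] dvd a1" "[:[:0, 1:]:] dvd b1"
        using hom s z True by (auto simp: \<alpha>_def \<beta>_def)
      then have "[:[:0, 1:]:] dvd (1::poly2)" by (rule common)
      then show False by (simp add: is_unit_poly_iff)
    next
      case False
      have "[:- [:0, y / x:], 1:] dvd P" if P: "homogeneous3 d (monom P 1)" "binary_form n (F P) x y = 0" for P
      proof -
        have "poly (poly P [:0, y / x:]) t = 0" for t
          using binary_form_scale[of n "F P" "t / x" x y] P(2) False
          by (simp add: poly_poly_eq_eval2 evalF[OF P(1)] mult.commute)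
        then have "poly P [:0, y / x:] = 0" using poly_all_0_iff_0 by blast
        then show ?thesis by (simp add: poly_eq_0_iff_dvd)
      qed
      then have "[:- [:0, y / x:], 1:] dvd a1" "[:- [:0, y / x:], 1:] dvd b1"
        using hom s z by (auto simp: \<alpha>_def \<beta>_def)
      then have "[:- [:0, y / x:], 1:] dvd (1::poly2)" by (rule common)
      then show False by (simp add: is_unit_poly_iff)
    qed
  qed
  have rad: "\<exists>x y. x * binary_form n \<alpha> x y + y * binary_form n \<beta> x y \<noteq> 0"
  proof (rule ccontr)
    assume "\<not> ?thesis"
    then have "eval2 c0 x y = 0" for x y using C by simp
    then show False using s(4) eval2_eq_0_imp_0 by blast
  qed
  show ?thesis
    by (rule that[of \<alpha> \<beta>, folded n_def])
      (use degF A B cov nz rad coeffP hom s in \<open>auto simp: \<alpha>_def \<beta>_def affAB\<close>)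
qed

lemma homogeneous_line:
  assumes l: "(\<alpha>, \<beta>, \<gamma>) \<noteq> 0" and inv: "homothety 2 ` line (\<alpha>, \<beta>, \<gamma>) = line (\<alpha>, \<beta>, \<gamma>)"
  shows "\<gamma> = 0 \<or> (\<alpha> = 0 \<and> \<beta> = 0)"
proof (rule ccontr)
  assume neg: "\<not> ?thesis"
  define m :: vec3 where "m = (if \<alpha> \<noteq> 0 then (- \<gamma> / \<alpha>, 0, 1) else (0, - \<gamma> / \<beta>, 1))"
  have "m \<in> line (\<alpha>, \<beta>, \<gamma>)" using neg by (auto simp: m_def line_def zero_prod_def)
  then have "homothety 2 m \<in> line (\<alpha>, \<beta>, \<gamma>)" using inv by blast
  then show False using neg by (auto simp: m_def line_def split: if_splits)
qed

section \<open>The web in a chart\<close>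

text \<open>The binary form restricted to y = b0 + b1 x: this line is y = p x - q in the Legendre
  transform and y = 1 + c x in a chart.\<close>

definition subst_form :: "nat \<Rightarrow> complex poly \<Rightarrow> complex \<Rightarrow> complex \<Rightarrow> complex poly" where
  "subst_form n F b0 b1 = (\<Sum>k\<le>n. smult (coeff F k) ([:b0, b1:] ^ k * [:0, 1:] ^ (n - k)))"

lemma poly_subst_form: "poly (subst_form n F b0 b1) S = binary_form n F S (b0 + b1 * S)"
  by (simp add: subst_form_def binary_form_def poly_sum algebra_simps)

lemma degree_subst_form: "degree (subst_form n F b0 b1) \<le> n"
  unfolding subst_form_def
proof (intro degree_sum_le finite_atMost)
  fix k assume k: "k \<in> {..n}"
  have "degree ([:b0, b1:] ^ k) \<le> degree [:b0, b1:] * k" by (rule degree_power_le)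
  also have "\<dots> \<le> 1 * k" by (intro mult_right_mono) auto
  finally have "degree ([:b0, b1:] ^ k * [:0, 1:] ^ (n - k)) \<le> k + (n - k)"
    by (intro order_trans[OF degree_mult_le] add_mono order_trans[OF degree_power_le]) auto
  then show "degree (smult (coeff F k) ([:b0, b1:] ^ k * [:0, 1:] ^ (n - k))) \<le> n"
    using k by (intro order_trans[OF degree_smult_le]) simp
qed

lemma coeff_linear_power_top: "coeff ([:b0, b1:] ^ k) k = (b1 :: complex) ^ k"
proof (induction k)
  case (Suc k)
  have "degree ([:b0, b1:] ^ k) \<le> degree [:b0, b1:] * k" by (rule degree_power_le)
  also have "\<dots> \<le> 1 * k" by (intro mult_right_mono) auto
  finally have "coeff ([:b0, b1:] ^ k) (Suc k) = 0" by (simp add: coeff_eq_0)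
  then show ?case using Suc by simp
qed simp

lemma coeff_subst_form: "coeff (subst_form n F b0 b1) n = binary_form n F 1 b1"
proof -
  have "coeff ([:b0, b1:] ^ k * [:0, 1:] ^ (n - k)) n = b1 ^ k" if "k \<le> n" for k
  proof -
    have "[:0, 1:] ^ (n - k) = (monom 1 (n - k) :: complex poly)" by (simp add: monom_altdef)
    then show ?thesis using that coeff_linear_power_top[of b0 b1 k]
      by (simp add: mult.commute[of _ "monom _ _"] coeff_monom_mult)
  qed
  then show ?thesis by (simp add: subst_form_def coeff_sum binary_form_def)
qed

lemma binary_form_subst_form:
  "binary_form n (subst_form n F b0 b1) dp dq = binary_form n F dq (b0 * dp + b1 * dq)"
proof (cases "dp = 0")
  case True
  then show ?thesis
    using binary_form_scale[of n F dq 1 b1] by (simp add: binary_form_0_left coeff_subst_form mult.commute)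
next
  case False
  then show ?thesis
    using binary_form_scale[of n F dp "dq / dp" "b0 + b1 * (dq / dp)"]
    by (simp add: binary_form_nonzero_left[OF degree_subst_form] poly_subst_form algebra_simps)
qed

lemma binary_form_add: "binary_form n (F + G) x y = binary_form n F x y + binary_form n G x y"
  by (simp add: binary_form_def sum.distrib algebra_simps)

lemma binary_form_smult: "binary_form n (smult u F) x y = u * binary_form n F x y"
  by (simp add: binary_form_def sum_distrib_left algebra_simps)

lemma poly_eq_subst_form:
  assumes "\<And>j. coeff P j = (if j \<le> n then monom (coeff F j) (n - j) else 0)"
  shows "poly P [:b0, b1:] = subst_form n F b0 b1"
proof -
  have "poly P [:b0, b1:] = (\<Sum>k\<le>n. coeff P k * [:b0, b1:] ^ k)"
    by (rule poly_const_sum) (simp add: assms)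
  also have "\<dots> = subst_form n F b0 b1"
    unfolding subst_form_def
    by (rule sum.cong) (auto simp: assms monom_altdef mult.commute)
  finally show ?thesis .
qed

section \<open>The Legendre web and its affine charts\<close>

locale homogeneous_web =
  fixes n :: nat and \<alpha> \<beta> :: "complex poly" and lx ly lz :: complex and H :: form3
  assumes n: "n \<ge> 2" and degree_\<alpha>: "degree \<alpha> \<le> n" and degree_\<beta>: "degree \<beta> \<le> n"
    and coeff_affA: "\<And>j. coeff (affA H) j = (if j \<le> n then monom (coeff \<alpha> j) (n - j) else 0)"
    and coeff_affB: "\<And>j. coeff (affB H) j = (if j \<le> n then monom (coeff \<beta> j) (n - j) else 0)"
    and no_common_zero: "\<And>x y. (x, y) \<noteq> 0 \<Longrightarrow> \<not> (binary_form n \<alpha> x y = 0 \<and> binary_form n \<beta> x y = 0)"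
    and nonradial: "\<exists>x y. x * binary_form n \<alpha> x y + y * binary_form n \<beta> x y \<noteq> 0"
    and eval2_affA: "\<And>x y. eval2 (affA H) x y = binary_form n \<alpha> x y"
    and eval2_affB: "\<And>x y. eval2 (affB H) x y = binary_form n \<beta> x y"
    and covector_H: "\<And>x y z. covector H (x, y, z) =
      (z * binary_form n \<alpha> x y, z * binary_form n \<beta> x y,
       - (x * binary_form n \<alpha> x y + y * binary_form n \<beta> x y))"
    and line_cases: "(lz = 0 \<and> (lx, ly) \<noteq> 0) \<or> (lx = 0 \<and> ly = 0 \<and> lz \<noteq> 0)"
begin

abbreviation A :: "complex \<Rightarrow> complex \<Rightarrow> complex" where "A \<equiv> binary_form n \<alpha>"
abbreviation B :: "complex \<Rightarrow> complex \<Rightarrow> complex" where "B \<equiv> binary_form n \<beta>"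

text \<open>Its zeros [x:y] are the directions with Gauss image p.\<close>

definition \<Phi> :: "complex \<Rightarrow> complex \<Rightarrow> complex \<Rightarrow> complex" where
  "\<Phi> p x y = A x y + p * B x y"

definition W :: web where "W = leg (n + 1) (lx, ly, lz) H"

lemma \<Phi>_scale: "\<Phi> p (t * x) (t * y) = t ^ n * \<Phi> p x y"
  by (simp add: \<Phi>_def binary_form_scale algebra_simps)

text \<open>With x = dq/dp and y = p x - q, the point [x:y:1] is [dq : p dq - q dp : dp]. The
  factors are the homogeneous equations of \<ell> and of \<Phi> at this point.\<close>

lemma W_eq: "W (p, q) dp dq =
  (lx * dq + ly * (p * dq - q * dp) + lz * dp) * \<Phi> p dq (p * dq - q * dp)"
proof -
  have "leg_line (lx, ly, lz) (p, q) dp dq = lx * dq + ly * (p * dq - q * dp) + lz * dp"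
    by (simp add: binary_form_def atMost_Suc algebra_simps)
  moreover have "leg_foliation n H (p, q) dp dq = \<Phi> p dq (p * dq - q * dp)"
    by (simp add: poly_eq_subst_form[OF coeff_affA] poly_eq_subst_form[OF coeff_affB] binary_form_add
        binary_form_smult binary_form_subst_form \<Phi>_def algebra_simps)
  ultimately show ?thesis by (simp add: W_def leg_def del: leg_line.simps leg_foliation.simps)
qed

text \<open>
  The chart with parameter \<open>c\<close>: \<open>P = 1 / (p - c)\<close> on the projective line of the values \<open>p\<close>, and
  \<open>[x:y] = [S:1 + c S]\<close> on that of the directions. Every point of both lines is finite in the
  chart for all but finitely many \<open>c\<close>.
\<close>

definition chart_f :: "complex \<Rightarrow> complex poly" where
  "chart_f c = subst_form n \<beta> 1 c"

definition chart_g :: "complex \<Rightarrow> complex poly" where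
  "chart_g c = subst_form n \<alpha> 1 c + smult c (subst_form n \<beta> 1 c)"

definition chart_k :: "complex \<Rightarrow> complex" where
  "chart_k c = (if lz = 0 then - ly / (lx + c * ly) else 0)"

definition chart_e :: complex where
  "chart_e = (if lz = 0 then 0 else 1)"

lemma poly_chart_f: "poly (chart_f c) S = B S (1 + c * S)"
  by (simp add: chart_f_def poly_subst_form)

lemma poly_chart_g: "poly (chart_g c) S = A S (1 + c * S) + c * B S (1 + c * S)"
  by (simp add: chart_g_def poly_subst_form)

lemma coeff_chart: "coeff (chart_f c) n = B 1 c" "coeff (chart_g c) n = A 1 c + c * B 1 c"
  by (simp_all add: chart_f_def chart_g_def coeff_subst_form)

lemma pencil_chart: "pencil (chart_f c) (chart_g c) n"
proof
  show "degree (chart_f c) \<le> n" "degree (chart_g c) \<le> n"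
    unfolding chart_f_def chart_g_def
    by (intro degree_subst_form degree_add_le order_trans[OF degree_smult_le])+
  fix S
  have "(S, 1 + c * S) \<noteq> 0" by (auto simp: zero_prod_def)
  from no_common_zero[OF this] show "\<not> (poly (chart_f c) S = 0 \<and> poly (chart_g c) S = 0)"
    by (auto simp: poly_chart_f poly_chart_g)
qed

sublocale C: pencil "chart_f c" "chart_g c" n "chart_k c" chart_e for c
  by (rule pencil_chart)

text \<open>Neither p, nor a direction with Gauss image p, nor a line \<ell> through the origin is
  at infinity in the chart; the direction S = infinity is [1:c].\<close>

definition good :: "complex \<Rightarrow> complex \<Rightarrow> bool" where
  "good c p \<longleftrightarrow> p \<noteq> c \<and> \<Phi> p 1 c \<noteq> 0 \<and> (lz = 0 \<longrightarrow> lx + c * ly \<noteq> 0)"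

lemma member_chart:
  assumes "p \<noteq> c"
  shows "poly (C.member c (1 / (p - c))) S = \<Phi> p S (1 + c * S) / (p - c)"
    "coeff (C.member c (1 / (p - c))) n = \<Phi> p 1 c / (p - c)"
  using assms
  by (simp_all add: C.poly_member C.member_def coeff_chart poly_chart_f poly_chart_g \<Phi>_def field_simps)

lemma coeff_member_good: "good c p \<Longrightarrow> coeff (C.member c (1 / (p - c))) n \<noteq> 0"
  by (auto simp: good_def member_chart)

lemma fibre_chart: "p \<noteq> c \<Longrightarrow> S \<in> C.fibre c (1 / (p - c)) \<longleftrightarrow> \<Phi> p S (1 + c * S) = 0"
  by (simp add: C.fibre_def member_chart)

text \<open>For x = dq and y = p dq - q dp, \<kappa> is y - c x, so dq / \<kappa> is the coordinate
  S of the direction. The case \<kappa> = 0 is the direction S = infinity, which a good chart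
  excludes.\<close>

lemma W_zero_iff:
  fixes dp dq :: complex
  assumes g: "good c p" and q: "q \<noteq> 0"
  defines "\<kappa> \<equiv> (p - c) * dq - q * dp"
  shows "W (p, q) dp dq = 0 \<longleftrightarrow>
    (if \<kappa> = 0 then dp = 0 \<and> dq = 0 else dq / \<kappa> \<in> C.branches c (1 / (p - c)))"
proof (cases "\<kappa> = 0")
  case True
  have y: "p * dq - q * dp = dq * c" using True by (simp add: \<kappa>_def algebra_simps)
  have dp: "dp = (p - c) / q * dq" using True q by (simp add: \<kappa>_def field_simps)
  have "\<Phi> p dq (p * dq - q * dp) = dq ^ n * \<Phi> p 1 c"
    unfolding y using \<Phi>_scale[of p dq 1 c] by simp
  moreover have "lx * dq + ly * (p * dq - q * dp) + lz * dp = (lx + c * ly + lz * ((p - c) / q)) * dq"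
    unfolding y by (subst dp) (simp add: algebra_simps)
  moreover have "lx + c * ly + lz * ((p - c) / q) \<noteq> 0"
    using line_cases g q by (auto simp: good_def)
  moreover have "\<Phi> p 1 c \<noteq> 0" using g by (simp add: good_def)
  ultimately have "W (p, q) dp dq = 0 \<longleftrightarrow> dq = 0" by (auto simp: W_eq)
  then show ?thesis using True dp by auto
next
  case False
  define S where "S = dq / \<kappa>"
  have pc: "p \<noteq> c" using g by (simp add: good_def)
  have x: "dq = \<kappa> * S" using False by (simp add: S_def)
  have y: "p * dq - q * dp = \<kappa> * (1 + c * S)" using False by (simp add: S_def \<kappa>_def field_simps)
  have "\<kappa> * (p - c) / q * (S - 1 / (p - c)) = ((p - c) * (\<kappa> * S) - \<kappa>) / q"
    using pc q by (simp add: field_simps)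
  then have dp: "dp = \<kappa> * (p - c) / q * (S - 1 / (p - c))"
    using q unfolding x[symmetric] by (simp add: \<kappa>_def)
  have "\<Phi> p dq (p * dq - q * dp) = 0 \<longleftrightarrow> S \<in> C.fibre c (1 / (p - c))"
    using False unfolding y by (subst x) (simp add: \<Phi>_scale fibre_chart[OF pc])
  moreover have "lx * dq + ly * (p * dq - q * dp) + lz * dp = 0 \<longleftrightarrow>
      S = chart_k c + chart_e * (1 / (p - c))"
  proof (cases "lz = 0")
    case True
    then have nz: "lx + c * ly \<noteq> 0" using g unfolding good_def by blast
    have "lx * dq + ly * (p * dq - q * dp) + lz * dp = \<kappa> * ((lx + c * ly) * S + ly)"
      unfolding y using True by (subst x) (simp add: algebra_simps)
    moreover have "(lx + c * ly) * S + ly = 0 \<longleftrightarrow> S = - ly / (lx + c * ly)"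
      using nz by (auto simp: field_simps eq_neg_iff_add_eq_0)
    moreover have "chart_k c + chart_e * (1 / (p - c)) = - ly / (lx + c * ly)"
      unfolding chart_k_def chart_e_def using True by simp
    ultimately show ?thesis using False by simp
  next
    case lz: False
    then have ck: "chart_k c = 0" "chart_e = 1" by (simp_all add: chart_k_def chart_e_def)
    have "lx = 0" "ly = 0" using line_cases lz by auto
    then show ?thesis unfolding ck using lz dp False q pc by simp
  qed
  ultimately show ?thesis using False by (auto simp: W_eq C.branches_def S_def)
qed

section \<open>Defining forms of the web and their branches\<close>

definition height :: "complex \<Rightarrow> (nat \<Rightarrow> form1) \<Rightarrow> nat \<Rightarrow> pt \<Rightarrow> complex" where
  "height c \<omega> i z = (fst z - c) * fst (\<omega> i z) + snd z * snd (\<omega> i z)"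

text \<open>The kernel of e dp + f dq is spanned by (f, -e), and \<open>height\<close> is minus the
  value of \<kappa> on it. The quotient is thus the coordinate S of the kernel.\<close>

definition slope :: "complex \<Rightarrow> (nat \<Rightarrow> form1) \<Rightarrow> nat \<Rightarrow> pt \<Rightarrow> complex" where
  "slope c \<omega> i z = fst (\<omega> i z) / height c \<omega> i z"

lemma superposition_branch:
  assumes s: "superposition (n + 1) W U \<omega>" and z: "z \<in> U" "snd z \<noteq> 0" and g: "good c (fst z)"
    and i: "i < n + 1"
  shows "height c \<omega> i z \<noteq> 0" "slope c \<omega> i z \<in> C.branches c (1 / (fst z - c))"
proof -
  obtain p q where pq: "z = (p, q)" by (cases z)
  define e f where "e = fst (\<omega> i z)" and "f = snd (\<omega> i z)"
  \<comment> \<open>Transversality to any other form shows that \<open>\<omega> i\<close> does not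
    vanish.\<close>
  define j where "j = (if i = 0 then 1 else 0 :: nat)"
  have j: "j < n + 1" "i \<noteq> j" using n by (auto simp: j_def)
  have "delta \<omega> i j z \<noteq> 0" using s z i j by (auto simp: superposition_def)
  then have ef: "\<not> (e = 0 \<and> f = 0)" by (auto simp: delta_def wedge_def e_def f_def)
  have "W z f (- e) = 0 \<longleftrightarrow> (\<exists>i<n + 1. fst (\<omega> i z) * f + snd (\<omega> i z) * (- e) = 0)"
    using s z by (simp add: superposition_def)
  moreover have "fst (\<omega> i z) * f + snd (\<omega> i z) * (- e) = 0" by (simp add: e_def f_def)
  ultimately have W0: "W (p, q) f (- e) = 0" using i pq by blast
  define t where "t = (p - c) * (- e) - q * f"
  have "good c p" "q \<noteq> 0" using g z pq by auto
  from W0[unfolded W_zero_iff[OF this], folded t_def]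
  have *: "if t = 0 then f = 0 \<and> - e = 0 else (- e) / t \<in> C.branches c (1 / (p - c))" .
  have h: "height c \<omega> i z = - t"
    by (simp add: height_def e_def f_def pq t_def)
  show nz: "height c \<omega> i z \<noteq> 0" using * ef h by (auto split: if_splits)
  have "slope c \<omega> i z = (- e) / t"
    unfolding slope_def h e_def[symmetric] by (simp add: minus_divide_divide)
  then show "slope c \<omega> i z \<in> C.branches c (1 / (fst z - c))" using * nz h pq by (auto split: if_splits)
qed

text \<open>Transverse forms have different slopes, and n + 1 slopes fill a set of at most n + 1
  branches.\<close>

lemma superposition_regular:
  assumes s: "superposition (n + 1) W U \<omega>" and z: "z \<in> U" "snd z \<noteq> 0" and g: "good c (fst z)"
  shows "inj_on (\<lambda>i. slope c \<omega> i z) {..<n + 1}" (is ?inj)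
    "(\<lambda>i. slope c \<omega> i z) ` {..<n + 1} = C.branches c (1 / (fst z - c))" (is ?im)
    "C.regular c (1 / (fst z - c))" (is ?reg)
proof -
  note b = superposition_branch[OF s z g]
  show inj: ?inj
  proof (rule inj_onI, rule ccontr)
    fix i j assume ij: "i \<in> {..<n + 1}" "j \<in> {..<n + 1}" "slope c \<omega> i z = slope c \<omega> j z" "i \<noteq> j"
    then have "fst (\<omega> i z) * height c \<omega> j z = fst (\<omega> j z) * height c \<omega> i z"
      using b(1)[of i] b(1)[of j] by (simp add: slope_def field_simps)
    then have "snd z * (fst (\<omega> i z) * snd (\<omega> j z) - snd (\<omega> i z) * fst (\<omega> j z)) = 0"
      unfolding height_def by algebra
    then have "delta \<omega> i j z = 0" using z by (simp add: delta_def wedge_def)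
    then show False using s z ij by (auto simp: superposition_def)
  qed
  have c0: "coeff (C.member c (1 / (fst z - c))) n \<noteq> 0" by (rule coeff_member_good[OF g])
  have fin: "finite (C.branches c (1 / (fst z - c)))"
    using C.finite_fibre[OF c0] by (simp add: C.branches_def)
  have card: "card (C.branches c (1 / (fst z - c))) \<le> n + 1"
    using C.finite_fibre[OF c0] by (simp add: C.branches_def card_insert_if)
  show im: ?im
    by (rule card_seteq[OF fin]) (use b(2) card card_image[OF inj] in auto)
  show ?reg unfolding C.regular_def using c0 im card_image[OF inj] by simp
qed

text \<open>On q = 0 the equation of the web has at most two zero directions, dq = 0 and that of the
  factor of \<ell>, whereas n + 1 \<ge> 3 transverse foliations have three.\<close>

lemma superposition_snd_nonzero:
  assumes s: "superposition (n + 1) W U \<omega>" and z: "z \<in> U"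
  shows "snd z \<noteq> 0"
proof
  assume "snd z = 0"
  then obtain p where p: "z = (p, 0)" by (cases z) auto
  have W0: "W z dp dq = ((lx + ly * p) * dq + lz * dp) * (dq ^ n * \<Phi> p 1 p)" for dp dq
    using \<Phi>_scale[of p dq 1 p] by (simp add: W_eq p algebra_simps)
  have zero: "W z dp dq = 0 \<longleftrightarrow> (\<exists>i<n + 1. fst (\<omega> i z) * dp + snd (\<omega> i z) * dq = 0)" for dp dq
    using s z by (auto simp: superposition_def)
  have wedge: "fst (\<omega> i z) * snd (\<omega> j z) - snd (\<omega> i z) * fst (\<omega> j z) \<noteq> 0"
    if "i < n + 1" "j < n + 1" "i \<noteq> j" for i j
    using s z that by (auto simp: superposition_def delta_def wedge_def)
  have nz: "\<not> (\<omega> i z = (0, 0))" if "i < n + 1" for i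
  proof -
    define j where "j = (if i = 0 then 1 else 0 :: nat)"
    have "j < n + 1" "i \<noteq> j" using n by (auto simp: j_def)
    then show ?thesis using wedge[OF that, of j] by auto
  qed
  \<comment> \<open>Otherwise finitely many kernels would cover infinitely many directions.\<close>
  have "\<exists>t. W z 1 t \<noteq> 0"
  proof (rule ccontr)
    assume "\<not> ?thesis"
    then have "UNIV \<subseteq> (\<lambda>i. - fst (\<omega> i z) / snd (\<omega> i z)) ` {..<n + 1}"
    proof (intro subsetI)
      fix t assume "\<not> (\<exists>t. W z 1 t \<noteq> 0)"
      then obtain i where i: "i < n + 1" "fst (\<omega> i z) + snd (\<omega> i z) * t = 0" using zero[of 1 t] by auto
      have "snd (\<omega> i z) \<noteq> 0" using i nz[OF i(1)] by (auto simp: prod_eq_iff)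
      then have "t = - fst (\<omega> i z) / snd (\<omega> i z)" using i(2)
        by (simp add: field_simps eq_neg_iff_add_eq_0 add.commute)
      then show "t \<in> (\<lambda>i. - fst (\<omega> i z) / snd (\<omega> i z)) ` {..<n + 1}" using i(1) by auto
    qed
    then have "finite (UNIV :: complex set)" by (rule finite_subset) auto
    then show False by (simp add: infinite_UNIV_char_0)
  qed
  then have \<Phi>: "\<Phi> p 1 p \<noteq> 0" and l: "lx + ly * p \<noteq> 0 \<or> lz \<noteq> 0" by (auto simp: W0)
  \<comment> \<open>By transversality at most one form has the kernel dq = 0.\<close>
  obtain i j where ij: "i < n + 1" "j < n + 1" "i \<noteq> j" "fst (\<omega> i z) \<noteq> 0" "fst (\<omega> j z) \<noteq> 0"
  proof -
    have "fst (\<omega> 0 z) \<noteq> 0 \<or> fst (\<omega> 1 z) \<noteq> 0" "fst (\<omega> 0 z) \<noteq> 0 \<or> fst (\<omega> 2 z) \<noteq> 0"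
      "fst (\<omega> 1 z) \<noteq> 0 \<or> fst (\<omega> 2 z) \<noteq> 0"
      using wedge[of 0 1] wedge[of 0 2] wedge[of 1 2] n by auto
    then show ?thesis using that[of 0 1] that[of 0 2] that[of 1 2] n by auto
  qed
  have "(lx + ly * p) * fst (\<omega> i z) = lz * snd (\<omega> i z)" if "i < n + 1" "fst (\<omega> i z) \<noteq> 0" for i
  proof -
    have "W z (snd (\<omega> i z)) (- fst (\<omega> i z)) = 0"
      unfolding zero using that by (intro exI[of _ i]) (simp add: algebra_simps)
    then show ?thesis using \<Phi> that by (simp add: W0)
  qed
  from this[OF ij(1,4)] this[OF ij(2,5)]
  have "(lx + ly * p) * (fst (\<omega> i z) * snd (\<omega> j z) - snd (\<omega> i z) * fst (\<omega> j z)) = 0"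
    "lz * (fst (\<omega> i z) * snd (\<omega> j z) - snd (\<omega> i z) * fst (\<omega> j z)) = 0"
    by algebra+
  then show False using l wedge[OF ij(1-3)] by simp
qed

definition chart_bsum :: "complex \<Rightarrow> complex \<Rightarrow> complex" where
  "chart_bsum c p = C.bsum c (1 / (p - c))"

lemma open_good: "open {p. good c p}"
proof -
  have "{p. good c p} = {p. p \<noteq> c} \<inter> {p. A 1 c + p * B 1 c \<noteq> 0} \<inter> {p. lz = 0 \<longrightarrow> lx + c * ly \<noteq> 0}"
    by (auto simp: good_def \<Phi>_def)
  then show ?thesis
    by (auto intro!: open_Int open_Collect_neq continuous_intros)
qed

lemma superposition_exists:
  assumes g: "good c p0" and reg: "C.regular c (1 / (p0 - c))" and q0: "q0 \<noteq> 0"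
  shows "(p0, q0) \<in> web_regular (n + 1) W"
proof -
  define P where "P = (\<lambda>p. 1 / (p - c))"
  obtain r \<sigma> where r: "r > 0"
    "\<And>Q. Q \<in> ball (P p0) r \<Longrightarrow> inj_on (\<lambda>i. \<sigma> i Q) {..<n + 1}"
    "\<And>Q. Q \<in> ball (P p0) r \<Longrightarrow> C.branches c Q = (\<lambda>i. \<sigma> i Q) ` {..<n + 1}"
    "\<And>i Q. i < n + 1 \<Longrightarrow> Q \<in> ball (P p0) r \<Longrightarrow>
      (\<sigma> i has_field_derivative 1 - C.velocity c Q (\<sigma> i Q)) (at Q)"
    using C.regular_branches[OF reg] unfolding P_def by metis
  have h\<sigma>: "\<sigma> i holomorphic_on ball (P p0) r" if "i < n + 1" for i
    unfolding holomorphic_on_open[OF open_ball] using r(4)[OF that] by blast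
  define V where "V = {p. good c p} \<inter> {p. p \<noteq> c \<and> P p \<in> ball (P p0) r}"
  have "continuous_on {p. p \<noteq> c} P" unfolding P_def by (intro continuous_intros) auto
  moreover have "open {p. p \<noteq> c}" by (intro open_Collect_neq continuous_intros)
  ultimately have "open ({p. p \<noteq> c} \<inter> P -` ball (P p0) r)"
    by (rule continuous_open_preimage[OF _ _ open_ball])
  moreover have "{p. p \<noteq> c} \<inter> P -` ball (P p0) r = {p. p \<noteq> c \<and> P p \<in> ball (P p0) r}" by auto
  ultimately have "open {p. p \<noteq> c \<and> P p \<in> ball (P p0) r}" by simp
  then have V: "open V" unfolding V_def using open_good by blast
  have Vc: "p \<noteq> c" "P p \<noteq> 0" "P p \<in> ball (P p0) r" "good c p" if "p \<in> V" for p
    using that by (auto simp: V_def P_def)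
  have hP: "P holomorphic_on V" unfolding P_def using Vc by (intro holomorphic_intros) auto
  have h\<sigma>P: "(\<lambda>p. \<sigma> i (P p)) holomorphic_on V" if "i < n + 1" for i
  proof -
    have "P ` V \<subseteq> ball (P p0) r" using Vc(3) by blast
    from holomorphic_on_compose_gen[OF hP h\<sigma>[OF that] this] show ?thesis by (simp add: o_def)
  qed
  define U where "U = V \<times> (UNIV - {0 :: complex})"
  have U: "open U" unfolding U_def by (intro open_Times V open_Diff) auto
  \<comment> \<open>This is dq/q = dp/(p - s) with p = c + 1/P and s = c + 1/\<sigma>, cleared of
    denominators so that vertical directions (\<sigma> = 0) and fixed points (\<sigma> = P) are
    covered.\<close>
  define \<omega> :: "nat \<Rightarrow> form1" where
    "\<omega> = (\<lambda>i w. (\<sigma> i (P (fst w)) * P (fst w), (P (fst w) - \<sigma> i (P (fst w))) * (1 / snd w)))"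
  have comp1: "holomorphic2_on (\<lambda>w. h (fst w)) U" if "h holomorphic_on V" for h
    by (rule holomorphic2_on_compose[OF holomorphic2_on_fst[OF U] that V]) (auto simp: U_def)
  have comp2: "holomorphic2_on (\<lambda>w. 1 / snd w) U"
    by (rule holomorphic2_on_compose[OF holomorphic2_on_snd[OF U], where T = "UNIV - {0}" and h = "\<lambda>q. 1 / q"])
       (auto simp: U_def intro!: holomorphic_intros open_Diff)
  have "superposition (n + 1) W U \<omega>"
    unfolding superposition_def
  proof (intro conjI allI impI ballI)
    show "open U" by (rule U)
    fix i assume i: "i < n + 1"
    show "holomorphic2_on (\<lambda>z. fst (\<omega> i z)) U"
      unfolding \<omega>_def fst_conv by (rule comp1) (intro holomorphic_intros h\<sigma>P i hP)
    show "holomorphic2_on (\<lambda>z. snd (\<omega> i z)) U"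
      unfolding \<omega>_def snd_conv
      by (intro holomorphic2_on_mult comp2 comp1 holomorphic_intros h\<sigma>P i hP)
    fix j z assume j: "j < n + 1" "i \<noteq> j" "z \<in> U"
    then have v: "fst z \<in> V" "snd z \<noteq> 0" by (auto simp: U_def)
    have "delta \<omega> i j z = (P (fst z))\<^sup>2 * (\<sigma> i (P (fst z)) - \<sigma> j (P (fst z))) / snd z"
      by (simp add: delta_def wedge_def \<omega>_def power2_eq_square algebra_simps diff_divide_distrib)
    moreover have "\<sigma> i (P (fst z)) \<noteq> \<sigma> j (P (fst z))"
      using r(2)[OF Vc(3)[OF v(1)]] i j by (auto dest: inj_onD)
    ultimately show "delta \<omega> i j z \<noteq> 0" using v Vc by auto
  next
    fix z dp dq assume "z \<in> U"
    then obtain p q where pq: "z = (p, q)" "p \<in> V" "q \<noteq> 0" by (auto simp: U_def)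
    define \<kappa> where "\<kappa> = (p - c) * dq - q * dp"
    note Vp = Vc[OF pq(2)]
    have eq: "fst (\<omega> i z) * dp + snd (\<omega> i z) * dq = P p / q * (dq - \<sigma> i (P p) * \<kappa>)" for i
    proof -
      have P\<kappa>: "P p * \<kappa> = dq - P p * q * dp" using Vp(1) by (simp add: \<kappa>_def P_def field_simps)
      have "P p / q * (dq - \<sigma> i (P p) * \<kappa>) = (P p * dq - \<sigma> i (P p) * (P p * \<kappa>)) / q"
        by (simp add: algebra_simps diff_divide_distrib)
      then show ?thesis unfolding P\<kappa> using pq(3) by (simp add: \<omega>_def pq(1) field_simps)
    qed
    have "W z dp dq = 0 \<longleftrightarrow> (if \<kappa> = 0 then dp = 0 \<and> dq = 0 else dq / \<kappa> \<in> C.branches c (P p))"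
      unfolding \<kappa>_def P_def pq(1) by (rule W_zero_iff[OF Vp(4) pq(3)])
    also have "\<dots> \<longleftrightarrow> (\<exists>i<n + 1. dq - \<sigma> i (P p) * \<kappa> = 0)"
    proof (cases "\<kappa> = 0")
      case True
      then have "dq = 0 \<longleftrightarrow> dp = 0 \<and> dq = 0" using pq(3) by (auto simp: \<kappa>_def)
      then show ?thesis using True by auto
    next
      case False
      then have "dq / \<kappa> = \<sigma> i (P p) \<longleftrightarrow> dq - \<sigma> i (P p) * \<kappa> = 0" for i by (simp add: field_simps)
      then show ?thesis using False by (auto simp: r(3)[OF Vp(3)])
    qed
    also have "\<dots> \<longleftrightarrow> (\<exists>i<n + 1. fst (\<omega> i z) * dp + snd (\<omega> i z) * dq = 0)"
      unfolding eq using Vp(2) pq(3) by simp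
    finally show "W z dp dq = 0 \<longleftrightarrow> (\<exists>i<n + 1. fst (\<omega> i z) * dp + snd (\<omega> i z) * dq = 0)" .
  qed
  moreover have "(p0, q0) \<in> U" using g q0 r(1) by (auto simp: U_def V_def good_def)
  ultimately show ?thesis unfolding web_regular_def by blast
qed

text \<open>The forms are arbitrary, so their slopes have to be matched with the local branches: at
  the base point by a permutation, nearby by continuity, since the branches stay distinct. Then the
  normal form of \<open>invariant_web\<close> applies, and the sum over sets does not see the
  permutation.\<close>

lemma forms_curvature_superposition:
  assumes s: "superposition (n + 1) W U \<omega>" and z: "(p0, q0) \<in> U" and g: "good c p0"
  shows "forms_curvature (n + 1) \<omega> (p0, q0) = deriv (chart_bsum c) p0 / q0"
proof -
  have U: "open U" using s by (simp add: superposition_def)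
  have q0: "q0 \<noteq> 0" using superposition_snd_nonzero[OF s z] by simp
  have h\<omega>: "holomorphic2_on (\<lambda>z. fst (\<omega> i z)) U" "holomorphic2_on (\<lambda>z. snd (\<omega> i z)) U"
    if "i < n + 1" for i
    using s that by (auto simp: superposition_def)
  define P where "P = (\<lambda>p. 1 / (p - c))"
  note reg = superposition_regular[OF s z, of c, simplified, OF q0 g]
  have reg3: "C.regular c (P p0)" using reg(3) by (simp add: P_def)
  obtain r \<tau> where r: "r > 0"
    "\<And>Q. Q \<in> ball (P p0) r \<Longrightarrow> inj_on (\<lambda>i. \<tau> i Q) {..<n + 1}"
    "\<And>Q. Q \<in> ball (P p0) r \<Longrightarrow> C.branches c Q = (\<lambda>i. \<tau> i Q) ` {..<n + 1}"
    "\<And>i Q. i < n + 1 \<Longrightarrow> Q \<in> ball (P p0) r \<Longrightarrow>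
      (\<tau> i has_field_derivative 1 - C.velocity c Q (\<tau> i Q)) (at Q)"
    using C.regular_branches[OF reg3] by metis
  have "\<forall>i\<in>{..<n + 1}. \<exists>j. j < n + 1 \<and> slope c \<omega> i (p0, q0) = \<tau> j (P p0)"
    using reg(2) r(1) r(3)[of "P p0"] by (auto simp: P_def)
  from bchoice[OF this] obtain \<pi> where \<pi>: "\<And>i. i < n + 1 \<Longrightarrow> \<pi> i < n + 1"
    "\<And>i. i < n + 1 \<Longrightarrow> slope c \<omega> i (p0, q0) = \<tau> (\<pi> i) (P p0)" by auto
  have inj\<pi>: "inj_on \<pi> {..<n + 1}"
    using reg(1) \<pi>(2) by (auto simp: inj_on_def)
  have bij\<pi>: "\<pi> ` {..<n + 1} = {..<n + 1}"
    by (rule endo_inj_surj[OF finite_lessThan _ inj\<pi>]) (use \<pi>(1) in auto)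
  define \<sigma> where "\<sigma> = (\<lambda>i. \<tau> (\<pi> i))"
  have \<sigma>: "inj_on (\<lambda>i. \<sigma> i Q) {..<n + 1}" "C.branches c Q = (\<lambda>i. \<sigma> i Q) ` {..<n + 1}"
    "\<And>i. i < n + 1 \<Longrightarrow> (\<sigma> i has_field_derivative 1 - C.velocity c Q (\<sigma> i Q)) (at Q)"
    if Q: "Q \<in> ball (P p0) r" for Q
  proof -
    show "inj_on (\<lambda>i. \<sigma> i Q) {..<n + 1}"
      using comp_inj_on[OF inj\<pi>, of "\<lambda>i. \<tau> i Q"] r(2)[OF Q] bij\<pi> by (simp add: \<sigma>_def o_def)
    show "C.branches c Q = (\<lambda>i. \<sigma> i Q) ` {..<n + 1}"
      unfolding r(3)[OF Q] \<sigma>_def by (subst bij\<pi>[symmetric]) (simp add: image_image)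
    show "(\<sigma> i has_field_derivative 1 - C.velocity c Q (\<sigma> i Q)) (at Q)" if "i < n + 1" for i
      using r(4)[OF \<pi>(1)[OF that] Q] by (simp add: \<sigma>_def)
  qed
  have slope0: "slope c \<omega> i (p0, q0) = \<sigma> i (P p0)" if "i < n + 1" for i
    using \<pi>(2)[OF that] by (simp add: \<sigma>_def)
  have p0c: "p0 \<noteq> c" using g by (simp add: good_def)
  have cP: "isCont (\<lambda>w. P (fst w)) (p0, q0)" unfolding P_def using p0c
    by (intro continuous_intros) auto
  have c\<sigma>: "isCont (\<lambda>w. \<sigma> i (P (fst w))) (p0, q0)" if "i < n + 1" for i
  proof -
    have "isCont (\<sigma> i) (P (fst (p0, q0)))" using DERIV_isCont[OF \<sigma>(3)[OF _ that]] r(1) by simp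
    from isCont_o2[OF cP this] show ?thesis .
  qed
  have c\<omega>: "isCont (\<lambda>w. fst (\<omega> i w)) (p0, q0)" "isCont (\<lambda>w. snd (\<omega> i w)) (p0, q0)" if "i < n + 1" for i
    using holomorphic2_on_continuous_on[OF h\<omega>(1)[OF that]] holomorphic2_on_continuous_on[OF h\<omega>(2)[OF that]]
      z continuous_on_eq_continuous_at[OF U] by blast+
  have cs: "isCont (slope c \<omega> i) (p0, q0)" if "i < n + 1" for i
  proof -
    have "height c \<omega> i (p0, q0) \<noteq> 0" using superposition_branch(1)[OF s z _ _ that] q0 g by simp
    then show ?thesis unfolding slope_def[abs_def] height_def
      by (intro continuous_intros c\<omega> that) auto
  qed
  have ev1: "\<forall>\<^sub>F w in nhds (p0, q0). slope c \<omega> i w \<noteq> \<sigma> j (P (fst w))"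
    if "i < n + 1" "j < n + 1" "i \<noteq> j" for i j
  proof -
    have "isCont (\<lambda>w. slope c \<omega> i w - \<sigma> j (P (fst w))) (p0, q0)"
      by (intro continuous_intros cs c\<sigma> that)
    moreover have "slope c \<omega> i (p0, q0) - \<sigma> j (P p0) \<noteq> 0"
      using slope0[OF that(1)] \<sigma>(1)[of "P p0"] that r(1) by (auto dest: inj_onD)
    ultimately have "\<forall>\<^sub>F w in nhds (p0, q0). slope c \<omega> i w - \<sigma> j (P (fst w)) \<noteq> 0"
      by (intro tendsto_imp_eventually_ne[where c = "slope c \<omega> i (p0, q0) - \<sigma> j (P p0)"])
        (auto simp: continuous_at tendsto_nhds_iff)
    then show ?thesis by simp
  qed
  have ev1': "\<forall>\<^sub>F w in nhds (p0, q0). \<forall>i\<in>{..<n + 1}. \<forall>j\<in>{..<n + 1} - {i}. slope c \<omega> i w \<noteq> \<sigma> j (P (fst w))"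
    by (intro eventually_ball_finite ballI finite_lessThan finite_Diff ev1) auto
  have ev2: "\<forall>\<^sub>F w in nhds (p0, q0). P (fst w) \<in> ball (P p0) r"
    using cP r(1) by (intro topological_tendstoD[where l = "P p0"]) (auto simp: continuous_at tendsto_nhds_iff)
  have ev3: "\<forall>\<^sub>F w in nhds (p0, q0). w \<in> U" using U z by (rule eventually_nhds_in_open)
  have ev4: "\<forall>\<^sub>F w in nhds (p0, q0). w \<in> {p. good c p} \<times> UNIV"
    using g open_good by (intro eventually_nhds_in_open open_Times) auto
  have ev5: "\<forall>\<^sub>F w in nhds (p0, q0). w \<in> UNIV \<times> (UNIV - {0})"
    using q0 by (intro eventually_nhds_in_open open_Times open_Diff) auto
  obtain T where T: "open T" "(p0, q0) \<in> T" "\<And>w. w \<in> T \<Longrightarrow>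
      (\<forall>i\<in>{..<n + 1}. \<forall>j\<in>{..<n + 1} - {i}. slope c \<omega> i w \<noteq> \<sigma> j (P (fst w))) \<and>
      P (fst w) \<in> ball (P p0) r \<and> w \<in> U \<and> w \<in> {p. good c p} \<times> UNIV \<and> w \<in> UNIV \<times> (UNIV - {0})"
    using eventually_conj[OF ev1' eventually_conj[OF ev2 eventually_conj[OF ev3 eventually_conj[OF ev4 ev5]]]]
    unfolding eventually_nhds by blast
  obtain V X where VX: "open V" "open X" "(p0, q0) \<in> V \<times> X" "V \<times> X \<subseteq> T"
    using open_prod_elim[OF T(1,2)] by metis
  have in_T: "(p, q) \<in> T" if "p \<in> V" "q \<in> X" for p q using that VX by auto
  have slope_eq: "slope c \<omega> i w = \<sigma> i (P (fst w))" if "i < n + 1" "w \<in> V \<times> X" for i w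
  proof -
    have w: "w \<in> T" using that VX by auto
    note Tw = T(3)[OF w]
    have "slope c \<omega> i w \<in> C.branches c (P (fst w))"
      unfolding P_def by (rule superposition_branch(2)[OF s _ _ _ that(1)]) (use Tw in auto)
    then obtain j where "j < n + 1" "slope c \<omega> i w = \<sigma> j (P (fst w))"
      using \<sigma>(2)[of "P (fst w)"] Tw by auto
    then show ?thesis using Tw that(1) by (cases "i = j") auto
  qed
  have V: "p \<noteq> c" "good c p" "P p \<in> ball (P p0) r" if "p \<in> V" for p
    using T(3)[OF in_T[OF that]] VX by (auto simp: good_def)
  have X: "0 \<notin> X" using T(3)[OF in_T] VX by blast
  define m where "m = (\<lambda>i p. C.velocity c (P p) (\<sigma> i (P p)))"
  define M where "M = (\<lambda>i p. P p - \<sigma> i (P p))"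
  \<comment> \<open>As P (p - c) = 1, the dp-coefficient \<sigma> \<open>height\<close> is \<gamma>
    \<sigma> P, and \<sigma> P is N + M \<psi> for N = P^2 and \<psi> = -P.\<close>
  define \<gamma> where "\<gamma> = (\<lambda>i w. height c \<omega> i w * (fst w - c))"
  have dP: "(P has_field_derivative - (P p)\<^sup>2) (at p)" if "p \<in> V" for p
    unfolding P_def using V(1)[OF that]
    by (auto intro!: derivative_eq_intros simp: field_simps power2_eq_square)
  have hP: "P holomorphic_on V" unfolding holomorphic_on_open[OF VX(1)] using dP by blast
  have opVX: "open (V \<times> X)" by (intro open_Times VX)
  have VXU: "V \<times> X \<subseteq> U" using VX T by blast
  \<comment> \<open>N is -dP/dp, and \<psi> dp is d log P because q P takes the place of q in the
    chart.\<close>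
  interpret I: invariant_web V X "n + 1" "\<lambda>p. (P p)\<^sup>2" "\<lambda>p. - P p" M m \<gamma> \<omega>
  proof
    show "open V" "open X" "0 \<notin> X" using VX X by auto
    show "(\<lambda>p. (P p)\<^sup>2) holomorphic_on V" "(\<lambda>p. - P p) holomorphic_on V"
      by (intro holomorphic_intros hP)+
    show "(P p)\<^sup>2 \<noteq> 0" if "p \<in> V" for p using V(1)[OF that] by (simp add: P_def)
    show "(M i has_field_derivative - (P p)\<^sup>2 * m i p) (at p)" if "i < n + 1" "p \<in> V" for i p
    proof -
      have "((\<lambda>p. \<sigma> i (P p)) has_field_derivative (1 - C.velocity c (P p) (\<sigma> i (P p))) * - (P p)\<^sup>2) (at p)"
        by (rule DERIV_chain2[OF \<sigma>(3)[OF V(3)[OF that(2)] that(1)] dP[OF that(2)]])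
      from DERIV_diff[OF dP[OF that(2)] this] show ?thesis
        by (simp add: M_def m_def algebra_simps)
    qed
    show "M i p \<noteq> M j p" if "i < n + 1" "j < n + 1" "i \<noteq> j" "p \<in> V" for i j p
      using \<sigma>(1)[OF V(3)[OF that(4)]] that by (auto simp: M_def dest: inj_onD)
    show "holomorphic2_on (\<gamma> i) (V \<times> X)" if "i < n + 1" for i
    proof -
      have sub: "holomorphic2_on f (V \<times> X)" if "holomorphic2_on f U" for f
        by (rule holomorphic2_on_subset[OF that opVX VXU])
      have lin: "holomorphic2_on (\<lambda>w. fst w - c) (V \<times> X)"
        by (rule holomorphic2_on_compose[OF holomorphic2_on_fst[OF opVX], where T = UNIV and h = "\<lambda>p. p - c"])
           (auto intro!: holomorphic_intros)
      show ?thesis unfolding \<gamma>_def height_def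
        by (intro holomorphic2_on_mult holomorphic2_on_add lin sub h\<omega> that holomorphic2_on_snd opVX)
    qed
    have hnz: "height c \<omega> i w \<noteq> 0" if "i < n + 1" "w \<in> V \<times> X" for i w
      by (rule superposition_branch(1)[OF s _ _ _ that(1)]) (use that VXU V(2)[of "fst w"] X in auto)
    show "\<gamma> i w \<noteq> 0" if "i < n + 1" "w \<in> V \<times> X" for i w
      using hnz[OF that] that V(1)[of "fst w"] by (auto simp: \<gamma>_def)
    show "\<omega> i w = (\<gamma> i w * ((P (fst w))\<^sup>2 + M i (fst w) * - P (fst w)), \<gamma> i w * M i (fst w) / snd w)"
      if "i < n + 1" "w \<in> V \<times> X" for i w
    proof -
      have w: "fst w \<noteq> c" "snd w \<noteq> 0" using that V(1)[of "fst w"] X by auto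
      then have PP: "(fst w - c) * P (fst w) = 1" by (simp add: P_def)
      have e: "fst (\<omega> i w) = \<sigma> i (P (fst w)) * height c \<omega> i w"
        using slope_eq[OF that] hnz[OF that] by (simp add: slope_def field_simps)
      have "\<gamma> i w * ((P (fst w))\<^sup>2 + M i (fst w) * - P (fst w)) =
         ((fst w - c) * P (fst w)) * (height c \<omega> i w * \<sigma> i (P (fst w)))"
        by (simp add: \<gamma>_def M_def algebra_simps power2_eq_square)
      then have 1: "fst (\<omega> i w) = \<gamma> i w * ((P (fst w))\<^sup>2 + M i (fst w) * - P (fst w))"
        by (simp add: PP e)
      have "snd w * snd (\<omega> i w) = height c \<omega> i w - (fst w - c) * fst (\<omega> i w)"
        by (simp add: height_def)
      also have "\<dots> = height c \<omega> i w * ((fst w - c) * P (fst w)) - (fst w - c) * (\<sigma> i (P (fst w)) * height c \<omega> i w)"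
        by (simp add: PP e)
      also have "\<dots> = \<gamma> i w * M i (fst w)" by (simp add: \<gamma>_def M_def algebra_simps)
      finally have "snd (\<omega> i w) = \<gamma> i w * M i (fst w) / snd w" using w by (simp add: field_simps)
      then show ?thesis using 1 by (simp add: prod_eq_iff)
    qed
  qed
  have "forms_curvature (n + 1) \<omega> (p0, q0) = deriv (\<lambda>p. \<Sum>(r, s, t) \<in> {(r, s, t). r < s \<and> s < t \<and> t < n + 1}.
      eta_coeff (\<lambda>i. M i p) (\<lambda>i. m i p) r s t) p0 / q0"
    using I.forms_curvature_\<omega>[OF VX(3)] by simp
  also have "deriv (\<lambda>p. \<Sum>(r, s, t) \<in> {(r, s, t). r < s \<and> s < t \<and> t < n + 1}.
      eta_coeff (\<lambda>i. M i p) (\<lambda>i. m i p) r s t) p0 = deriv (chart_bsum c) p0"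
  proof (rule deriv_cong_ev)
    have "\<forall>\<^sub>F p in nhds p0. p \<in> V" using VX by (intro eventually_nhds_in_open) auto
    then show "\<forall>\<^sub>F p in nhds p0. (\<Sum>(r, s, t) \<in> {(r, s, t). r < s \<and> s < t \<and> t < n + 1}.
      eta_coeff (\<lambda>i. M i p) (\<lambda>i. m i p) r s t) = chart_bsum c p"
    proof eventually_elim
      case (elim p)
      show ?case unfolding chart_bsum_def P_def[symmetric] M_def m_def
        using C.bsum_indexed[OF \<sigma>(1,2)[OF V(3)[OF elim]]] P_def by (simp add: P_def)
    qed
  qed simp
  finally show ?thesis .
qed

end

section \<open>The curvature as a function on the projective line\<close>

lemma eventually_at_notin_finite:
  fixes a :: complex
  assumes "finite F"
  shows "\<forall>\<^sub>F x in at a. x \<notin> F"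
proof -
  obtain r where "r > 0" "\<And>x. x \<in> F \<Longrightarrow> x \<noteq> a \<Longrightarrow> r \<le> dist a x"
    using finite_set_avoid[OF assms, of a] by auto
  then show ?thesis unfolding eventually_at by (intro exI[of _ r]) (force simp: dist_commute)
qed

lemma eventually_at_infinity_notin_finite:
  fixes F :: "complex set"
  assumes "finite F"
  shows "\<forall>\<^sub>F x in at_infinity. x \<notin> F"
proof -
  obtain b where "\<And>x. x \<in> F \<Longrightarrow> norm x \<le> b"
    using finite_imp_bounded[OF assms] by (auto simp: bounded_iff)
  then show ?thesis unfolding eventually_at_infinity by (intro exI[of _ "b + 1"]) force
qed

lemma holomorphic_extend_finite:
  assumes "finite E" "D holomorphic_on UNIV - E"
    and "\<And>e. e \<in> E \<Longrightarrow> \<exists>K. \<forall>\<^sub>F p in at e. norm (D p) \<le> K"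
  shows "\<exists>D'. D' holomorphic_on UNIV \<and> (\<forall>p\<in>UNIV - E. D' p = D p)"
  using assms
proof (induction E arbitrary: D)
  case empty
  then show ?case by auto
next
  case (insert e E)
  have op: "open (UNIV - E)" using insert.hyps(1) by (intro open_Diff open_UNIV finite_imp_closed)
  have hol: "D holomorphic_on (UNIV - E) - {e}"
    by (rule holomorphic_on_subset[OF insert.prems(1)]) auto
  have int: "e \<in> interior (UNIV - E)" using interior_open[OF op] insert.hyps by auto
  have "\<exists>K. \<forall>\<^sub>F p in at e. norm (D p) \<le> K" by (rule insert.prems(2)) simp
  then obtain g where g: "g holomorphic_on UNIV - E" "\<And>z. z \<in> UNIV - E - {e} \<Longrightarrow> g z = D z"
    using holomorphic_on_extend_bounded[OF hol int] by blast
  have "\<exists>K. \<forall>\<^sub>F p in at e'. norm (g p) \<le> K" if e': "e' \<in> E" for e'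
  proof -
    obtain K where "\<forall>\<^sub>F p in at e'. norm (D p) \<le> K" using insert.prems(2)[of e'] e' by auto
    moreover have "\<forall>\<^sub>F p in at e'. p \<notin> insert e E"
      using insert.hyps(1) by (intro eventually_at_notin_finite) simp
    ultimately have "\<forall>\<^sub>F p in at e'. norm (g p) \<le> K"
      by eventually_elim (use g(2) in auto)
    then show ?thesis by blast
  qed
  from insert.IH[OF g(1) this] obtain D' where
    D': "D' holomorphic_on UNIV" "\<forall>p\<in>UNIV - E. D' p = g p" by blast
  have "\<forall>p\<in>UNIV - insert e E. D' p = D p" using D'(2) g(2) by simp
  then show ?case using D'(1) by blast
qed

text \<open>Rescaling by \<kappa> and substituting \<tau> multiply the Wronskian by \<kappa>^2
  \<tau>'; the linear change of the pair multiplies it by its determinant, here -1. So criticality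
  may be tested in any chart of source and target.\<close>

lemma wronskian_transfer:
  fixes u v \<kappa> \<tau> f g :: "complex \<Rightarrow> complex"
  assumes u: "(u has_field_derivative u') (at (\<tau> S))" and v: "(v has_field_derivative v') (at (\<tau> S))"
    and \<kappa>: "(\<kappa> has_field_derivative \<kappa>') (at S)" "\<kappa> S \<noteq> 0"
    and \<tau>: "(\<tau> has_field_derivative \<tau>') (at S)" "\<tau>' \<noteq> 0"
    and f: "(f has_field_derivative f') (at S)" "\<forall>\<^sub>F s in nhds S. f s = \<kappa> s * v (\<tau> s)"
    and g: "(g has_field_derivative g') (at S)" "\<forall>\<^sub>F s in nhds S. g s = \<kappa> s * (u (\<tau> s) + c * v (\<tau> s))"
  shows "f' * g S = f S * g' \<longleftrightarrow> u' * v (\<tau> S) = u (\<tau> S) * v'"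
proof -
  have dv: "((\<lambda>s. v (\<tau> s)) has_field_derivative v' * \<tau>') (at S)" by (rule DERIV_chain2[OF v \<tau>(1)])
  have du: "((\<lambda>s. u (\<tau> s)) has_field_derivative u' * \<tau>') (at S)" by (rule DERIV_chain2[OF u \<tau>(1)])
  have "((\<lambda>s. \<kappa> s * v (\<tau> s)) has_field_derivative \<kappa>' * v (\<tau> S) + v' * \<tau>' * \<kappa> S) (at S)"
    by (rule DERIV_mult[OF \<kappa>(1) dv])
  then have f': "f' = \<kappa>' * v (\<tau> S) + v' * \<tau>' * \<kappa> S"
    using DERIV_cong_ev[OF refl f(2) refl] f(1) DERIV_unique by blast
  have "((\<lambda>s. \<kappa> s * (u (\<tau> s) + c * v (\<tau> s))) has_field_derivative
      \<kappa>' * (u (\<tau> S) + c * v (\<tau> S)) + (u' * \<tau>' + c * (v' * \<tau>')) * \<kappa> S) (at S)"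
    by (rule DERIV_mult[OF \<kappa>(1) DERIV_add[OF du DERIV_cmult[OF dv]]])
  then have g': "g' = \<kappa>' * (u (\<tau> S) + c * v (\<tau> S)) + (u' * \<tau>' + c * (v' * \<tau>')) * \<kappa> S"
    using DERIV_cong_ev[OF refl g(2) refl] g(1) DERIV_unique by blast
  have fS: "f S = \<kappa> S * v (\<tau> S)" and gS: "g S = \<kappa> S * (u (\<tau> S) + c * v (\<tau> S))"
    using f(2) g(2) by (auto dest: eventually_nhds_x_imp_x)
  have "f' * g S - f S * g' = - ((\<kappa> S)\<^sup>2 * \<tau>' * (u' * v (\<tau> S) - u (\<tau> S) * v'))"
    unfolding f' g' fS gS by (simp add: power2_eq_square algebra_simps)
  moreover have "(\<kappa> S)\<^sup>2 * \<tau>' \<noteq> 0" using \<kappa> \<tau> by simp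
  ultimately show ?thesis by (metis eq_iff_diff_eq_0 mult_eq_0_iff neg_equal_0_iff_equal)
qed

text \<open>The chart of the target depends on whether v vanishes, but in both charts the derivative
  is zero exactly if the Wronskian of the homogeneous coordinates is.\<close>

lemma p1_critical_iff:
  assumes u: "(u has_field_derivative u') (at (p1_coord P P))" and v: "(v has_field_derivative v') (at (p1_coord P P))"
    and G: "\<And>t. G (p1_param P t) = (- u t, v t)"
    and nz: "u (p1_coord P P) \<noteq> 0 \<or> v (p1_coord P P) \<noteq> 0"
    and snd: "snd (G P) = 0 \<longleftrightarrow> v (p1_coord P P) = 0"
  shows "p1_critical G P \<longleftrightarrow> u' * v (p1_coord P P) = u (p1_coord P P) * v'"
proof (cases "v (p1_coord P P) = 0")
  case True
  then have nzu: "u (p1_coord P P) \<noteq> 0" using nz by simp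
  have "((\<lambda>t. v t / - u t) has_field_derivative - v' / u (p1_coord P P)) (at (p1_coord P P))"
    using u v nzu True by (auto intro!: derivative_eq_intros simp: field_simps power2_eq_square)
  then have "deriv (\<lambda>t. v t / - u t) (p1_coord P P) = - v' / u (p1_coord P P)" by (rule DERIV_imp_deriv)
  then show ?thesis using True snd nzu by (simp add: p1_critical_def G p1_coord_def[of "G P"])
next
  case False
  have "((\<lambda>t. - u t / v t) has_field_derivative
      - (u' * v (p1_coord P P) - u (p1_coord P P) * v') / (v (p1_coord P P))\<^sup>2) (at (p1_coord P P))"
    using u v False by (auto intro!: derivative_eq_intros simp: field_simps power2_eq_square)
  then have "deriv (\<lambda>t. - u t / v t) (p1_coord P P) =
      - (u' * v (p1_coord P P) - u (p1_coord P P) * v') / (v (p1_coord P P))\<^sup>2" by (rule DERIV_imp_deriv)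
  then show ?thesis using False snd by (auto simp: p1_critical_def G p1_coord_def[of "G P"])
qed

lemma binary_form_has_zero:
  assumes "degree F \<le> n" "n \<ge> 1"
  obtains x y where "(x, y) \<noteq> 0" "binary_form n F x y = 0"
proof (cases "degree F = 0")
  case True
  then have "coeff F n = 0" using assms(2) by (intro coeff_eq_0) simp
  then show ?thesis by (intro that[of 0 1]) (auto simp: binary_form_0_left zero_prod_def)
next
  case False
  then obtain s where "poly F s = 0"
    using Fundamental_Theorem_Algebra.fundamental_theorem_of_algebra[of F] by (auto simp: constant_degree)
  then show ?thesis by (intro that[of 1 s]) (auto simp: binary_form_1_left[OF assms(1)] zero_prod_def)
qed

lemma binary_form_has_derivative_left:
  "\<exists>D. ((\<lambda>t. binary_form n F t y) has_field_derivative D) (at t)"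
proof -
  have "(\<lambda>t. binary_form n F t y) holomorphic_on UNIV"
    unfolding binary_form_def by (intro holomorphic_intros)
  then show ?thesis by (auto simp: holomorphic_on_open)
qed

section \<open>The coefficient of the curvature as a function of p\<close>

context homogeneous_web
begin

lemma web_regular_snd: "(p, q) \<in> web_regular (n + 1) W \<Longrightarrow> q \<noteq> 0"
  using superposition_snd_nonzero by (fastforce simp: web_regular_def)

lemma web_regular_iff:
  assumes "good c p" "q \<noteq> 0"
  shows "(p, q) \<in> web_regular (n + 1) W \<longleftrightarrow> C.regular c (1 / (p - c))"
proof
  assume "(p, q) \<in> web_regular (n + 1) W"
  then obtain U \<omega> where "(p, q) \<in> U" "superposition (n + 1) W U \<omega>" by (auto simp: web_regular_def)
  from superposition_regular(3)[OF this(2,1), of c] show "C.regular c (1 / (p - c))"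
    using assms by simp
qed (use superposition_exists assms in blast)

lemma web_curvature_eq:
  assumes z: "(p, q) \<in> web_regular (n + 1) W" and g: "good c p"
  shows "web_curvature (n + 1) W (p, q) = deriv (chart_bsum c) p / q"
  unfolding web_curvature_def
proof (rule the_equality)
  obtain U \<omega> where U: "(p, q) \<in> U" "superposition (n + 1) W U \<omega>" using z by (auto simp: web_regular_def)
  show "\<exists>U \<omega>. (p, q) \<in> U \<and> superposition (n + 1) W U \<omega> \<and>
      deriv (chart_bsum c) p / q = forms_curvature (n + 1) \<omega> (p, q)"
    using U forms_curvature_superposition[OF U(2,1) g] by (intro exI[of _ U] exI[of _ \<omega>]) simp
  fix k assume "\<exists>U \<omega>. (p, q) \<in> U \<and> superposition (n + 1) W U \<omega> \<and> k = forms_curvature (n + 1) \<omega> (p, q)"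
  then show "k = deriv (chart_bsum c) p / q" using forms_curvature_superposition[OF _ _ g] by metis
qed

text \<open>If A + p B vanished identically, every zero of B would be a zero of A; if B did, every
  zero of A would be a common one.\<close>

lemma member_nonzero: "\<alpha> + smult p \<beta> \<noteq> 0" "\<beta> \<noteq> 0"
proof -
  have n1: "n \<ge> 1" using n by simp
  obtain x y where xy: "(x, y) \<noteq> 0" "B x y = 0" by (rule binary_form_has_zero[OF degree_\<beta> n1])
  show "\<alpha> + smult p \<beta> \<noteq> 0"
  proof
    assume 0: "\<alpha> + smult p \<beta> = 0"
    have "A x y + p * B x y = binary_form n (\<alpha> + smult p \<beta>) x y"
      by (simp add: binary_form_add binary_form_smult)
    then have "A x y = 0" unfolding 0 using xy by (simp add: binary_form_def)
    then show False using no_common_zero xy by blast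
  qed
  obtain x y where xy: "(x, y) \<noteq> 0" "A x y = 0" by (rule binary_form_has_zero[OF degree_\<alpha> n1])
  show "\<beta> \<noteq> 0" using no_common_zero[OF xy(1)] xy(2) by (auto simp: binary_form_def)
qed

text \<open>\<open>B 1 c \<noteq> 0\<close> keeps the fibre over p = infinity, where P = 0, in the
  chart. The last condition says that not every direction is fixed, so the line at infinity is a
  branch of its own for almost all P.\<close>

definition generic :: "complex \<Rightarrow> bool" where
  "generic c \<longleftrightarrow> B 1 c \<noteq> 0 \<and> (lz = 0 \<longrightarrow> lx + c * ly \<noteq> 0) \<and> chart_f c + pCons 0 (chart_g c) \<noteq> 0"

lemma finite_line_bad: "lz = 0 \<Longrightarrow> finite {c. lx + c * ly = 0}"
proof -
  assume "lz = 0"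
  then have "[:lx, ly:] \<noteq> 0" using line_cases by (auto simp: zero_prod_def)
  from poly_roots_finite[OF this] show ?thesis by simp
qed

lemma finite_not_good: "finite {c. \<not> good c p}"
proof -
  have "{c. \<not> good c p} \<subseteq> {p} \<union> {c. poly (\<alpha> + smult p \<beta>) c = 0} \<union> {c. lz = 0 \<and> lx + c * ly = 0}"
    by (auto simp: good_def \<Phi>_def binary_form_1_left[OF degree_\<alpha>] binary_form_1_left[OF degree_\<beta>])
  moreover have "finite ({p} \<union> {c. poly (\<alpha> + smult p \<beta>) c = 0} \<union> {c. lz = 0 \<and> lx + c * ly = 0})"
    using poly_roots_finite[OF member_nonzero(1)] finite_line_bad by (cases "lz = 0") auto
  ultimately show ?thesis by (rule finite_subset)
qed

lemma finite_not_generic: "finite {c. \<not> generic c}"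
proof -
  obtain x y where xy: "x * A x y + y * B x y \<noteq> 0" using nonradial by blast
  have "chart_f c + pCons 0 (chart_g c) \<noteq> 0" if "y - c * x \<noteq> 0" for c
  proof
    assume 0: "chart_f c + pCons 0 (chart_g c) = 0"
    define t S where "t = y - c * x" and "S = x / t"
    have t: "t \<noteq> 0" "x = t * S" "y = t * (1 + c * S)" using that by (auto simp: t_def S_def field_simps)
    have "poly (chart_f c + pCons 0 (chart_g c)) S = S * A S (1 + c * S) + (1 + c * S) * B S (1 + c * S)"
      by (simp add: poly_chart_f poly_chart_g algebra_simps)
    then have "S * A S (1 + c * S) + (1 + c * S) * B S (1 + c * S) = 0" unfolding 0 by simp
    moreover have "x * A x y + y * B x y = t * t ^ n * (S * A S (1 + c * S) + (1 + c * S) * B S (1 + c * S))"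
      unfolding t(2,3) binary_form_scale by (simp add: algebra_simps)
    ultimately show False using xy by simp
  qed
  then have "{c. \<not> generic c} \<subseteq> {c. poly \<beta> c = 0} \<union> {c. lz = 0 \<and> lx + c * ly = 0} \<union> {c. y - c * x = 0}"
    by (auto simp: generic_def binary_form_1_left[OF degree_\<beta>])
  moreover have "finite {c. y - c * x = 0}"
  proof -
    have "[:y, - x:] \<noteq> 0" using xy by auto
    from poly_roots_finite[OF this] show ?thesis by simp
  qed
  then have "finite ({c. poly \<beta> c = 0} \<union> {c. lz = 0 \<and> lx + c * ly = 0} \<union> {c. y - c * x = 0})"
    using poly_roots_finite[OF member_nonzero(2)] finite_line_bad by (cases "lz = 0") auto
  ultimately show ?thesis by (rule finite_subset)
qed

lemma obtain_chart:
  obtains c where "generic c" "good c p"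
proof -
  have "finite ({c. \<not> generic c} \<union> {c. \<not> good c p})"
    using finite_not_generic finite_not_good by blast
  then obtain c where "c \<notin> {c. \<not> generic c} \<union> {c. \<not> good c p}"
    using ex_new_if_finite[OF infinite_UNIV_char_0] by blast
  then show ?thesis using that by blast
qed

lemma finite_not_regular_chart:
  assumes "generic c"
  shows "finite {P. \<not> C.regular c P}"
proof (rule C.finite_not_regular)
  show "1 \<le> n" using n by simp
  show "coeff (chart_f c) n \<noteq> 0 \<or> coeff (chart_g c) n \<noteq> 0"
    using assms by (simp add: generic_def coeff_chart)
  show "chart_e = 0 \<or> (chart_k c = 0 \<and> chart_e = 1 \<and> chart_f c + pCons 0 (chart_g c) \<noteq> 0)"
    using assms unfolding generic_def chart_e_def chart_k_def by simp
qed

definition Preg :: "complex set" where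
  "Preg = {p. (p, 1) \<in> web_regular (n + 1) W}"

text \<open>Read off from the web at q = 1, D belongs to no particular chart, whereas
  \<open>chart_bsum c\<close> is tied to one; this lets results from different charts be
  combined.\<close>

definition D :: "complex \<Rightarrow> complex" where
  "D p = web_curvature (n + 1) W (p, 1)"

lemma Preg_iff: "good c p \<Longrightarrow> p \<in> Preg \<longleftrightarrow> C.regular c (1 / (p - c))"
  using web_regular_iff[of c p 1] by (simp add: Preg_def)

lemma web_regular_eq: "(p, q) \<in> web_regular (n + 1) W \<longleftrightarrow> p \<in> Preg \<and> q \<noteq> 0"
proof -
  obtain c where "good c p" by (rule obtain_chart)
  then show ?thesis using Preg_iff web_regular_iff web_regular_snd by metis
qed

lemma D_eq: "p \<in> Preg \<Longrightarrow> good c p \<Longrightarrow> D p = deriv (chart_bsum c) p"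
  using web_curvature_eq[of p 1 c] by (simp add: D_def Preg_def)

lemma web_curvature_D:
  assumes "p \<in> Preg" "q \<noteq> 0"
  shows "web_curvature (n + 1) W (p, q) = D p / q"
proof -
  obtain c where "good c p" by (rule obtain_chart)
  then show ?thesis using web_curvature_eq[of p q c] D_eq[of p c] assms web_regular_eq by simp
qed

lemma finite_not_Preg: "finite (- Preg)"
proof -
  obtain c where c: "generic c" by (rule obtain_chart)
  have "- Preg \<subseteq> {c} \<union> {p. poly [:A 1 c, B 1 c:] p = 0} \<union> (\<lambda>P. c + 1 / P) ` {P. \<not> C.regular c P}"
  proof
    fix p assume p: "p \<in> - Preg"
    show "p \<in> {c} \<union> {p. poly [:A 1 c, B 1 c:] p = 0} \<union> (\<lambda>P. c + 1 / P) ` {P. \<not> C.regular c P}"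
    proof (rule ccontr)
      assume neg: "\<not> ?thesis"
      then have "good c p" using c by (auto simp: good_def \<Phi>_def generic_def)
      then have "\<not> C.regular c (1 / (p - c))" using p Preg_iff by simp
      moreover have "p = c + 1 / (1 / (p - c))" by simp
      ultimately show False using neg by blast
    qed
  qed
  moreover have "[:A 1 c, B 1 c:] \<noteq> 0" using c by (simp add: generic_def)
  then have "finite ({c} \<union> {p. poly [:A 1 c, B 1 c:] p = 0} \<union> (\<lambda>P. c + 1 / P) ` {P. \<not> C.regular c P})"
    using poly_roots_finite finite_not_regular_chart[OF c] by blast
  ultimately show ?thesis by (rule finite_subset)
qed

lemma open_Preg: "open Preg"
  using finite_imp_closed[OF finite_not_Preg] by (simp add: closed_def)

lemma chart_bsum_has_derivative:
  assumes "p \<in> Preg" "good c p"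
  shows "(chart_bsum c has_field_derivative deriv (C.bsum c) (1 / (p - c)) * - (1 / (p - c))\<^sup>2) (at p)"
proof -
  have pc: "p \<noteq> c" using assms by (simp add: good_def)
  have reg: "C.regular c (1 / (p - c))" using assms Preg_iff by simp
  have 1: "(C.bsum c has_field_derivative deriv (C.bsum c) (1 / (p - c))) (at (1 / (p - c)))"
    using C.bsum_holomorphic C.open_regular reg by (intro holomorphic_derivI) auto
  have 2: "((\<lambda>p. 1 / (p - c)) has_field_derivative - (1 / (p - c))\<^sup>2) (at p)"
    using pc by (auto intro!: derivative_eq_intros simp: field_simps power2_eq_square)
  show ?thesis unfolding chart_bsum_def[abs_def] by (rule DERIV_chain2[OF 1 2])
qed

lemma D_chart:
  assumes "p \<in> Preg" "good c p"
  shows "D p = - (deriv (C.bsum c) (1 / (p - c)) * (1 / (p - c))\<^sup>2)"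
  using D_eq[OF assms] DERIV_imp_deriv[OF chart_bsum_has_derivative[OF assms]] by simp

lemma D_holomorphic: "D holomorphic_on Preg"
  unfolding holomorphic_on_open[OF open_Preg]
proof
  fix p0 assume p0: "p0 \<in> Preg"
  obtain c where c: "good c p0" by (rule obtain_chart)
  define V where "V = Preg \<inter> {p. good c p}"
  have V: "open V" unfolding V_def using open_Preg open_good by blast
  have "\<forall>p\<in>V. \<exists>f'. (chart_bsum c has_field_derivative f') (at p)"
    unfolding V_def using chart_bsum_has_derivative by blast
  then have "chart_bsum c holomorphic_on V" by (simp add: holomorphic_on_open[OF V])
  then have "deriv (chart_bsum c) holomorphic_on V" using V by (rule holomorphic_deriv)
  then have "D holomorphic_on V" by (rule holomorphic_transform) (use D_eq in \<open>auto simp: V_def\<close>)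
  then show "\<exists>f'. (D has_field_derivative f') (at p0)"
    using V p0 c by (auto simp: holomorphic_on_open V_def)
qed

text \<open>The product of P - P0 with \<open>bsum\<close> tends to 0 at an isolated singularity.
  The singularity is therefore removable, and the derivative of the extension is bounded
  nearby.\<close>

lemma tame_deriv_bounded:
  assumes c: "generic c" and t: "C.tame c P0"
  obtains K where "\<forall>\<^sub>F P in at P0. norm (deriv (C.bsum c) P) \<le> K"
proof -
  have fin: "finite {P. \<not> C.regular c P}" by (rule finite_not_regular_chart[OF c])
  have reg: "\<forall>\<^sub>F P in at P0. C.regular c P"
    using eventually_at_notin_finite[OF fin] by simp
  then obtain r where r: "r > 0" "\<And>P. P \<in> ball P0 r - {P0} \<Longrightarrow> C.regular c P"
    unfolding eventually_at by (auto simp: dist_commute)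
  have line: "chart_e = 0 \<or> (chart_k c = 0 \<and> chart_e = 1)"
    unfolding chart_e_def chart_k_def by simp
  have "C.bsum c holomorphic_on ball P0 r - {P0}"
    by (rule holomorphic_on_subset[OF C.bsum_holomorphic]) (use r in auto)
  moreover have "P0 \<in> interior (ball P0 r)" using r(1) by simp
  ultimately obtain G where G: "G holomorphic_on ball P0 r" "\<And>P. P \<in> ball P0 r - {P0} \<Longrightarrow> G P = C.bsum c P"
    using holomorphic_on_extend_lim[of "C.bsum c" "ball P0 r" P0] C.tame_bsum[OF t line reg] by blast
  have op: "open (ball P0 r - {P0})" by (intro open_Diff) auto
  have eq: "deriv (C.bsum c) P = deriv G P" if "P \<in> ball P0 r - {P0}" for P
  proof (rule deriv_cong_ev)
    have "\<forall>\<^sub>F x in nhds P. x \<in> ball P0 r - {P0}" using op that by (rule eventually_nhds_in_open)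
    then show "\<forall>\<^sub>F x in nhds P. C.bsum c x = G x" by eventually_elim (use G(2) in auto)
  qed simp
  have "deriv G holomorphic_on ball P0 r" using G(1) by (intro holomorphic_deriv) auto
  then have "isCont (deriv G) P0"
    using continuous_on_eq_continuous_at[OF open_ball] holomorphic_on_imp_continuous_on r(1) centre_in_ball by blast
  then have "(\<lambda>P. norm (deriv G P)) \<midarrow>P0\<rightarrow> norm (deriv G P0)"
    by (intro tendsto_norm) (simp add: isCont_def)
  then have "\<forall>\<^sub>F P in at P0. norm (deriv G P) < norm (deriv G P0) + 1"
    by (rule order_tendstoD) simp
  moreover have "\<forall>\<^sub>F P in at P0. P \<in> ball P0 r - {P0}"
    unfolding eventually_at using r(1) by (intro exI[of _ r]) (auto simp: dist_commute)
  ultimately have "\<forall>\<^sub>F P in at P0. norm (deriv (C.bsum c) P) \<le> norm (deriv G P0) + 1"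
    by eventually_elim (use eq in auto)
  then show ?thesis by (rule that)
qed

lemma tame_D_bounded:
  assumes c: "generic c" "good c p0" and t: "C.tame c (1 / (p0 - c))"
  shows "\<exists>K. \<forall>\<^sub>F p in at p0. norm (D p) \<le> K"
proof -
  obtain K where K: "\<forall>\<^sub>F P in at (1 / (p0 - c)). norm (deriv (C.bsum c) P) \<le> K"
    by (rule tame_deriv_bounded[OF c(1) t])
  have p0c: "p0 \<noteq> c" using c by (simp add: good_def)
  have tends: "((\<lambda>p. 1 / (p - c)) \<longlongrightarrow> 1 / (p0 - c)) (at p0)"
    using p0c by (intro tendsto_intros) auto
  have "filterlim (\<lambda>p. 1 / (p - c)) (at (1 / (p0 - c))) (at p0)"
    unfolding filterlim_at
  proof (intro conjI tends)
    have "\<forall>\<^sub>F p in at p0. p \<noteq> p0" by (simp add: eventually_at_filter)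
    then show "\<forall>\<^sub>F p in at p0. 1 / (p - c) \<in> UNIV \<and> 1 / (p - c) \<noteq> 1 / (p0 - c)"
      by eventually_elim (use p0c in \<open>auto simp: divide_eq_eq eq_divide_eq split: if_splits\<close>)
  qed
  then have e1: "\<forall>\<^sub>F p in at p0. norm (deriv (C.bsum c) (1 / (p - c))) \<le> K"
    using K by (rule eventually_compose_filterlim[rotated])
  have "((\<lambda>p. norm (1 / (p - c))) \<longlongrightarrow> norm (1 / (p0 - c))) (at p0)" by (rule tendsto_norm[OF tends])
  then have e2: "\<forall>\<^sub>F p in at p0. norm (1 / (p - c)) < norm (1 / (p0 - c)) + 1" by (rule order_tendstoD) simp
  have e3: "\<forall>\<^sub>F p in at p0. good c p"
    using eventually_nhds_in_open[OF open_good, of p0 c] c by (auto simp: eventually_at_filter elim: eventually_mono)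
  have e4: "\<forall>\<^sub>F p in at p0. p \<in> Preg"
    using eventually_at_notin_finite[OF finite_not_Preg, of p0] by simp
  have "\<forall>\<^sub>F p in at p0. norm (D p) \<le> K * (norm (1 / (p0 - c)) + 1)\<^sup>2"
    using e1 e2 e3 e4
  proof eventually_elim
    case (elim p)
    have "norm (D p) = norm (deriv (C.bsum c) (1 / (p - c))) * (norm (1 / (p - c)))\<^sup>2"
      unfolding D_chart[OF elim(4,3)] by (simp add: norm_mult norm_power norm_divide)
    also have "\<dots> \<le> K * (norm (1 / (p0 - c)) + 1)\<^sup>2"
      using elim(1,2) order_trans[OF norm_ge_zero elim(1)] by (intro mult_mono power_mono) auto
    finally show ?case .
  qed
  then show ?thesis by blast
qed

text \<open>D is -b'(P) P^2 with P = 1/(p - c): the change of variable supplies the decay.\<close>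

lemma tame_D_infinity:
  assumes c: "generic c" and t: "C.tame c 0"
  shows "(D \<longlongrightarrow> 0) at_infinity"
proof -
  obtain K where K: "\<forall>\<^sub>F P in at 0. norm (deriv (C.bsum c) P) \<le> K"
    by (rule tame_deriv_bounded[OF c t])
  have "filterlim (\<lambda>p. p + - c) at_infinity at_infinity"
    by (rule tendsto_add_filterlim_at_infinity'[OF filterlim_ident tendsto_const])
  then have fl: "filterlim (\<lambda>p. 1 / (p - c)) (at 0) at_infinity"
    using filterlim_inverse_at_iff[of "\<lambda>p. p + - c" at_infinity] by (simp add: inverse_eq_divide)
  have e1: "\<forall>\<^sub>F p in at_infinity. norm (deriv (C.bsum c) (1 / (p - c))) \<le> K"
    using K fl by (rule eventually_compose_filterlim)
  have "B 1 c \<noteq> 0" using c by (simp add: generic_def)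
  then have "[:A 1 c, B 1 c:] \<noteq> 0" by simp
  from eventually_at_infinity_notin_finite[OF poly_roots_finite[OF this]]
  have "\<forall>\<^sub>F p in at_infinity. \<Phi> p 1 c \<noteq> 0" by (simp add: \<Phi>_def)
  moreover have "\<forall>\<^sub>F p in at_infinity. p \<notin> {c}" by (rule eventually_at_infinity_notin_finite) simp
  ultimately have e3: "\<forall>\<^sub>F p in at_infinity. good c p"
    by eventually_elim (use c in \<open>auto simp: good_def generic_def\<close>)
  have e4: "\<forall>\<^sub>F p in at_infinity. p \<in> Preg"
    using eventually_at_infinity_notin_finite[OF finite_not_Preg] by simp
  have bd: "\<forall>\<^sub>F p in at_infinity. norm (D p) \<le> K * (norm (1 / (p - c)))\<^sup>2"
    using e1 e3 e4
  proof eventually_elim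
    case (elim p)
    show ?case unfolding D_chart[OF elim(3,2)]
      using mult_right_mono[OF elim(1), of "(norm (1 / (p - c)))\<^sup>2"]
      by (simp add: norm_mult norm_power norm_divide)
  qed
  have "((\<lambda>p. K * (norm (1 / (p - c)))\<^sup>2) \<longlongrightarrow> K * (norm (0::complex))\<^sup>2) at_infinity"
    using fl by (intro tendsto_intros) (simp add: filterlim_at)
  then have lim: "((\<lambda>p. K * (norm (1 / (p - c)))\<^sup>2) \<longlongrightarrow> 0) at_infinity" by simp
  show ?thesis by (rule Lim_null_comparison[OF bd lim])
qed

end

section \<open>Critical points and the theorem\<close>

context homogeneous_web
begin

lemma gauss_line_map_H: "gauss_line_map H (y, x) = (- A x y, B x y)"
  by (simp add: eval2_affA eval2_affB)

text \<open>[a:b] is the direction [y:x] with coordinate S = b/(a - c b). Criticality is defined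
  through a/b or b/a, that is, through c + 1/S or S/(1 + c S), and \<open>wronskian_transfer\<close>
  compares these with S.\<close>

lemma p1_critical_chart:
  assumes ab: "a \<noteq> c * b" and S: "b / (a - c * b) \<in> C.fibre c P"
  shows "p1_critical (gauss_line_map H) (a, b) \<longleftrightarrow>
    poly (pderiv (C.member c P)) (b / (a - c * b)) = 0"
proof -
  define S where "S = b / (a - c * b)"
  have Sf: "S \<in> C.fibre c P" using S by (simp add: S_def)
  define u' v' where "u' = poly (pderiv (chart_f c)) S" and "v' = poly (pderiv (chart_g c)) S"
  have "poly (pderiv (C.member c P)) S = 0 \<longleftrightarrow> u' * poly (chart_g c) S = poly (chart_f c) S * v'"
    using C.wronskian_fibre[OF Sf] C.g_nonzero_fibre[OF Sf] by (auto simp: u'_def v'_def)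
  also have "\<dots> \<longleftrightarrow> p1_critical (gauss_line_map H) (a, b)"
  proof (cases "b = 0")
    case False
    define \<tau> where "\<tau> = (\<lambda>s. c + 1 / s)"
    have S0: "S \<noteq> 0" using False ab by (simp add: S_def)
    have \<tau>S: "\<tau> S = a / b" using False ab by (simp add: \<tau>_def S_def field_simps)
    have co: "p1_coord (a, b) (a, b) = a / b" using False by (simp add: p1_coord_def)
    have dA: "(A 1 has_field_derivative poly (pderiv \<alpha>) t) (at t)"
      and dB: "(B 1 has_field_derivative poly (pderiv \<beta>) t) (at t)" for t
      using poly_DERIV[of \<alpha> t] poly_DERIV[of \<beta> t]
      by (simp_all add: binary_form_1_left[OF degree_\<alpha>, abs_def] binary_form_1_left[OF degree_\<beta>, abs_def])
    have ev: "\<forall>\<^sub>F s in nhds S. s \<noteq> 0" using S0 by (rule t1_space_nhds)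
    have "u' * poly (chart_g c) S = poly (chart_f c) S * v' \<longleftrightarrow>
        poly (pderiv \<alpha>) (\<tau> S) * B 1 (\<tau> S) = A 1 (\<tau> S) * poly (pderiv \<beta>) (\<tau> S)"
    proof (rule wronskian_transfer[OF dA dB, where \<kappa> = "\<lambda>s. s ^ n" and c = c and \<tau> = \<tau>
          and S = S and f = "poly (chart_f c)" and g = "poly (chart_g c)"])
      show "((\<lambda>s. s ^ n) has_field_derivative of_nat n * S ^ (n - 1)) (at S)"
        by (auto intro!: derivative_eq_intros)
      show "S ^ n \<noteq> 0" using S0 by simp
      show "(\<tau> has_field_derivative - 1 / S\<^sup>2) (at S)"
        unfolding \<tau>_def using S0 by (auto intro!: derivative_eq_intros simp: power2_eq_square field_simps)
      show "- 1 / S\<^sup>2 \<noteq> 0" using S0 by simp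
      show "(poly (chart_f c) has_field_derivative u') (at S)" "(poly (chart_g c) has_field_derivative v') (at S)"
        by (simp_all add: u'_def v'_def poly_DERIV)
      have eq: "F s (1 + c * s) = s ^ n * F 1 (\<tau> s)" if "s \<noteq> 0" "F = A \<or> F = B" for s F
        using that binary_form_scale[of n \<alpha> s 1 "\<tau> s"] binary_form_scale[of n \<beta> s 1 "\<tau> s"]
        by (auto simp: \<tau>_def algebra_simps)
      show "\<forall>\<^sub>F s in nhds S. poly (chart_f c) s = s ^ n * B 1 (\<tau> s)"
        using ev by eventually_elim (simp add: poly_chart_f eq)
      show "\<forall>\<^sub>F s in nhds S. poly (chart_g c) s = s ^ n * (A 1 (\<tau> s) + c * B 1 (\<tau> s))"
        using ev by eventually_elim (simp add: poly_chart_g eq distrib_left mult.left_commute)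
    qed
    also have "\<dots> \<longleftrightarrow> p1_critical (gauss_line_map H) (a, b)"
      unfolding \<tau>S
    proof (rule p1_critical_iff[of "A 1" _ "(a, b)" "B 1", unfolded co, symmetric])
      show "(A 1 has_field_derivative poly (pderiv \<alpha>) (a / b)) (at (a / b))" by (rule dA)
      show "(B 1 has_field_derivative poly (pderiv \<beta>) (a / b)) (at (a / b))" by (rule dB)
      show "gauss_line_map H (p1_param (a, b) t) = (- A 1 t, B 1 t)" for t
        using False gauss_line_map_H by (simp add: p1_param_def)
      show "A 1 (a / b) \<noteq> 0 \<or> B 1 (a / b) \<noteq> 0"
        using no_common_zero[of 1 "a / b"] by (auto simp: zero_prod_def)
      show "snd (gauss_line_map H (a, b)) = 0 \<longleftrightarrow> B 1 (a / b) = 0"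
        using binary_form_scale[of n \<beta> b 1 "a / b"] False gauss_line_map_H by simp
    qed
    finally show ?thesis .
  next
    case True
    define \<tau> where "\<tau> = (\<lambda>s. s / (1 + c * s))"
    have S0: "S = 0" and a0: "a \<noteq> 0" using True ab by (simp_all add: S_def)
    have \<tau>S: "\<tau> S = 0" by (simp add: \<tau>_def S0)
    have co: "p1_coord (a, b) (a, b) = 0" using True by (simp add: p1_coord_def)
    obtain a' where dA: "((\<lambda>t. A t 1) has_field_derivative a') (at 0)"
      using binary_form_has_derivative_left by blast
    obtain b' where dB: "((\<lambda>t. B t 1) has_field_derivative b') (at 0)"
      using binary_form_has_derivative_left by blast
    have "((\<lambda>s. 1 + c * s) \<longlongrightarrow> 1 + c * S) (nhds S)"
      by (intro tendsto_intros filterlim_ident)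
    then have ev: "\<forall>\<^sub>F s in nhds S. 1 + c * s \<noteq> 0"
      by (rule tendsto_imp_eventually_ne) (simp add: S0)
    have "u' * poly (chart_g c) S = poly (chart_f c) S * v' \<longleftrightarrow> a' * B (\<tau> S) 1 = A (\<tau> S) 1 * b'"
    proof (rule wronskian_transfer[where \<kappa> = "\<lambda>s. (1 + c * s) ^ n" and c = c and \<tau> = \<tau>
          and S = S and f = "poly (chart_f c)" and g = "poly (chart_g c)"
          and u = "\<lambda>t. A t 1" and v = "\<lambda>t. B t 1"])
      show "((\<lambda>t. A t 1) has_field_derivative a') (at (\<tau> S))" unfolding \<tau>S by (rule dA)
      show "((\<lambda>t. B t 1) has_field_derivative b') (at (\<tau> S))" unfolding \<tau>S by (rule dB)
      show "((\<lambda>s. (1 + c * s) ^ n) has_field_derivative of_nat n * (1 + c * S) ^ (n - 1) * c) (at S)"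
        by (auto intro!: derivative_eq_intros)
      show "(1 + c * S) ^ n \<noteq> 0" by (simp add: S0)
      show "(\<tau> has_field_derivative 1) (at S)"
        unfolding \<tau>_def S0 by (auto intro!: derivative_eq_intros)
      show "(poly (chart_f c) has_field_derivative u') (at S)" "(poly (chart_g c) has_field_derivative v') (at S)"
        by (simp_all add: u'_def v'_def poly_DERIV)
      have eq: "F s (1 + c * s) = (1 + c * s) ^ n * F (\<tau> s) 1" if "1 + c * s \<noteq> 0" "F = A \<or> F = B" for s F
        using that binary_form_scale[of n \<alpha> "1 + c * s" "\<tau> s" 1] binary_form_scale[of n \<beta> "1 + c * s" "\<tau> s" 1]
        by (auto simp: \<tau>_def)
      show "\<forall>\<^sub>F s in nhds S. poly (chart_f c) s = (1 + c * s) ^ n * B (\<tau> s) 1"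
        using ev by eventually_elim (simp add: poly_chart_f eq)
      show "\<forall>\<^sub>F s in nhds S. poly (chart_g c) s = (1 + c * s) ^ n * (A (\<tau> s) 1 + c * B (\<tau> s) 1)"
        using ev by eventually_elim (simp add: poly_chart_g eq distrib_left mult.left_commute)
    qed simp
    also have "\<dots> \<longleftrightarrow> p1_critical (gauss_line_map H) (a, b)"
      unfolding \<tau>S
    proof (rule p1_critical_iff[of "\<lambda>t. A t 1" _ "(a, b)" "\<lambda>t. B t 1", unfolded co, symmetric])
      show "((\<lambda>t. A t 1) has_field_derivative a') (at 0)" by (rule dA)
      show "((\<lambda>t. B t 1) has_field_derivative b') (at 0)" by (rule dB)
      show "gauss_line_map H (p1_param (a, b) t) = (- A t 1, B t 1)" for t
        using True gauss_line_map_H by (simp add: p1_param_def)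
      show "A 0 1 \<noteq> 0 \<or> B 0 1 \<noteq> 0"
        using no_common_zero[of 0 1] by (auto simp: zero_prod_def)
      show "snd (gauss_line_map H (a, b)) = 0 \<longleftrightarrow> B 0 1 = 0"
        using binary_form_scale[of n \<beta> a 0 1] True a0 gauss_line_map_H by simp
    qed
    finally show ?thesis .
  qed
  finally show ?thesis by (simp add: S_def)
qed

lemma p1_fixed_iff: "p1_fixed (gauss_line_map H) (y, x) \<longleftrightarrow> x * A x y + y * B x y = 0"
  unfolding p1_fixed_def gauss_line_map_H by (auto simp: eq_neg_iff_add_eq_0 neg_eq_iff_add_eq_0 algebra_simps)

text \<open>x A + y B vanishes at the fixed directions; the factor S - P shows that these are S = P
  in the chart.\<close>

lemma radial_fibre:
  assumes "S \<in> C.fibre c P"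
  shows "S * A S (1 + c * S) + (1 + c * S) * B S (1 + c * S) = (S - P) * poly (chart_g c) S"
proof -
  have "B S (1 + c * S) + P * (A S (1 + c * S) + c * B S (1 + c * S)) = 0"
    using assms by (simp add: C.mem_fibre poly_chart_f poly_chart_g)
  then show ?thesis unfolding poly_chart_g by algebra
qed

text \<open>Failure of tameness supplies a point of an inflection line or of \<ell> whose Gauss
  image lies over the given P. There the hypothesis on the curvature can be applied.\<close>

lemma not_tame_point:
  assumes c0: "coeff (C.member c P) n \<noteq> 0" and l: "lz = 0 \<longrightarrow> lx + c * ly \<noteq> 0" and t: "\<not> C.tame c P"
  obtains S where "S \<in> C.fibre c P" "S \<noteq> P"
    "(S, 1 + c * S, 1) \<in> transverse_inflection H \<or> (lz = 0 \<and> lx * S + ly * (1 + c * S) = 0)"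
proof -
  consider S where "S \<in> C.fibre c P" "S \<noteq> P" "poly (pderiv (C.member c P)) S = 0"
    | "chart_e = 0" "chart_k c \<in> C.fibre c P" "chart_k c \<noteq> P"
    using t c0 unfolding C.tame_def by blast
  then show ?thesis
  proof cases
    case 1
    have crit: "p1_critical (gauss_line_map H) (1 + c * S, S)"
      using p1_critical_chart[of "1 + c * S" c S P] 1 by simp
    have "S * A S (1 + c * S) + (1 + c * S) * B S (1 + c * S) \<noteq> 0"
      unfolding radial_fibre[OF 1(1)] using 1(2) C.g_nonzero_fibre[OF 1(1)] by simp
    then have "\<not> p1_fixed (gauss_line_map H) (1 + c * S, S)" by (simp add: p1_fixed_iff)
    moreover have "(1 + c * S, S) \<noteq> 0" by (auto simp: zero_prod_def)
    moreover have "(S, 1 + c * S, 1) \<in> line (- (1 + c * S), S, 0)"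
      by (simp add: line_def zero_prod_def algebra_simps)
    ultimately have "(S, 1 + c * S, 1) \<in> transverse_inflection H"
      unfolding transverse_inflection_def using crit by blast
    then show ?thesis using that 1 by blast
  next
    case 2
    have lz: "lz = 0" using 2(1) unfolding chart_e_def by (simp split: if_splits)
    then have "chart_k c = - ly / (lx + c * ly)" unfolding chart_k_def by simp
    then have "lx * chart_k c + ly * (1 + c * chart_k c) = 0"
      using l lz by (simp add: field_simps)
    then show ?thesis using that 2 lz by blast
  qed
qed

text \<open>The lines p = const over non-regular values and the line p = infinity; the point (p, q)
  is [p:-1:-q], whence u = -p v and v = 0. A finite union of planes is closed, so it absorbs the
  closure taken in \<open>gauss_image\<close>.\<close>

definition exceptional :: "vec3 set" where
  "exceptional = {\<xi>. fst (snd \<xi>) = 0} \<union> (\<Union>p\<in>- Preg. {\<xi>. fst \<xi> = - p * fst (snd \<xi>)})"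

lemma closed_exceptional: "closed exceptional"
  unfolding exceptional_def
  by (intro closed_Un closed_UN finite_not_Preg ballI closed_Collect_eq continuous_intros)

lemma gauss_image_exceptional:
  assumes "\<And>m. m \<in> X \<Longrightarrow> covector H m \<in> exceptional"
  shows "gauss_image H X \<subseteq> exceptional"
proof -
  have "{(k * u, k * v, k * w) | k u v w. k \<noteq> 0 \<and> (u, v, w) \<noteq> 0 \<and> (\<exists>m\<in>X. (u, v, w) = covector H m)}
      \<subseteq> exceptional"
  proof clarify
    fix k u v w :: complex and m assume "k \<noteq> 0" "m \<in> X" "(u, v, w) = covector H m"
    then have "(u, v, w) \<in> exceptional" using assms by metis
    then show "(k * u, k * v, k * w) \<in> exceptional" by (auto simp: exceptional_def)
  qed
  from closure_minimal[OF this closed_exceptional] show ?thesis by (auto simp: gauss_image_def)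
qed

lemma direction_in_fibre:
  assumes B: "B x y \<noteq> 0" and g: "good c (- A x y / B x y)"
  shows "y \<noteq> c * x" "x / (y - c * x) \<in> C.fibre c (1 / (- A x y / B x y - c))"
proof -
  define p where "p = - A x y / B x y"
  have \<Phi>: "\<Phi> p x y = 0" using B by (simp add: \<Phi>_def p_def)
  have gp: "good c p" using g by (simp add: p_def)
  show t: "y \<noteq> c * x"
  proof
    assume y: "y = c * x"
    then have "x ^ n * \<Phi> p 1 c = 0" using \<Phi>_scale[of p x 1 c] \<Phi> by (simp add: mult.commute)
    then have "x = 0" using gp n by (simp add: good_def)
    then show False using B y n by (simp add: binary_form_0_left power_0_left)
  qed
  define t S where "t = y - c * x" and "S = x / t"
  have "t \<noteq> 0" "x = t * S" "y = t * (1 + c * S)" using t by (auto simp: t_def S_def field_simps)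
  then have "\<Phi> p S (1 + c * S) = 0" using \<Phi> \<Phi>_scale[of p t S "1 + c * S"] by simp
  then show "x / (y - c * x) \<in> C.fibre c (1 / (- A x y / B x y - c))"
    using fibre_chart[of p c S] gp by (simp add: good_def S_def t_def p_def)
qed

text \<open>For B = 0 the image lies on p = infinity, which is always included. Otherwise regularity
  of p = -A/B can be tested in any good chart.\<close>

lemma covector_exceptionalI:
  assumes "\<And>c. B x y \<noteq> 0 \<Longrightarrow> good c (- A x y / B x y) \<Longrightarrow> \<not> C.regular c (1 / (- A x y / B x y - c))"
  shows "covector H (x, y, z) \<in> exceptional"
proof (cases "B x y = 0")
  case False
  obtain c where c: "good c (- A x y / B x y)" by (rule obtain_chart)
  define p where "p = - A x y / B x y"
  have "p \<in> - Preg" using c assms[OF False] Preg_iff by (simp add: p_def)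
  moreover have "z * A x y = - p * (z * B x y)" using False by (simp add: p_def)
  ultimately show ?thesis unfolding covector_H exceptional_def by (intro UnI2 UN_I[of p]) simp_all
qed (simp add: covector_H exceptional_def)

text \<open>A critical direction is a multiple root of the member of the pencil over its image, so
  that image is not regular.\<close>

lemma transverse_inflection_exceptional:
  assumes "m \<in> transverse_inflection H"
  shows "covector H m \<in> exceptional"
proof -
  obtain a b where ab: "(a, b) \<noteq> 0" "p1_critical (gauss_line_map H) (a, b)" "m \<in> line (- a, b, 0)"
    using assms by (auto simp: transverse_inflection_def)
  obtain x y z where m: "m = (x, y, z)" by (cases m)
  have xy: "b * y = a * x" using ab(3) by (simp add: line_def m)
  show ?thesis unfolding m
  proof (rule covector_exceptionalI)
    fix c assume B: "B x y \<noteq> 0" and g: "good c (- A x y / B x y)"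
    note d = direction_in_fibre[OF B g]
    have abc: "a \<noteq> c * b"
    proof
      assume a: "a = c * b"
      then have "b * (y - c * x) = 0" using xy by (simp add: algebra_simps)
      then show False using d(1) a ab(1) by (auto simp: zero_prod_def)
    qed
    have "x * (a - c * b) = b * (y - c * x)" using xy by (simp add: algebra_simps)
    then have S: "x / (y - c * x) = b / (a - c * b)" using d(1) abc by (simp add: frac_eq_eq)
    show "\<not> C.regular c (1 / (- A x y / B x y - c))"
      using C.regularD(4) d(2) ab(2) p1_critical_chart[OF abc] unfolding S by blast
  qed
qed

text \<open>Over the Gauss image of a point of \<ell>, the branch of \<ell> lies in the fibre and
  two foliations of the web coincide.\<close>

lemma line_exceptional:
  assumes lz: "lz = 0" and m: "m \<in> line (lx, ly, lz)"
  shows "covector H m \<in> exceptional"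
proof -
  obtain x y z where xyz: "m = (x, y, z)" by (cases m)
  have xy: "lx * x + ly * y = 0" using m lz by (simp add: line_def xyz)
  show ?thesis unfolding xyz
  proof (rule covector_exceptionalI)
    fix c assume B: "B x y \<noteq> 0" and g: "good c (- A x y / B x y)"
    note d = direction_in_fibre[OF B g]
    have L: "lx + c * ly \<noteq> 0" using g lz unfolding good_def by blast
    have k: "chart_k c = - ly / (lx + c * ly)" "chart_e = 0"
      unfolding chart_k_def chart_e_def using lz by simp_all
    have "x * (lx + c * ly) = - ly * (y - c * x)" using xy by algebra
    then have S: "x / (y - c * x) = - ly / (lx + c * ly)"
      by (subst frac_eq_eq) (use d(1) L in auto)
    have "chart_k c + chart_e * (1 / (- A x y / B x y - c)) = x / (y - c * x)"
      unfolding k S by simp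
    then show "\<not> C.regular c (1 / (- A x y / B x y - c))"
      using C.regularD(3)[of c "1 / (- A x y / B x y - c)"] d(2) by metis
  qed
qed

section \<open>Consequences of holomorphy at points of the curve\<close>

lemma pullback2_id: "pullback2 (\<lambda>z. z) k z = k z"
  by (simp add: pullback2_def pd1_def pd2_def)

text \<open>The curvature is D(p)/q and q0 may be 0. A nearby q1 \<noteq> 0 gives D(p) = q1 h(p, q1)
  with the extension h, which is bounded near p0.\<close>

lemma holomorphic_at_finite:
  assumes hol: "extends_at (web_regular (n + 1) W) (web_curvature (n + 1) W) UNIV (\<lambda>z. z) (p0, q0)"
  shows "\<exists>K. \<forall>\<^sub>F p in at p0. norm (D p) \<le> K"
proof -
  obtain N h where h: "(p0, q0) \<in> N" "holomorphic2_on h N"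
    "\<And>z. z \<in> N \<Longrightarrow> z \<in> web_regular (n + 1) W \<Longrightarrow> h z = web_curvature (n + 1) W z"
    using hol unfolding extends_at_def pullback2_id by blast
  have N: "open N" by (rule holomorphic2_on_open[OF h(2)])
  obtain V X where VX: "open V" "open X" "(p0, q0) \<in> V \<times> X" "V \<times> X \<subseteq> N"
    using open_prod_elim[OF N h(1)] by metis
  have "X \<noteq> {0}" using VX(2) not_open_singleton by blast
  then obtain q1 where q1: "q1 \<in> X" "q1 \<noteq> 0" using VX(3) by auto
  have "isCont (\<lambda>p. h (p, q1)) p0"
  proof (rule isCont_o2[where f = "\<lambda>p. (p, q1)"])
    show "isCont (\<lambda>p. (p, q1)) p0" by (intro continuous_intros)
    show "isCont h (p0, q1)"
      using holomorphic2_on_continuous_on[OF h(2)] continuous_on_eq_continuous_at[OF N] VX q1 by auto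
  qed
  then have "(\<lambda>p. norm (h (p, q1))) \<midarrow>p0\<rightarrow> norm (h (p0, q1))" by (intro tendsto_norm) (simp add: isCont_def)
  then have e1: "\<forall>\<^sub>F p in at p0. norm (h (p, q1)) < norm (h (p0, q1)) + 1" by (rule order_tendstoD) simp
  have e2: "\<forall>\<^sub>F p in at p0. p \<in> Preg"
    using eventually_at_notin_finite[OF finite_not_Preg, of p0] by simp
  have e3: "\<forall>\<^sub>F p in at p0. p \<in> V"
    using VX by (intro eventually_at_in_open') auto
  have "\<forall>\<^sub>F p in at p0. norm (D p) \<le> norm q1 * (norm (h (p0, q1)) + 1)"
    using e1 e2 e3
  proof eventually_elim
    case (elim p)
    have "h (p, q1) = web_curvature (n + 1) W (p, q1)"
      by (rule h(3)) (use elim VX q1 web_regular_eq in auto)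
    then have "h (p, q1) = D p / q1" using web_curvature_D[OF elim(2) q1(2)] by simp
    then have "D p = q1 * h (p, q1)" using q1 by simp
    then show ?case using elim(1) by (simp add: norm_mult mult_left_mono)
  qed
  then show ?thesis by blast
qed

lemma pullback2_infinity:
  assumes "p \<noteq> 0"
  shows "pullback2 (\<lambda>(p', q'). (1 / p', - q' / p')) k (p, q) = k (1 / p, - q / p) * (1 / p ^ 3)"
proof -
  have 1: "((\<lambda>s. 1 / s) has_field_derivative - 1 / p\<^sup>2) (at p)"
    using assms by (auto intro!: derivative_eq_intros simp: power2_eq_square field_simps)
  have 2: "((\<lambda>s. - s / p) has_field_derivative - 1 / p) (at q)"
    using assms by (auto intro!: derivative_eq_intros simp: field_simps)
  show ?thesis
    using DERIV_imp_deriv[OF 1] DERIV_imp_deriv[OF 2] assms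
    by (simp add: pullback2_def pd1_def pd2_def case_prod_unfold power2_eq_square power3_eq_cube)
qed

text \<open>The Jacobian of the chart is 1/p'^3. At (1/p, q1) this means h = D(p) p^3 / (-q1 p), so
  D(p) = -q1 h / p^2 tends to 0.\<close>

lemma holomorphic_at_infinity:
  assumes hol: "extends_at (web_regular (n + 1) W) (web_curvature (n + 1) W) {z. fst z \<noteq> 0}
    (\<lambda>(p', q'). (1 / p', - q' / p')) (0, q0)"
  shows "(D \<longlongrightarrow> 0) at_infinity"
proof -
  obtain N h where h: "(0, q0) \<in> N" "holomorphic2_on h N"
    "\<forall>z\<in>N \<inter> {z. fst z \<noteq> 0}. (case z of (p', q') \<Rightarrow> (1 / p', - q' / p')) \<in> web_regular (n + 1) W \<longrightarrow>
      h z = pullback2 (\<lambda>(p', q'). (1 / p', - q' / p')) (web_curvature (n + 1) W) z"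
    using hol unfolding extends_at_def by blast
  have h3: "h (p, q) = web_curvature (n + 1) W (1 / p, - q / p) * (1 / p ^ 3)"
    if "(p, q) \<in> N" "p \<noteq> 0" "(1 / p, - q / p) \<in> web_regular (n + 1) W" for p q
    using bspec[OF h(3), of "(p, q)"] that pullback2_infinity[OF that(2), of "web_curvature (n + 1) W" q] by simp
  have N: "open N" by (rule holomorphic2_on_open[OF h(2)])
  obtain V X where VX: "open V" "open X" "(0, q0) \<in> V \<times> X" "V \<times> X \<subseteq> N"
    using open_prod_elim[OF N h(1)] by metis
  have "X \<noteq> {0}" using VX(2) not_open_singleton by blast
  then obtain q1 where q1: "q1 \<in> X" "q1 \<noteq> 0" using VX(3) by auto
  have c: "isCont (\<lambda>p. h (p, q1)) 0"
  proof (rule isCont_o2[where f = "\<lambda>p. (p, q1)"])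
    show "isCont (\<lambda>p. (p, q1)) 0" by (intro continuous_intros)
    show "isCont h (0, q1)"
      using holomorphic2_on_continuous_on[OF h(2)] continuous_on_eq_continuous_at[OF N] VX q1 by auto
  qed
  have "((\<lambda>p. inverse p) \<longlongrightarrow> (0::complex)) at_infinity" by (rule tendsto_inverse_0)
  then have inv: "((\<lambda>p. 1 / p) \<longlongrightarrow> (0::complex)) at_infinity" by (simp add: inverse_eq_divide)
  have "((\<lambda>p. h (1 / p, q1)) \<longlongrightarrow> h (0, q1)) at_infinity"
    using isCont_tendsto_compose[OF c inv] by simp
  then have lim: "((\<lambda>p. - q1 * h (1 / p, q1) * (1 / p)\<^sup>2) \<longlongrightarrow> - q1 * h (0, q1) * 0\<^sup>2) at_infinity"
    by (intro tendsto_intros inv)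
  have e2: "\<forall>\<^sub>F p in at_infinity. p \<in> Preg"
    using eventually_at_infinity_notin_finite[OF finite_not_Preg] by simp
  have e3: "\<forall>\<^sub>F p in at_infinity. 1 / p \<in> V"
    using topological_tendstoD[OF inv] VX by auto
  have e4: "\<forall>\<^sub>F p in at_infinity. p \<notin> {0 :: complex}"
    by (rule eventually_at_infinity_notin_finite) simp
  have "\<forall>\<^sub>F p in at_infinity. - q1 * h (1 / p, q1) * (1 / p)\<^sup>2 = D p"
    using e2 e3 e4
  proof eventually_elim
    case (elim p)
    have q: "- q1 / (1 / p) \<noteq> 0" using q1 elim by simp
    have "h (1 / p, q1) = web_curvature (n + 1) W (1 / (1 / p), - q1 / (1 / p)) * (1 / (1 / p) ^ 3)"
      by (rule h3) (use elim VX q1 q web_regular_eq in auto)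
    also have "\<dots> = D p / (- q1 / (1 / p)) * (1 / (1 / p) ^ 3)"
      using web_curvature_D[OF elim(1) q] by simp
    finally have "h (1 / p, q1) = D p / (- q1 * p) * p ^ 3" by (simp add: field_simps)
    then show ?case using q1 elim(3) by (simp add: field_simps power2_eq_square power3_eq_cube)
  qed
  from tendsto_cong[THEN iffD1, OF this lim] show ?thesis by simp
qed

lemma D_bounded_if_holomorphic_on:
  assumes hol: "curvature_holomorphic_on (n + 1) W C" and C: "C \<subseteq> exceptional"
    and \<xi>: "(u0, v0, w0) \<in> C" "v0 \<noteq> 0"
  shows "\<exists>K. \<forall>\<^sub>F p in at (- u0 / v0). norm (D p) \<le> K"
proof -
  let ?hol = "holomorphic_at_dual (web_regular (n + 1) W) (web_curvature (n + 1) W)"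
  define p0 where "p0 = - u0 / v0"
  \<comment> \<open>A neighbourhood that meets no exceptional line except p = p0. The points of C in
    it, among them one where the curvature is holomorphic, lie on that line.\<close>
  define T where "T = {\<xi> :: vec3. fst (snd \<xi>) \<noteq> 0} \<inter> (\<Inter>p\<in>- Preg - {p0}. {\<xi>. fst \<xi> \<noteq> - p * fst (snd \<xi>)})"
  have "open T" unfolding T_def
    by (intro open_Int open_INT finite_Diff finite_not_Preg ballI open_Collect_neq continuous_intros)
  moreover have "(u0, v0, w0) \<in> T" using \<xi>(2) by (auto simp: T_def p0_def field_simps)
  moreover have "(u0, v0, w0) \<in> closure {\<xi> \<in> C. ?hol \<xi>}"
    using hol \<xi>(1) unfolding curvature_holomorphic_on_def by blast
  ultimately have "T \<inter> {\<xi> \<in> C. ?hol \<xi>} \<noteq> {}"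
    using open_Int_closure_eq_empty[of T] by blast
  then obtain u v w where uvw: "(u, v, w) \<in> T" "(u, v, w) \<in> C" "?hol (u, v, w)" by auto
  have v: "v \<noteq> 0" using uvw(1) by (simp add: T_def)
  then obtain p where "p \<in> - Preg" "u = - p * v" using uvw(2) C by (auto simp: exceptional_def)
  moreover from this have "p = p0" using uvw(1) by (auto simp: T_def)
  ultimately have "- u / v = p0" using v by simp
  then have "extends_at (web_regular (n + 1) W) (web_curvature (n + 1) W) UNIV (\<lambda>z. z) (p0, w / v)"
    using uvw(3) v by simp
  then show ?thesis unfolding p0_def[symmetric] by (rule holomorphic_at_finite)
qed

lemma D_infinity_if_holomorphic_on:
  assumes hol: "curvature_holomorphic_on (n + 1) W C" and C: "C \<subseteq> exceptional"
    and \<xi>: "(u0, 0, w0) \<in> C" "u0 \<noteq> 0"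
  shows "(D \<longlongrightarrow> 0) at_infinity"
proof -
  let ?hol = "holomorphic_at_dual (web_regular (n + 1) W) (web_curvature (n + 1) W)"
  \<comment> \<open>Here only the line v = 0 is kept; u \<noteq> 0 removes the point [0:0:1] common
    to all exceptional lines.\<close>
  define T where "T = {\<xi> :: vec3. fst \<xi> \<noteq> 0} \<inter> (\<Inter>p\<in>- Preg. {\<xi>. fst \<xi> \<noteq> - p * fst (snd \<xi>)})"
  have "open T" unfolding T_def
    by (intro open_Int open_INT finite_not_Preg ballI open_Collect_neq continuous_intros)
  moreover have "(u0, 0, w0) \<in> T" using \<xi>(2) by (auto simp: T_def)
  moreover have "(u0, 0, w0) \<in> closure {\<xi> \<in> C. ?hol \<xi>}"
    using hol \<xi>(1) unfolding curvature_holomorphic_on_def by blast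
  ultimately have "T \<inter> {\<xi> \<in> C. ?hol \<xi>} \<noteq> {}"
    using open_Int_closure_eq_empty[of T] by blast
  then obtain u v w where uvw: "(u, v, w) \<in> T" "(u, v, w) \<in> C" "?hol (u, v, w)" by auto
  have "v = 0" using uvw(1,2) C by (auto simp: T_def exceptional_def)
  moreover have "u \<noteq> 0" using uvw(1) by (simp add: T_def)
  ultimately have "extends_at (web_regular (n + 1) W) (web_curvature (n + 1) W) {z. fst z \<noteq> 0}
    (\<lambda>(p', q'). (1 / p', - q' / p')) (0, w / u)"
    using uvw(3) by simp
  then show ?thesis by (rule holomorphic_at_infinity)
qed

text \<open>Stated for any C to serve both cases of the theorem. \<open>L\<close> concerns only
  points with x A + y B \<noteq> 0, so it holds vacuously if \<ell> is invariant.\<close>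

lemma flat_if_holomorphic_on:
  assumes hol: "curvature_holomorphic_on (n + 1) W C" and C: "C \<subseteq> exceptional"
    and TI: "\<And>m. m \<in> transverse_inflection H \<Longrightarrow> covector H m \<noteq> 0 \<Longrightarrow> covector H m \<in> C"
    and L: "\<And>x y. lz = 0 \<Longrightarrow> lx * x + ly * y = 0 \<Longrightarrow> x * A x y + y * B x y \<noteq> 0 \<Longrightarrow>
      covector H (x, y, 1) \<in> C"
  shows "flat_web (n + 1) W"
proof -
  have point: "covector H (S, 1 + c * S, 1) \<in> C"
    if S: "S \<in> C.fibre c P" "S \<noteq> P"
      "(S, 1 + c * S, 1) \<in> transverse_inflection H \<or> (lz = 0 \<and> lx * S + ly * (1 + c * S) = 0)" for S c P
  proof -
    have "S * A S (1 + c * S) + (1 + c * S) * B S (1 + c * S) \<noteq> 0"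
      unfolding radial_fibre[OF S(1)] using S(2) C.g_nonzero_fibre[OF S(1)] by simp
    moreover from this have "covector H (S, 1 + c * S, 1) \<noteq> 0"
      unfolding covector_H zero_prod_def prod.inject neg_equal_0_iff_equal by blast
    ultimately show ?thesis using S(3) TI L by blast
  qed
  have AB: "A S (1 + c * S) \<noteq> 0 \<or> B S (1 + c * S) \<noteq> 0" for S c
    using no_common_zero[of S "1 + c * S"] by (auto simp: zero_prod_def)
  have fin: "\<exists>K. \<forall>\<^sub>F p in at p0. norm (D p) \<le> K" for p0
  proof -
    obtain c where c: "generic c" "good c p0" by (rule obtain_chart)
    show ?thesis
    proof (cases "C.tame c (1 / (p0 - c))")
      case True
      then show ?thesis using tame_D_bounded c by blast
    next
      case False
      have pc: "p0 \<noteq> c" using c(2) by (simp add: good_def)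
      obtain S where S: "S \<in> C.fibre c (1 / (p0 - c))" "S \<noteq> 1 / (p0 - c)"
        "(S, 1 + c * S, 1) \<in> transverse_inflection H \<or> (lz = 0 \<and> lx * S + ly * (1 + c * S) = 0)"
        using not_tame_point[OF coeff_member_good[OF c(2)] _ False] c(1) unfolding generic_def by blast
      have \<Phi>: "A S (1 + c * S) + p0 * B S (1 + c * S) = 0"
        using S(1) by (simp add: fibre_chart[OF pc] \<Phi>_def)
      then have B: "B S (1 + c * S) \<noteq> 0" using AB[of S c] by auto
      then have p0: "- A S (1 + c * S) / B S (1 + c * S) = p0"
        using \<Phi> by (simp add: field_simps neg_eq_iff_add_eq_0 add.commute)
      show ?thesis
        using D_bounded_if_holomorphic_on[OF hol C point[OF S, unfolded covector_H]] B p0 by simp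
    qed
  qed
  have inf: "(D \<longlongrightarrow> 0) at_infinity"
  proof -
    obtain c where c: "generic c" by (rule obtain_chart)
    show ?thesis
    proof (cases "C.tame c 0")
      case True
      then show ?thesis using tame_D_infinity c by blast
    next
      case False
      have "coeff (C.member c 0) n \<noteq> 0" using c by (simp add: C.member_def coeff_chart generic_def)
      then obtain S where S: "S \<in> C.fibre c 0" "S \<noteq> 0"
        "(S, 1 + c * S, 1) \<in> transverse_inflection H \<or> (lz = 0 \<and> lx * S + ly * (1 + c * S) = 0)"
        using not_tame_point[OF _ _ False] c unfolding generic_def by blast
      have B: "B S (1 + c * S) = 0" using S(1) by (simp add: C.mem_fibre poly_chart_f)
      then have A: "A S (1 + c * S) \<noteq> 0" using AB[of S c] by auto
      show ?thesis
        by (rule D_infinity_if_holomorphic_on[OF hol C]) (use point[OF S, unfolded covector_H] A B in auto)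
    qed
  qed
  have "D holomorphic_on UNIV - (- Preg)" using D_holomorphic by simp
  then obtain D' where D': "D' holomorphic_on UNIV" "\<And>p. p \<in> Preg \<Longrightarrow> D' p = D p"
    using holomorphic_extend_finite[OF finite_not_Preg _ fin] by auto
  have "\<forall>\<^sub>F p in at_infinity. D p = D' p"
    using eventually_at_infinity_notin_finite[OF finite_not_Preg] by eventually_elim (simp add: D'(2))
  then have "(D' \<longlongrightarrow> 0) at_infinity" using inf tendsto_cong by blast
  then have "D' p = 0" for p by (rule Liouville_weak_0[OF D'(1)])
  then have D0: "D p = 0" if "p \<in> Preg" for p using D'(2)[OF that] by simp
  show ?thesis
    unfolding flat_web_def
  proof
    fix z assume z: "z \<in> web_regular (n + 1) W"
    obtain p q where pq: "z = (p, q)" by (cases z)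
    then have "p \<in> Preg" "q \<noteq> 0" using z web_regular_eq by auto
    then show "web_curvature (n + 1) W z = 0" using web_curvature_D D0 pq by simp
  qed
qed

end

section \<open>The converse and the two cases of the theorem\<close>

lemma holomorphic_on_if_flat:
  assumes "flat_web d W" "0 \<notin> C"
  shows "curvature_holomorphic_on d W C"
proof -
  have ext: "extends_at (web_regular d W) (web_curvature d W) X \<phi> z" for X \<phi> z
    unfolding extends_at_def
  proof (intro exI conjI ballI impI)
    show "z \<in> UNIV" by simp
    show "holomorphic2_on (\<lambda>_. 0) UNIV" by (rule holomorphic2_on_const) simp
    fix w assume "\<phi> w \<in> web_regular d W"
    then show "0 = pullback2 \<phi> (web_curvature d W) w"
      using assms(1) by (simp add: flat_web_def pullback2_def)
  qed
  have "holomorphic_at_dual (web_regular d W) (web_curvature d W) \<xi>" for \<xi>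
    by (cases \<xi>) (simp add: ext)
  then have "{\<xi> \<in> C. holomorphic_at_dual (web_regular d W) (web_curvature d W) \<xi>} = C" by blast
  then show ?thesis unfolding curvature_holomorphic_on_def by (simp add: closure_subset)
qed

lemma gauss_image_Un: "gauss_image H (X \<union> Y) = gauss_image H X \<union> gauss_image H Y"
proof -
  define S :: "vec3 set \<Rightarrow> vec3 set" where "S = (\<lambda>X. {(k * u, k * v, k * w) | k u v w.
    k \<noteq> 0 \<and> (u, v, w) \<noteq> 0 \<and> (\<exists>m\<in>X. (u, v, w) = covector H m)})"
  have "S (X \<union> Y) = S X \<union> S Y" unfolding S_def by blast
  then have "closure (S (X \<union> Y)) - {0} = (closure (S X) - {0}) \<union> (closure (S Y) - {0})"
    by (simp add: closure_Un Un_Diff)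
  then show ?thesis by (simp add: gauss_image_def S_def)
qed

lemma zero_notin_gauss_image: "0 \<notin> gauss_image H X"
  by (simp add: gauss_image_def)

lemma covector_in_gauss_image:
  assumes "m \<in> X" "covector H m \<noteq> 0"
  shows "covector H m \<in> gauss_image H X"
proof -
  obtain u v w where uvw: "covector H m = (u, v, w)" by (cases "covector H m")
  have "covector H m \<in> {(k * u, k * v, k * w) | k u v w.
    k \<noteq> 0 \<and> (u, v, w) \<noteq> 0 \<and> (\<exists>m\<in>X. (u, v, w) = covector H m)}"
    unfolding mem_Collect_eq
  proof (intro exI conjI)
    show "covector H m = (1 * u, 1 * v, 1 * w)" "(1 :: complex) \<noteq> 0" using uvw by simp_all
    show "(u, v, w) \<noteq> 0" using assms(2) uvw by simp
    show "\<exists>m\<in>X. (u, v, w) = covector H m" using assms(1) uvw by metis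
  qed
  from subsetD[OF closure_subset this] show ?thesis using assms(2) by (simp add: gauss_image_def)
qed

theorem theorem3p7:
  fixes d :: nat and l :: vec3 and H :: form3
  assumes "d \<ge> 3"
    and "homogeneous_prefoliation d l H"
  shows "(invariant_line l H \<longrightarrow>
            (flat_web d (leg d l H) \<longleftrightarrow>
             curvature_holomorphic_on d (leg d l H) (gauss_image H (transverse_inflection H)))) \<and>
         (\<not> invariant_line l H \<longrightarrow>
            gauss_image H (transverse_inflection H) \<union> gauss_image H (line l) =
              gauss_image H (transverse_inflection H \<union> line l) \<and>
            (flat_web d (leg d l H) \<longleftrightarrow>
             curvature_holomorphic_on d (leg d l H)
               (gauss_image H (transverse_inflection H) \<union> gauss_image H (line l))))"
proof -
  obtain lx ly lz where l: "l = (lx, ly, lz)" by (cases l)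
  have l0: "l \<noteq> 0" and fol: "foliation (d - 1) H"
    using assms(2) by (auto simp: homogeneous_prefoliation_def prefoliation_def)
  have hom: "homothety 2 ` line l = line l" "\<exists>k. \<forall>m v.
      pair3 (covector H (homothety 2 m)) (homothety 2 v) = k * pair3 (covector H m) v"
    using assms(2) unfolding homogeneous_prefoliation_def by (metis zero_neq_numeral)+
  then obtain \<kappa> where \<kappa>: "\<And>m v. pair3 (covector H (homothety 2 m)) (homothety 2 v) =
      \<kappa> * pair3 (covector H m) v" by blast
  obtain \<alpha> \<beta> where forms: "degree \<alpha> \<le> d - 1" "degree \<beta> \<le> d - 1"
    "\<And>x y. eval2 (affA H) x y = binary_form (d - 1) \<alpha> x y"
    "\<And>x y. eval2 (affB H) x y = binary_form (d - 1) \<beta> x y"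
    "\<And>j. coeff (affA H) j = (if j \<le> d - 1 then monom (coeff \<alpha> j) (d - 1 - j) else 0)"
    "\<And>j. coeff (affB H) j = (if j \<le> d - 1 then monom (coeff \<beta> j) (d - 1 - j) else 0)"
    "\<And>x y z. covector H (x, y, z) =
      (z * binary_form (d - 1) \<alpha> x y, z * binary_form (d - 1) \<beta> x y,
       - (x * binary_form (d - 1) \<alpha> x y + y * binary_form (d - 1) \<beta> x y))"
    "\<And>x y. (x, y) \<noteq> 0 \<Longrightarrow> \<not> (binary_form (d - 1) \<alpha> x y = 0 \<and> binary_form (d - 1) \<beta> x y = 0)"
    "\<exists>x y. x * binary_form (d - 1) \<alpha> x y + y * binary_form (d - 1) \<beta> x y \<noteq> 0"
    by (rule homogeneous_foliation_forms[OF assms(1) fol \<kappa>]) (rule that; assumption)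
  interpret homogeneous_web "d - 1" \<alpha> \<beta> lx ly lz H
  proof
    show "(lz = 0 \<and> (lx, ly) \<noteq> 0) \<or> (lx = 0 \<and> ly = 0 \<and> lz \<noteq> 0)"
      using homogeneous_line[of lx ly lz] hom(1) l0 l by (auto simp: zero_prod_def)
  qed (use assms(1) forms in auto)
  have d: "d - 1 + 1 = d" using assms(1) by simp
  have W: "leg d l H = W" unfolding W_def d l ..
  \<comment> \<open>(0, 0, 1) lies in the plane of every line through the origin, and the form at
    (x, y, 0) takes the value -(x A + y B) on it.\<close>
  have invariant: "x * A x y + y * B x y = 0"
    if inv: "invariant_line l H" and xy: "lz = 0" "lx * x + ly * y = 0" for x y
  proof -
    have "pair3 l (x, y, 0) = 0 \<and> pair3 l (0, 0, 1) = 0" using xy by (simp add: l)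
    then have "pair3 (covector H (x, y, 0)) (0, 0, 1) = 0"
      using inv unfolding invariant_line_def by blast
    then show ?thesis by (simp add: covector_H add_eq_0_iff)
  qed
  \<comment> \<open>The line at infinity is invariant: at z = 0 the form is a multiple of
    dz.\<close>
  have lz: "lz = 0" if "\<not> invariant_line l H"
  proof (rule ccontr)
    assume lz: "lz \<noteq> 0"
    then have l': "lx = 0" "ly = 0" using line_cases by auto
    have "pair3 (covector H m) v = 0" if "pair3 l m = 0 \<and> pair3 l v = 0" for m v
    proof -
      obtain x y z x' y' z' where mv: "m = (x, y, z)" "v = (x', y', z')" by (cases m, cases v)
      then have "z = 0" "z' = 0" using that lz l' by (simp_all add: l)
      then show ?thesis by (simp add: mv covector_H)
    qed
    then show False using \<open>\<not> invariant_line l H\<close> unfolding invariant_line_def by blast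
  qed
  let ?TI = "gauss_image H (transverse_inflection H)"
  have TI: "?TI \<subseteq> exceptional"
    by (rule gauss_image_exceptional[OF transverse_inflection_exceptional])
  have 1: "flat_web d (leg d l H)" if inv: "invariant_line l H"
    and hol: "curvature_holomorphic_on d (leg d l H) ?TI"
  proof -
    have "flat_web (d - 1 + 1) W"
    proof (rule flat_if_holomorphic_on[OF _ TI])
      show "curvature_holomorphic_on (d - 1 + 1) W ?TI" using hol unfolding W d .
    qed (use covector_in_gauss_image invariant[OF inv] in blast)+
    then show ?thesis unfolding W d .
  qed
  have 2: "flat_web d (leg d l H)" if inv: "\<not> invariant_line l H"
    and hol: "curvature_holomorphic_on d (leg d l H) (?TI \<union> gauss_image H (line l))"
  proof -
    have "flat_web (d - 1 + 1) W"
    proof (rule flat_if_holomorphic_on)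
      show "curvature_holomorphic_on (d - 1 + 1) W (?TI \<union> gauss_image H (line l))"
        using hol unfolding W d .
      have "gauss_image H (line l) \<subseteq> exceptional"
        by (rule gauss_image_exceptional, rule line_exceptional[OF lz[OF inv]]) (simp add: l)
      then show "?TI \<union> gauss_image H (line l) \<subseteq> exceptional" using TI by blast
      show "covector H (x, y, 1) \<in> ?TI \<union> gauss_image H (line l)"
        if "lz = 0" "lx * x + ly * y = 0" "x * A x y + y * B x y \<noteq> 0" for x y
      proof -
        have "(x, y, 1) \<in> line l" using that by (simp add: line_def l zero_prod_def)
        moreover have "covector H (x, y, 1) \<noteq> 0"
          using that(3) unfolding covector_H zero_prod_def prod.inject neg_equal_0_iff_equal by blast
        ultimately show ?thesis using covector_in_gauss_image by blast
      qed
    qed (use covector_in_gauss_image in blast)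
    then show ?thesis unfolding W d .
  qed
  show ?thesis
    using 1 2 gauss_image_Un[of H] holomorphic_on_if_flat zero_notin_gauss_image
    by (metis Un_iff)
qed

end
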